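(* Let $K$ be a field of characteristic zero, $\mathfrak u$ a finite-dimensional nilpotent Lie algebra over $K$, and suppose the unipotent group $U=\exp(\mathfrak u)$ acts rationally on an irreducible affine algebraic variety $X$ over $K$. Put $\mathcal A=K[X]$, and let $a_{k,0},a_{k,1}$ ($1\le k\le m$), the $U$-projector $P$, the $U$-invariant open subset $X_0\subseteq X$ and the subset $$\mathfrak S=\{x\in X_0:\ a_{k,1}(x)=0,\ 1\le k\le m\}$$ be as constructed in the context. Let $\mathrm{Res}:K[X_0]\to K[\mathfrak S]$ be the restriction mapping. Assume that the system $\{a_{k,1}:1\le k\le m\}$ generates the defining ideal of $\mathfrak S$ in the algebra $K[X_0]$. Let $b_1,\dots,b_s\in\mathcal A$ be elements such that $$\mathrm{Res}(b_1),\dots,\mathrm{Res}(b_s),\ \mathrm{Res}(a_{1,0})^{\pm1},\dots,\mathrm{Res}(a_{m,0})^{\pm1}$$ generate the algebra $K[\mathfrak S]$. Then $P(b_1),\dots,P(b_s),a_{1,0}^{\pm1},\dots,a_{m,0}^{\pm1}$ generate the algebra of invariants $K[X_0]^U$. In particular, $P(b_1),\dots,P(b_s),a_{1,0}^{\pm1},\dots,a_{m,0}^{\pm1}$ generate the field of invariants $K(X)^U$.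
   Context: $U$ acts on $\mathcal A=K[X]$ by $T_gf(x)=f(g^{-1}x)$, and $D=d_eT$ is the corresponding representation of $\mathfrak u$ on $\mathcal A$; each $D_x$, $x\in\mathfrak u$, is a locally nilpotent derivation of $\mathcal A$. For a $\mathfrak u$-stable algebra $\mathcal B$ in $\mathcal F=\mathrm{Frac}(\mathcal A)=K(X)$ and a subalgebra $\mathfrak v\subseteq\mathfrak u$, $\mathcal B^{\mathfrak v}$ is the subalgebra annihilated by all $D_x$, $x\in\mathfrak v$. Construction. Fix a chain of ideals $\mathfrak u=\mathfrak u_n\supset\mathfrak u_{n-1}\supset\cdots\supset\mathfrak u_1\supset\mathfrak u_0=\{0\}$ of $\mathfrak u$ with $\mathfrak u_{i}$ of codimension $1$ in $\mathfrak u_{i+1}$. Put $i_0=0$, $\mathcal A_0=\mathcal A$. Inductively for $k\ge 1$, if $\mathcal A_{k-1}^{\mathfrak u}\ne\mathcal A_{k-1}^{\mathfrak u_{i_{k-1}}}$, let $i_k$ be the least index with $\mathcal A_{k-1}^{\mathfrak u_{i_k}}\neq \mathcal A_{k-1}^{\mathfrak u_{i_{k-1}}}$ and fix $x_{i_k}\in\mathfrak u_{i_k}\setminus\mathfrak u_{i_k-1}$. There exist $a_{k,1}\in\mathcal A_{k-1}^{\mathfrak u_{i_{k-1}}}$ and $0\ne a_{k,0}\in\mathcal A_{k-1}^{\mathfrak u}$ with $D_{x_{i_k}}(a_{k,1})=a_{k,0}$; fix such elements. Let $\mathcal A_k=\mathcal A_{k-1}[a_{k,0}^{-1}]\subset\mathcal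 F$, $Q_k=a_{k,1}a_{k,0}^{-1}$, and define $$S_k:\mathcal A_{k-1}^{\mathfrak u_{i_{k-1}}}\to\mathcal A_k^{\mathfrak u_{i_k}},\qquad S_k(a)=\sum_{j\ge 0}(-1)^jD_{x_{i_k}}^j(a)\frac{Q_k^j}{j!}.$$ The process stops at some $k=m$, when $\mathcal A_m^{\mathfrak u}=\mathcal A_m^{\mathfrak u_{i_m}}$. Put $P=S_m\circ\cdots\circ S_1$; it is a homomorphism $\mathcal A\to\mathcal A_m^{\mathfrak u}$ identical on $\mathcal A^{\mathfrak u}$. Thus $a_{k,0},a_{k,1}$ are rational functions on $X$ lying in the localization of $K[X]$ at the denominators generated by $a_{1,0},\dots,a_{k-1,0}$, and the $a_{k,0}$ are $U$-invariant. The set $X_0=\{x\in X: a_{k,0}(x)\ne0,\ 1\le k\le m\}$ (conditions imposed successively for $k=1,\dots,m$) is open, affine, and $K[X_0]=\mathcal A_m$. $K[\mathfrak S]$ is the quotient of $K[X_0]$ by the defining (vanishing) ideal of $\mathfrak S$. The homomorphism $P$ extends to $K[X_0]\to K[X_0]^U$, identical on $K[X_0]^U$. *)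

theory Defs
  imports Complex_Main "HOL-Library.Function_Algebras"
begin

section \<open>Generated algebras and fields\<close>

text \<open>
  The algebra over a field of scalars generated by a set \<open>G\<close>. The map \<open>h\<close> is the structure
  map (the inclusion of the scalars); in particular \<open>h 1\<close> is the unit. It is passed explicitly
  because functions on a subset are represented below by total functions vanishing off that
  subset, so that their unit is not the constant function 1.
\<close>

inductive_set gen_alg :: "('k \<Rightarrow> 'a::{plus,times}) \<Rightarrow> 'a set \<Rightarrow> 'a set"
  for h :: "'k \<Rightarrow> 'a" and G :: "'a set" where
  scalar: "h c \<in> gen_alg h G"
| gen: "g \<in> G \<Longrightarrow> g \<in> gen_alg h G"
| add: "\<lbrakk>f \<in> gen_alg h G; g \<in> gen_alg h G\<rbrakk> \<Longrightarrow> f + g \<in> gen_alg h G"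
| mult: "\<lbrakk>f \<in> gen_alg h G; g \<in> gen_alg h G\<rbrakk> \<Longrightarrow> f * g \<in> gen_alg h G"

inductive_set gen_field :: "('k \<Rightarrow> 'a::field) \<Rightarrow> 'a set \<Rightarrow> 'a set"
  for h :: "'k \<Rightarrow> 'a" and G :: "'a set" where
  scalar: "h c \<in> gen_field h G"
| gen: "g \<in> G \<Longrightarrow> g \<in> gen_field h G"
| add: "\<lbrakk>f \<in> gen_field h G; g \<in> gen_field h G\<rbrakk> \<Longrightarrow> f + g \<in> gen_field h G"
| mult: "\<lbrakk>f \<in> gen_field h G; g \<in> gen_field h G\<rbrakk> \<Longrightarrow> f * g \<in> gen_field h G"
| inv: "f \<in> gen_field h G \<Longrightarrow> inverse f \<in> gen_field h G"

definition restr :: "'a set \<Rightarrow> ('a \<Rightarrow> 'l::zero) \<Rightarrow> 'a \<Rightarrow> 'l" where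
  "restr S f = (\<lambda>p. if p \<in> S then f p else 0)"


section \<open>Nilpotent Lie algebras and the group \<open>exp \<uu>\<close>\<close>

locale lie_algebra = vector_space scale
  for scale :: "'k::field \<Rightarrow> 'u::ab_group_add \<Rightarrow> 'u" +
  fixes br :: "'u \<Rightarrow> 'u \<Rightarrow> 'u"
  assumes br_add_left: "br (x + y) z = br x z + br y z"
    and br_add_right: "br x (y + z) = br x y + br x z"
    and br_scale_left: "br (scale c x) y = scale c (br x y)"
    and br_scale_right: "br x (scale c y) = scale c (br x y)"
    and br_self: "br x x = 0"
    and jacobi: "br x (br y z) + br y (br z x) + br z (br x y) = 0"

primrec lower_central ::
    "('k::field \<Rightarrow> 'u::ab_group_add \<Rightarrow> 'u) \<Rightarrow> ('u \<Rightarrow> 'u \<Rightarrow> 'u) \<Rightarrow> nat \<Rightarrow> 'u set" where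
  "lower_central scale br 0 = UNIV"
| "lower_central scale br (Suc i) =
     module.span scale {br x y |x y. y \<in> lower_central scale br i}"

definition fd_nilpotent_lie_algebra ::
    "('k::field \<Rightarrow> 'u::ab_group_add \<Rightarrow> 'u) \<Rightarrow> ('u \<Rightarrow> 'u \<Rightarrow> 'u) \<Rightarrow> bool" where
  "fd_nilpotent_lie_algebra scale br \<longleftrightarrow>
     lie_algebra scale br \<and>
     (\<exists>B. finite B \<and> module.span scale B = UNIV) \<and>
     (\<exists>i. lower_central scale br i = {0})"

definition lie_ideal ::
    "('k::field \<Rightarrow> 'u::ab_group_add \<Rightarrow> 'u) \<Rightarrow> ('u \<Rightarrow> 'u \<Rightarrow> 'u) \<Rightarrow> 'u set \<Rightarrow> bool" where
  "lie_ideal scale br I \<longleftrightarrow> module.subspace scale I \<and> (\<forall>x. \<forall>y\<in>I. br x y \<in> I)"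

text \<open>
  The group \<open>exp \<uu>\<close> is the set \<open>\<uu>\<close> with the Baker--Campbell--Hausdorff product
  \<open>log (exp x exp y)\<close>, given by Dynkin's formula: a pair list \<open>[(r\<^sub>1,s\<^sub>1),\<dots>,(r\<^sub>n,s\<^sub>n)]\<close>
  with all \<open>r\<^sub>i + s\<^sub>i > 0\<close> contributes
  \<open>(-1)^(n-1) / n \<cdot> [x^r\<^sub>1 y^s\<^sub>1 \<dots> x^r\<^sub>n y^s\<^sub>n] / ((\<Sum>(r\<^sub>i + s\<^sub>i)) \<cdot> \<Prod> r\<^sub>i! s\<^sub>i!)\<close>,
  where \<open>[\<dots>]\<close> is the right-nested bracket of the word. If \<open>\<uu>\<close> is nilpotent, only finitely many
  terms are nonzero. The unit is \<open>0\<close> and the inverse of \<open>exp x\<close> is \<open>exp (- x)\<close>.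
\<close>

fun nested_bracket :: "('u::zero \<Rightarrow> 'u \<Rightarrow> 'u) \<Rightarrow> 'u list \<Rightarrow> 'u" where
  "nested_bracket br [] = 0"
| "nested_bracket br [x] = x"
| "nested_bracket br (x # y # ys) = br x (nested_bracket br (y # ys))"

definition dynkin_word :: "'u \<Rightarrow> 'u \<Rightarrow> (nat \<times> nat) list \<Rightarrow> 'u list" where
  "dynkin_word x y ps = concat (map (\<lambda>(r, s). replicate r x @ replicate s y) ps)"

definition dynkin_coeff :: "(nat \<times> nat) list \<Rightarrow> 'k::field_char_0" where
  "dynkin_coeff ps =
     (-1) ^ (length ps - 1) /
     (of_nat (length ps) * of_nat (\<Sum>(r, s)\<leftarrow>ps. r + s) * (\<Prod>(r, s)\<leftarrow>ps. fact r * fact s))"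

definition dynkin_term ::
    "('k::field_char_0 \<Rightarrow> 'u::ab_group_add \<Rightarrow> 'u) \<Rightarrow> ('u \<Rightarrow> 'u \<Rightarrow> 'u) \<Rightarrow> 'u \<Rightarrow> 'u \<Rightarrow>
     (nat \<times> nat) list \<Rightarrow> 'u" where
  "dynkin_term scale br x y ps = scale (dynkin_coeff ps) (nested_bracket br (dynkin_word x y ps))"

definition bch ::
    "('k::field_char_0 \<Rightarrow> 'u::ab_group_add \<Rightarrow> 'u) \<Rightarrow> ('u \<Rightarrow> 'u \<Rightarrow> 'u) \<Rightarrow> 'u \<Rightarrow> 'u \<Rightarrow> 'u" where
  "bch scale br x y =
     (\<Sum>ps | ps \<noteq> [] \<and> (\<forall>(r, s)\<in>set ps. r + s > 0) \<and> dynkin_term scale br x y ps \<noteq> 0.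
        dynkin_term scale br x y ps)"


section \<open>Affine varieties with an action of \<open>exp \<uu>\<close>\<close>

text \<open>
  The points of the variety have coordinates in an extension field \<open>'l\<close> of the ground field
  \<open>'k\<close>, whereas all equations, regular functions and morphisms have coefficients in \<open>'k\<close>.
  Taking \<open>'l\<close> algebraically closed gives geometric points, and \<open>'l = 'k\<close> gives \<open>'k\<close>-points.
  The record contains:

  \<^item> \<open>ext\<close>: the embedding of \<open>'k\<close> into \<open>'l\<close>;
  \<^item> \<open>smult\<close>, \<open>bracket\<close>: the Lie algebra structure of \<open>\<uu>\<close> (the whole type \<open>'u\<close>);
  \<^item> \<open>points\<close>: the variety \<open>X\<close>, a subset of the affine space \<open>'n \<Rightarrow> 'l\<close>;
  \<^item> \<open>act y\<close>: the action of the group element \<open>exp y\<close> on \<open>X\<close>;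
  \<^item> \<open>emb\<close>: an embedding of \<open>K[X]\<close> into a field, in which \<open>K(X)\<close> is realised as the subfield
    of fractions of \<open>K[X]\<close>.
\<close>

record ('k, 'l, 'n, 'u, 'f) uvariety =
  ext :: "'k \<Rightarrow> 'l"
  smult :: "'k \<Rightarrow> 'u \<Rightarrow> 'u"
  bracket :: "'u \<Rightarrow> 'u \<Rightarrow> 'u"
  points :: "('n \<Rightarrow> 'l) set"
  act :: "'u \<Rightarrow> ('n \<Rightarrow> 'l) \<Rightarrow> ('n \<Rightarrow> 'l)"
  emb :: "(('n \<Rightarrow> 'l) \<Rightarrow> 'l) \<Rightarrow> 'f"

definition field_embedding :: "('k::field \<Rightarrow> 'l::field) \<Rightarrow> bool" where
  "field_embedding e \<longleftrightarrow>
     e 1 = 1 \<and> (\<forall>a b. e (a + b) = e a + e b) \<and> (\<forall>a b. e (a * b) = e a * e b)"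

definition poly_funs :: "('k, 'l::comm_ring_1, 'n, 'u, 'f) uvariety \<Rightarrow> (('n \<Rightarrow> 'l) \<Rightarrow> 'l) set" where
  "poly_funs W = gen_alg (\<lambda>c p. ext W c) (range (\<lambda>i p. p i))"

definition zariski_closed :: "('k, 'l::comm_ring_1, 'n, 'u, 'f) uvariety \<Rightarrow> ('n \<Rightarrow> 'l) set \<Rightarrow> bool" where
  "zariski_closed W Z \<longleftrightarrow> (\<exists>I\<subseteq>poly_funs W. Z = {p. \<forall>f\<in>I. f p = 0})"

definition irreducible_affine_variety :: "('k, 'l::comm_ring_1, 'n, 'u, 'f) uvariety \<Rightarrow> bool" where
  "irreducible_affine_variety W \<longleftrightarrow>
     zariski_closed W (points W) \<and> points W \<noteq> {} \<and>
     (\<forall>Y Z. zariski_closed W Y \<longrightarrow> zariski_closed W Z \<longrightarrow> points W \<subseteq> Y \<union> Z \<longrightarrow>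
        points W \<subseteq> Y \<or> points W \<subseteq> Z)"

text \<open>The coordinate ring \<open>K[X]\<close>, as functions on \<open>X\<close> (extended by \<open>0\<close> off \<open>X\<close>).\<close>

definition coord_ring :: "('k, 'l::comm_ring_1, 'n, 'u, 'f) uvariety \<Rightarrow> (('n \<Rightarrow> 'l) \<Rightarrow> 'l) set" where
  "coord_ring W = restr (points W) ` poly_funs W"

text \<open>
  \<open>exp \<uu>\<close> acts on \<open>X\<close>, and the action map \<open>exp \<uu> \<times> X \<rightarrow> X\<close> is a morphism: its coordinates are
  polynomials in the linear functionals on \<open>\<uu>\<close> and the coordinates of the point of \<open>X\<close>.
\<close>

definition rational_action ::
    "('k::field_char_0, 'l::field_char_0, 'n, 'u::ab_group_add, 'f) uvariety \<Rightarrow> bool" where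
  "rational_action W \<longleftrightarrow>
     (\<forall>y. \<forall>p\<in>points W. act W y p \<in> points W) \<and>
     (\<forall>p\<in>points W. act W 0 p = p) \<and>
     (\<forall>y z. \<forall>p\<in>points W. act W (bch (smult W) (bracket W) y z) p = act W y (act W z p)) \<and>
     (\<forall>i. \<exists>F \<in> gen_alg (\<lambda>c q. ext W c)
                 ({\<lambda>q. ext W (l (fst q)) |l. Vector_Spaces.linear (smult W) (*) l} \<union>
                  {\<lambda>q. snd q j |j. True}).
        \<forall>y. \<forall>p\<in>points W. act W y p i = F (y, p))"

definition fraction_embedding :: "('k, 'l::comm_ring_1, 'n, 'u, 'f::field) uvariety \<Rightarrow> bool" where
  "fraction_embedding W \<longleftrightarrow>
     emb W (restr (points W) (\<lambda>p. 1)) = 1 \<and>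
     (\<forall>f\<in>coord_ring W. \<forall>g\<in>coord_ring W. emb W (f + g) = emb W f + emb W g) \<and>
     (\<forall>f\<in>coord_ring W. \<forall>g\<in>coord_ring W. emb W (f * g) = emb W f * emb W g) \<and>
     inj_on (emb W) (coord_ring W)"

definition function_field :: "('k, 'l::comm_ring_1, 'n, 'u, 'f::field) uvariety \<Rightarrow> 'f set" where
  "function_field W =
     {emb W f / emb W g |f g. f \<in> coord_ring W \<and> g \<in> coord_ring W \<and> g \<noteq> 0}"

definition scalar_ff :: "('k, 'l::comm_ring_1, 'n, 'u, 'f) uvariety \<Rightarrow> 'k \<Rightarrow> 'f" where
  "scalar_ff W c = emb W (restr (points W) (\<lambda>p. ext W c))"

definition regular_at :: "('k, 'l::field, 'n, 'u, 'f::field) uvariety \<Rightarrow> 'f \<Rightarrow> ('n \<Rightarrow> 'l) \<Rightarrow> bool" where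
  "regular_at W r p \<longleftrightarrow>
     (\<exists>f\<in>coord_ring W. \<exists>g\<in>coord_ring W. g p \<noteq> 0 \<and> r = emb W f / emb W g)"

text \<open>The value at \<open>p \<in> X\<close> of a rational function regular at \<open>p\<close>.\<close>

definition ff_value :: "('k, 'l::field, 'n, 'u, 'f::field) uvariety \<Rightarrow> 'f \<Rightarrow> ('n \<Rightarrow> 'l) \<Rightarrow> 'l" where
  "ff_value W r p =
     (THE v. \<exists>f\<in>coord_ring W. \<exists>g\<in>coord_ring W.
        g p \<noteq> 0 \<and> r = emb W f / emb W g \<and> v = f p / g p)"


section \<open>The representations \<open>T\<close> of the group and \<open>D = d\<^sub>eT\<close> of the Lie algebra\<close>

definition trans_fun ::
    "('k, 'l::zero, 'n, 'u::ab_group_add, 'f) uvariety \<Rightarrow> 'u \<Rightarrow> (('n \<Rightarrow> 'l) \<Rightarrow> 'l) \<Rightarrow> ('n \<Rightarrow> 'l) \<Rightarrow> 'l" where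
  "trans_fun W y f = restr (points W) (\<lambda>p. f (act W (- y) p))"

definition trans ::
    "('k, 'l::comm_ring_1, 'n, 'u::ab_group_add, 'f::field) uvariety \<Rightarrow> 'u \<Rightarrow> 'f \<Rightarrow> 'f" where
  "trans W y r =
     (THE r'. \<exists>f\<in>coord_ring W. \<exists>g\<in>coord_ring W. g \<noteq> 0 \<and>
        r = emb W f / emb W g \<and> r' = emb W (trans_fun W y f) / emb W (trans_fun W y g))"

text \<open>
  \<open>t \<mapsto> T (exp (t x)) f\<close> is a polynomial \<open>c 0 + t c 1 + \<dots>\<close> in \<open>t \<in> K\<close> with coefficients in \<open>K[X]\<close>;
  its derivative at \<open>t = 0\<close> is \<open>c 1\<close>.
\<close>

definition deriv_fun ::
    "('k, 'l::comm_ring_1, 'n, 'u::ab_group_add, 'f) uvariety \<Rightarrow>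
     'u \<Rightarrow> (('n \<Rightarrow> 'l) \<Rightarrow> 'l) \<Rightarrow> ('n \<Rightarrow> 'l) \<Rightarrow> 'l" where
  "deriv_fun W x f =
     (THE g. \<exists>d c. (\<forall>j\<le>Suc d. c j \<in> coord_ring W) \<and>
        (\<forall>t p. trans_fun W (smult W t x) f p = (\<Sum>j\<le>Suc d. ext W t ^ j * c j p)) \<and> g = c 1)"

text \<open>The extension of the derivation to \<open>K(X)\<close>, by the quotient rule.\<close>

definition deriv_ff ::
    "('k, 'l::comm_ring_1, 'n, 'u::ab_group_add, 'f::field) uvariety \<Rightarrow> 'u \<Rightarrow> 'f \<Rightarrow> 'f" where
  "deriv_ff W x r =
     (THE r'. \<exists>f\<in>coord_ring W. \<exists>g\<in>coord_ring W. g \<noteq> 0 \<and> r = emb W f / emb W g \<and>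
        r' = (emb W (deriv_fun W x f) * emb W g - emb W f * emb W (deriv_fun W x g)) / (emb W g)\<^sup>2)"

definition group_invariants ::
    "('k, 'l::comm_ring_1, 'n, 'u::ab_group_add, 'f::field) uvariety \<Rightarrow> 'f set \<Rightarrow> 'f set" where
  "group_invariants W B = {r \<in> B. \<forall>y. trans W y r = r}"

definition lie_invariants ::
    "('k, 'l::comm_ring_1, 'n, 'u::ab_group_add, 'f::field) uvariety \<Rightarrow> 'f set \<Rightarrow> 'u set \<Rightarrow> 'f set" where
  "lie_invariants W B V = {r \<in> B. \<forall>x\<in>V. deriv_ff W x r = 0}"


section \<open>The construction of the \<open>U\<close>-projector\<close>

definition ideal_chain ::
    "('k::field, 'l, 'n, 'u::ab_group_add, 'f) uvariety \<Rightarrow> nat \<Rightarrow> (nat \<Rightarrow> 'u set) \<Rightarrow> bool" where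
  "ideal_chain W n \<uu> \<longleftrightarrow>
     \<uu> 0 = {0} \<and> \<uu> n = UNIV \<and>
     (\<forall>i\<le>n. lie_ideal (smult W) (bracket W) (\<uu> i)) \<and>
     (\<forall>i<n. \<uu> i \<subset> \<uu> (Suc i) \<and>
        vector_space.dim (smult W) (\<uu> (Suc i)) = vector_space.dim (smult W) (\<uu> i) + 1)"

text \<open>The algebras \<open>\<A>\<^sub>k\<close>.\<close>

primrec loc_alg ::
    "('k, 'l::comm_ring_1, 'n, 'u, 'f::field) uvariety \<Rightarrow> (nat \<Rightarrow> 'f) \<Rightarrow> nat \<Rightarrow> 'f set" where
  "loc_alg W a0 0 = emb W ` coord_ring W"
| "loc_alg W a0 (Suc k) =
     gen_alg (scalar_ff W) (loc_alg W a0 k \<union> {inverse (a0 (Suc k))})"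

text \<open>
  \<open>i k\<close> is the index \<open>i\<^sub>k\<close>, and \<open>x k\<close> is the element \<open>x\<^bsub>i\<^sub>k\<^esub>\<close>. The least index \<open>i\<^sub>k\<close> is sought among
  the indices greater than \<open>i\<^sub>k\<^sub>-\<^sub>1\<close>: passing to a smaller ideal may enlarge the algebra of
  invariants as well.
\<close>

definition projector_data ::
    "('k, 'l::comm_ring_1, 'n, 'u::ab_group_add, 'f::field) uvariety \<Rightarrow> nat \<Rightarrow> (nat \<Rightarrow> 'u set) \<Rightarrow>
     nat \<Rightarrow> (nat \<Rightarrow> nat) \<Rightarrow> (nat \<Rightarrow> 'u) \<Rightarrow> (nat \<Rightarrow> 'f) \<Rightarrow> (nat \<Rightarrow> 'f) \<Rightarrow> bool" where
  "projector_data W n \<uu> m i x a0 a1 \<longleftrightarrow>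
     i 0 = 0 \<and>
     (\<forall>k\<in>{1..m}.
        let A = loc_alg W a0 (k - 1); inv_prev = lie_invariants W A (\<uu> (i (k - 1))) in
        lie_invariants W A UNIV \<noteq> inv_prev \<and>
        i k = (LEAST j. i (k - 1) < j \<and> j \<le> n \<and> lie_invariants W A (\<uu> j) \<noteq> inv_prev) \<and>
        x k \<in> \<uu> (i k) - \<uu> (i k - 1) \<and>
        a1 k \<in> inv_prev \<and>
        a0 k \<in> lie_invariants W A UNIV \<and> a0 k \<noteq> 0 \<and>
        deriv_ff W (x k) (a1 k) = a0 k) \<and>
     lie_invariants W (loc_alg W a0 m) UNIV = lie_invariants W (loc_alg W a0 m) (\<uu> (i m))"

text \<open>
  \<open>S D Q a = \<Sum>\<^sub>j (-1)^j D^j(a) Q^j / j!\<close>; the sum is finite wherever \<open>D\<close> is locally nilpotent.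
\<close>

definition S_map :: "('f::field_char_0 \<Rightarrow> 'f) \<Rightarrow> 'f \<Rightarrow> 'f \<Rightarrow> 'f" where
  "S_map D Q a = (\<Sum>j | (D ^^ j) a \<noteq> 0. (-1) ^ j * (D ^^ j) a * (Q ^ j / fact j))"

text \<open>\<open>projector W x a0 a1 m\<close> is \<open>P = S\<^sub>m \<circ> \<dots> \<circ> S\<^sub>1\<close>, with \<open>Q\<^sub>k = a\<^sub>k\<^sub>,\<^sub>1 / a\<^sub>k\<^sub>,\<^sub>0\<close>.\<close>

primrec projector ::
    "('k, 'l::comm_ring_1, 'n, 'u::ab_group_add, 'f::field_char_0) uvariety \<Rightarrow>
     (nat \<Rightarrow> 'u) \<Rightarrow> (nat \<Rightarrow> 'f) \<Rightarrow> (nat \<Rightarrow> 'f) \<Rightarrow> nat \<Rightarrow> 'f \<Rightarrow> 'f" where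
  "projector W x a0 a1 0 = id"
| "projector W x a0 a1 (Suc k) =
     S_map (deriv_ff W (x (Suc k))) (a1 (Suc k) / a0 (Suc k)) \<circ> projector W x a0 a1 k"

definition X0 ::
    "('k, 'l::field, 'n, 'u, 'f::field) uvariety \<Rightarrow> (nat \<Rightarrow> 'f) \<Rightarrow> nat \<Rightarrow> ('n \<Rightarrow> 'l) set" where
  "X0 W a0 m =
     {p \<in> points W. \<forall>k\<in>{1..m}. regular_at W (a0 k) p \<and> ff_value W (a0 k) p \<noteq> 0}"

text \<open>The coordinate ring \<open>K[X\<^sub>0] = \<A>\<^sub>m\<close> of the open affine subset \<open>X\<^sub>0\<close>.\<close>

definition coord_ring_X0 ::
    "('k, 'l::comm_ring_1, 'n, 'u, 'f::field) uvariety \<Rightarrow> (nat \<Rightarrow> 'f) \<Rightarrow> nat \<Rightarrow> 'f set" where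
  "coord_ring_X0 W a0 m = loc_alg W a0 m"

text \<open>The subset \<open>\<SS>\<close> of \<open>X\<^sub>0\<close>.\<close>

definition slice ::
    "('k, 'l::field, 'n, 'u, 'f::field) uvariety \<Rightarrow> (nat \<Rightarrow> 'f) \<Rightarrow> (nat \<Rightarrow> 'f) \<Rightarrow> nat \<Rightarrow> ('n \<Rightarrow> 'l) set" where
  "slice W a0 a1 m = {p \<in> X0 W a0 m. \<forall>k\<in>{1..m}. ff_value W (a1 k) p = 0}"

definition slice_ideal ::
    "('k, 'l::field, 'n, 'u, 'f::field) uvariety \<Rightarrow> (nat \<Rightarrow> 'f) \<Rightarrow> (nat \<Rightarrow> 'f) \<Rightarrow> nat \<Rightarrow> 'f set" where
  "slice_ideal W a0 a1 m =
     {r \<in> coord_ring_X0 W a0 m. \<forall>p\<in>slice W a0 a1 m. ff_value W r p = 0}"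

text \<open>
  \<open>Res : K[X\<^sub>0] \<rightarrow> K[\<SS>]\<close>. The kernel of the restriction of functions to \<open>\<SS>\<close> is the defining
  ideal of \<open>\<SS>\<close>, so its image is the quotient of \<open>K[X\<^sub>0]\<close> by that ideal.
\<close>

definition Res ::
    "('k, 'l::field, 'n, 'u, 'f::field) uvariety \<Rightarrow> (nat \<Rightarrow> 'f) \<Rightarrow> (nat \<Rightarrow> 'f) \<Rightarrow> nat \<Rightarrow>
     'f \<Rightarrow> ('n \<Rightarrow> 'l) \<Rightarrow> 'l" where
  "Res W a0 a1 m r = restr (slice W a0 a1 m) (ff_value W r)"

definition coord_ring_slice ::
    "('k, 'l::field, 'n, 'u, 'f::field) uvariety \<Rightarrow> (nat \<Rightarrow> 'f) \<Rightarrow> (nat \<Rightarrow> 'f) \<Rightarrow> nat \<Rightarrow>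
     (('n \<Rightarrow> 'l) \<Rightarrow> 'l) set" where
  "coord_ring_slice W a0 a1 m = Res W a0 a1 m ` coord_ring_X0 W a0 m"

definition scalar_slice ::
    "('k, 'l::field, 'n, 'u, 'f::field) uvariety \<Rightarrow> (nat \<Rightarrow> 'f) \<Rightarrow> (nat \<Rightarrow> 'f) \<Rightarrow> nat \<Rightarrow>
     'k \<Rightarrow> ('n \<Rightarrow> 'l) \<Rightarrow> 'l" where
  "scalar_slice W a0 a1 m c = restr (slice W a0 a1 m) (\<lambda>p. ext W c)"

end

theory Submission
  imports "HOL-Computational_Algebra.Polynomial" Defs
begin

text \<open>
  Each map \<open>S\<^sub>k\<close> substitutes \<open>t = - Q\<^sub>k\<close> into \<open>exp (t D) a\<close>, where \<open>D = D\<^sub>x\<close> for \<open>x = x k\<close>. Since \<open>D\<close> is a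
  locally nilpotent derivation, this is a ring homomorphism that fixes the kernel of \<open>D\<close>; since
  \<open>D Q\<^sub>k = 1\<close>, its values are killed by \<open>D\<close>. Because the \<open>\<uu> j\<close> are ideals and the index \<open>i k\<close> is minimal,
  \<open>S\<^sub>k\<close> leads from the functions annihilated by \<open>\<uu> (i (k - 1))\<close> to those annihilated by \<open>\<uu> (i k)\<close>
  (\<open>S_annihilated\<close>). So the composite \<open>P\<close> is a ring homomorphism from \<open>K[X\<^sub>0]\<close> onto the invariants which
  is the identity there, and \<open>P a\<^sub>k\<^sub>,\<^sub>1 = 0\<close> for every \<open>k\<close>, as \<open>S\<^sub>k a\<^sub>k\<^sub>,\<^sub>1 = a\<^sub>k\<^sub>,\<^sub>1 - a\<^sub>k\<^sub>,\<^sub>0 Q\<^sub>k\<close>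
  (\<open>projector_kills_a1\<close>).

  The statement on algebras is now formal. The elements \<open>a\<^sub>k\<^sub>,\<^sub>1\<close> generate the ideal of the slice, so \<open>P\<close>
  vanishes on that ideal and two functions with the same restriction to the slice have the same
  projection (\<open>projector_determined_by_res\<close>). Every function on \<open>X\<^sub>0\<close> has the same restriction to the slice as a
  polynomial expression in the \<open>b\<^sub>j\<close> and the \<open>a\<^sub>k\<^sub>,\<^sub>0\<close> and their inverses; \<open>P\<close> applied to this expression is the same
  expression in the \<open>P b\<^sub>j\<close> and the \<open>a\<^sub>k\<^sub>,\<^sub>0\<close>, which are invariant. For the field of invariants it remains
  to write an invariant fraction as a quotient of invariants in \<open>K[X]\<close>: its denominators form a
  nonzero \<open>\<uu>\<close>-stable ideal, and a nonzero space on which a nilpotent Lie algebra acts by locally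
  nilpotent operators contains a nonzero invariant (\<open>invariant_denominator\<close>).

  All of this needs that \<open>x \<mapsto> D\<^sub>x\<close> is a representation of \<open>\<uu>\<close> by locally nilpotent derivations whose
  invariants are those of the group, whereas only a morphic action of the group with the
  Baker--Campbell--Hausdorff product is given. The product satisfies \<open>exp (s x) exp (t x) = exp ((s + t) x)\<close>, which makes
  \<open>T (exp (t x))\<close> the exponential series of \<open>t D\<^sub>x\<close> (\<open>flow_exp_series\<close>). The bracket is obtained from the
  coefficient of \<open>s t\<close> in \<open>exp (s x) exp (t y) = exp (s x + t y + s t [x,y] / 2 + \<dots>)\<close>
  (\<open>deriv_fun_linear_and_bracket\<close>).
\<close>

section \<open>Images of generated algebras\<close>

lemma gen_alg_image:
  assumes "\<And>c. \<phi> (h c) = h' c"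
    and "\<And>f g. f \<in> gen_alg h G \<Longrightarrow> g \<in> gen_alg h G \<Longrightarrow> \<phi> (f + g) = \<phi> f + \<phi> g"
    and "\<And>f g. f \<in> gen_alg h G \<Longrightarrow> g \<in> gen_alg h G \<Longrightarrow> \<phi> (f * g) = \<phi> f * \<phi> g"
  shows "\<phi> ` gen_alg h G = gen_alg h' (\<phi> ` G)"
proof
  show "\<phi> ` gen_alg h G \<subseteq> gen_alg h' (\<phi> ` G)"
  proof
    fix r assume "r \<in> \<phi> ` gen_alg h G"
    then obtain f where "f \<in> gen_alg h G" "r = \<phi> f" by blast
    then show "r \<in> gen_alg h' (\<phi> ` G)"
    proof (induction f arbitrary: r rule: gen_alg.induct)
      case (scalar c)
      then show ?case by (simp add: assms(1) gen_alg.scalar)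
    next
      case (gen g)
      then show ?case by (simp add: gen_alg.gen)
    next
      case (add f g)
      then show ?case by (simp add: assms(2) gen_alg.add)
    next
      case (mult f g)
      then show ?case by (simp add: assms(3) gen_alg.mult)
    qed
  qed
  show "gen_alg h' (\<phi> ` G) \<subseteq> \<phi> ` gen_alg h G"
  proof
    fix r assume "r \<in> gen_alg h' (\<phi> ` G)"
    then show "r \<in> \<phi> ` gen_alg h G"
    proof (induction r rule: gen_alg.induct)
      case (scalar c)
      then show ?case by (metis assms(1) gen_alg.scalar imageI)
    next
      case (gen g)
      then show ?case by (auto intro: gen_alg.gen)
    next
      case (add f g)
      then obtain f' g' where "f' \<in> gen_alg h G" "f = \<phi> f'" "g' \<in> gen_alg h G" "g = \<phi> g'" by blast
      then show ?case using assms(2)[of f' g'] gen_alg.add[of f' h G g'] by (metis imageI)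
    next
      case (mult f g)
      then obtain f' g' where "f' \<in> gen_alg h G" "f = \<phi> f'" "g' \<in> gen_alg h G" "g = \<phi> g'" by blast
      then show ?case using assms(3)[of f' g'] gen_alg.mult[of f' h G g'] by (metis imageI)
    qed
  qed
qed

section \<open>The group law near the unit\<close>

locale nilpotent_lie_algebra = lie_algebra scale br
  for scale :: "'k::field_char_0 \<Rightarrow> 'u::ab_group_add \<Rightarrow> 'u" and br +
  assumes nilpotent: "\<exists>i. lower_central scale br i = {0}"
begin

lemma br_zero_right [simp]: "br x 0 = 0"
  using br_add_right[of x 0 0] by simp

lemma br_minus_right: "br x (- y) = - br x y"
  using br_add_right[of x y "- y"] by (simp add: eq_neg_iff_add_eq_0 add.commute)

lemma br_swap: "br y x = - br x y"
proof -
  have "br (x + y) (x + y) = br x x + br x y + (br y x + br y y)"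
    by (simp only: br_add_left br_add_right add_ac)
  then have "br x y + br y x = 0" by (simp add: br_self)
  then show ?thesis by (simp add: eq_neg_iff_add_eq_0 add.commute)
qed

lemma br_minus_left: "br (- x) y = - br x y"
  by (metis br_minus_right br_swap)

lemma nested_bracket_in_lower_central:
  "ws \<noteq> [] \<Longrightarrow> nested_bracket br ws \<in> lower_central scale br (length ws - 1)"
proof (induction br ws rule: nested_bracket.induct)
  case (3 br x y ys)
  then show ?case by (auto intro!: span_base)
qed auto

text \<open>
  This makes the sum over all words in Dynkin's formula finite, with a bound that does not depend on
  the arguments.
\<close>

lemma long_brackets_vanish: "\<exists>N. \<forall>ws. length ws > N \<longrightarrow> nested_bracket br ws = 0"
proof -
  obtain i where i: "lower_central scale br i = {0}" using nilpotent by blast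
  have "lower_central scale br (i + j) = {0}" for j
    by (induction j) (auto simp: i)
  then have vanish: "lower_central scale br j = {0}" if "j \<ge> i" for j
    using that le_Suc_ex by blast
  have "nested_bracket br ws = 0" if "length ws > i" for ws
    using nested_bracket_in_lower_central[of ws] vanish[of "length ws - 1"] that
    by (cases "ws = []") auto
  then show ?thesis by blast
qed

lemma nested_bracket_scale:
  "nested_bracket br (map (\<lambda>(c, w). scale c w) ls) =
     scale (prod_list (map fst ls)) (nested_bracket br (map snd ls))"
proof (induction ls)
  case (Cons a ls)
  then show ?case
    by (cases ls) (auto simp: br_scale_left br_scale_right split: prod.splits)
qed simp

end

definition word_degree :: "(nat \<times> nat) list \<Rightarrow> nat \<times> nat" where
  "word_degree ps = (sum_list (map fst ps), sum_list (map snd ps))"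

lemma map_dynkin_word: "map g (dynkin_word x y ps) = dynkin_word (g x) (g y) ps"
  by (induction ps) (auto simp: dynkin_word_def)

lemma prod_list_dynkin_word:
  "prod_list (dynkin_word s t ps) =
     (s :: 'a::comm_semiring_1) ^ fst (word_degree ps) * t ^ snd (word_degree ps)"
  by (induction ps)
     (auto simp: dynkin_word_def word_degree_def prod_list_replicate power_add mult_ac)

lemma length_dynkin_word:
  "length (dynkin_word x y ps) = fst (word_degree ps) + snd (word_degree ps)"
  by (induction ps) (auto simp: dynkin_word_def word_degree_def)

text \<open>
  The indices of the words of length at most \<open>N\<close>. Unlike the index set in the definition of \<open>bch\<close>, which is the
  support of the sum, this set does not vary with the arguments, so that coefficients can be compared.
\<close>

definition dynkin_indices :: "nat \<Rightarrow> (nat \<times> nat) list set" where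
  "dynkin_indices N = {ps. ps \<noteq> [] \<and> (\<forall>(r, s)\<in>set ps. r + s > 0) \<and>
     fst (word_degree ps) + snd (word_degree ps) \<le> N}"

lemma dynkin_index_bounds:
  assumes "\<forall>(r, s)\<in>set ps. r + s > 0"
  shows "length ps \<le> fst (word_degree ps) + snd (word_degree ps)"
    and "set ps \<subseteq> {..fst (word_degree ps)} \<times> {..snd (word_degree ps)}"
  using assms by (induction ps) (auto simp: word_degree_def)

lemma finite_dynkin_indices: "finite (dynkin_indices N)"
proof (rule finite_subset)
  show "dynkin_indices N \<subseteq> {ps. set ps \<subseteq> {..N} \<times> {..N} \<and> length ps \<le> N}"
  proof
    fix ps assume ps: "ps \<in> dynkin_indices N"
    then have "\<forall>(r, s)\<in>set ps. r + s > 0" by (auto simp: dynkin_indices_def)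
    from dynkin_index_bounds[OF this] ps
    show "ps \<in> {ps. set ps \<subseteq> {..N} \<times> {..N} \<and> length ps \<le> N}"
      unfolding dynkin_indices_def by fastforce
  qed
qed (rule finite_lists_length_le, simp)

text \<open>
  The words of Dynkin's formula of degree at most one in each of \<open>x\<close> and \<open>y\<close> are few enough to be
  listed.
\<close>

lemma dynkin_indices_low_degree:
  assumes "ps \<in> dynkin_indices N"
  shows "word_degree ps \<noteq> (0, 0)"
    and "word_degree ps = (1, 0) \<longleftrightarrow> ps = [(1, 0)]"
    and "word_degree ps = (0, 1) \<longleftrightarrow> ps = [(0, 1)]"
    and "word_degree ps = (1, 1) \<longleftrightarrow> ps \<in> {[(1, 1)], [(1, 0), (0, 1)], [(0, 1), (1, 0)]}"
proof -
  have pos: "ps \<noteq> []" "\<forall>(r, s)\<in>set ps. r + s > 0"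
    using assms by (auto simp: dynkin_indices_def)
  obtain p qs where ps: "ps = p # qs" using pos by (cases ps) auto
  obtain r s where p: "p = (r, s)" by (cases p)
  have qs: "\<forall>(r, s)\<in>set qs. r + s > 0" and rs: "r + s > 0" using pos ps p by auto
  note len = dynkin_index_bounds(1)[OF qs]
  have deg: "word_degree ps = (r + fst (word_degree qs), s + snd (word_degree qs))"
    by (simp add: ps p word_degree_def)
  show "word_degree ps \<noteq> (0, 0)" using deg rs by auto
  have qs0: "word_degree qs = (0, 0) \<longleftrightarrow> qs = []"
  proof
    assume "word_degree qs = (0, 0)"
    then show "qs = []" using len by simp
  qed (simp add: word_degree_def)
  have qs1: "word_degree qs = (a, b) \<longleftrightarrow> qs = [(a, b)]" if "a + b = 1" for a b
  proof
    assume *: "word_degree qs = (a, b)"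
    then have "length qs \<le> 1" "qs \<noteq> []" using len that by (auto simp: word_degree_def)
    then obtain q where "qs = [q]" by (cases qs) auto
    with * show "qs = [(a, b)]" by (cases q) (auto simp: word_degree_def)
  qed (auto simp: word_degree_def)
  have w: "word_degree ps = (c, d) \<longleftrightarrow>
      (\<exists>a b. word_degree qs = (a, b) \<and> r + a = c \<and> s + b = d)" for c d
    unfolding deg by (cases "word_degree qs") auto
  show "word_degree ps = (1, 0) \<longleftrightarrow> ps = [(1, 0)]"
    unfolding w using qs0 rs ps p by (auto simp: add_is_1)
  show "word_degree ps = (0, 1) \<longleftrightarrow> ps = [(0, 1)]"
    unfolding w using qs0 rs ps p by (auto simp: add_is_1)
  show "word_degree ps = (1, 1) \<longleftrightarrow> ps \<in> {[(1, 1)], [(1, 0), (0, 1)], [(0, 1), (1, 0)]}"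
    unfolding w using qs0 qs1[of 1 0] qs1[of 0 1] rs ps p by (auto simp: add_is_1)
qed

context nilpotent_lie_algebra
begin

text \<open>
  A nested bracket is homogeneous in each of its entries, which turns the product of \<open>s x\<close> and \<open>t y\<close>
  into a polynomial in \<open>s\<close> and \<open>t\<close>. Arbitrarily large \<open>N\<close> are admitted to ensure that the words of low
  degree are among the indices.
\<close>

lemma bch_expansion:
  "\<exists>N0. \<forall>N\<ge>N0. \<forall>s t. bch scale br (scale s x) (scale t y) =
     (\<Sum>ps\<in>dynkin_indices N.
        scale (s ^ fst (word_degree ps) * t ^ snd (word_degree ps) * dynkin_coeff ps)
          (nested_bracket br (dynkin_word x y ps)))"
proof -
  obtain N0 where N0: "\<And>ws. length ws > N0 \<Longrightarrow> nested_bracket br ws = 0"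
    using long_brackets_vanish by blast
  have dterm: "dynkin_term scale br (scale s x) (scale t y) ps =
      scale (s ^ fst (word_degree ps) * t ^ snd (word_degree ps) * dynkin_coeff ps)
        (nested_bracket br (dynkin_word x y ps))" for s t ps
  proof -
    have "dynkin_word (scale s x) (scale t y) ps =
        map (\<lambda>(c, w). scale c w) (dynkin_word (s, x) (t, y) ps)"
      by (simp add: map_dynkin_word)
    then show ?thesis
      by (simp only: dynkin_term_def nested_bracket_scale)
        (simp add: map_dynkin_word prod_list_dynkin_word mult.commute)
  qed
  have "bch scale br (scale s x) (scale t y) =
      (\<Sum>ps\<in>dynkin_indices N. dynkin_term scale br (scale s x) (scale t y) ps)"
    if N: "N \<ge> N0" for N s t
    unfolding bch_def
  proof (rule sum.mono_neutral_left)
    show "{ps. ps \<noteq> [] \<and> (\<forall>(r, s)\<in>set ps. r + s > 0) \<and>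
        dynkin_term scale br (scale s x) (scale t y) ps \<noteq> 0} \<subseteq> dynkin_indices N"
    proof
      fix ps assume ps: "ps \<in> {ps. ps \<noteq> [] \<and> (\<forall>(r, s)\<in>set ps. r + s > 0) \<and>
          dynkin_term scale br (scale s x) (scale t y) ps \<noteq> 0}"
      then have "nested_bracket br (dynkin_word (scale s x) (scale t y) ps) \<noteq> 0"
        by (auto simp: dynkin_term_def)
      then have "length (dynkin_word (scale s x) (scale t y) ps) \<le> N0"
        using N0 not_le by blast
      then show "ps \<in> dynkin_indices N"
        using ps N by (auto simp: dynkin_indices_def length_dynkin_word)
    qed
  qed (use finite_dynkin_indices in \<open>auto simp: dynkin_indices_def\<close>)
  then show ?thesis unfolding dterm by blast
qed

text \<open>
  Every word of length at least two in \<open>x\<close> alone has the bracket \<open>[x,x] = 0\<close> at its end.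
\<close>

lemma bch_multiples: "bch scale br (scale s x) (scale t x) = scale (s + t) x"
proof -
  obtain N where N: "N \<ge> 1" and e:
    "bch scale br (scale s x) (scale t x) =
     (\<Sum>ps\<in>dynkin_indices N.
        scale (s ^ fst (word_degree ps) * t ^ snd (word_degree ps) * dynkin_coeff ps)
          (nested_bracket br (dynkin_word x x ps)))"
    using bch_expansion[of x x] by (meson linear order_trans)
  have long: "nested_bracket br (replicate (Suc (Suc k)) x) = 0" for k
    by (induction k) (auto simp: br_self)
  have word: "dynkin_word x x ps =
      replicate (fst (word_degree ps) + snd (word_degree ps)) x" for ps
    by (induction ps) (auto simp: dynkin_word_def word_degree_def replicate_add[symmetric] add_ac)
  have "bch scale br (scale s x) (scale t x) =
     (\<Sum>ps\<in>{[(1, 0)], [(0, 1)]}.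
        scale (s ^ fst (word_degree ps) * t ^ snd (word_degree ps) * dynkin_coeff ps)
          (nested_bracket br (dynkin_word x x ps)))"
    unfolding e
  proof (rule sum.mono_neutral_right[OF finite_dynkin_indices])
    show "{[(1, 0)], [(0, 1)]} \<subseteq> dynkin_indices N"
      using N by (auto simp: dynkin_indices_def word_degree_def)
    show "\<forall>ps\<in>dynkin_indices N - {[(1, 0)], [(0, 1)]}.
       scale (s ^ fst (word_degree ps) * t ^ snd (word_degree ps) * dynkin_coeff ps)
          (nested_bracket br (dynkin_word x x ps)) = 0"
    proof
      fix ps assume ps: "ps \<in> dynkin_indices N - {[(1, 0)], [(0, 1)]}"
      obtain a b where ab: "word_degree ps = (a, b)" by fastforce
      have "a + b \<ge> 2"
        using dynkin_indices_low_degree(1,2,3)[of ps N] ps ab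
        by (cases a; cases b) (auto, (metis One_nat_def Suc_lessI add_gr_0 neq0_conv not_less_eq zero_less_Suc)?)
      then obtain k where "a + b = Suc (Suc k)" by (metis add_2_eq_Suc le_Suc_ex)
      then have "nested_bracket br (dynkin_word x x ps) = 0"
        unfolding word using long[of k] ab by simp
      then show "scale (s ^ fst (word_degree ps) * t ^ snd (word_degree ps) * dynkin_coeff ps)
          (nested_bracket br (dynkin_word x x ps)) = 0" by simp
    qed
  qed
  also have "\<dots> = scale (s + t) x"
    by (simp add: word_degree_def dynkin_coeff_def dynkin_word_def scale_left_distrib)
  finally show ?thesis .
qed

end

section \<open>Two-variable jets\<close>

locale embedded_field =
  fixes e :: "'k::field_char_0 \<Rightarrow> 'l::field_char_0"
  assumes embedding: "field_embedding e"
begin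

lemma e_1 [simp]: "e 1 = 1"
  and e_add: "e (a + b) = e a + e b"
  and e_mult: "e (a * b) = e a * e b"
  using embedding by (auto simp: field_embedding_def)

lemma e_0 [simp]: "e 0 = 0"
  using e_add[of 0 0] by simp

lemma e_minus: "e (- a) = - e a"
  using e_add[of a "- a"] by (simp add: eq_neg_iff_add_eq_0 add.commute)

lemma e_diff: "e (a - b) = e a - e b"
  using e_add[of a "- b"] by (simp add: e_minus)

lemma e_power: "e (a ^ j) = e a ^ j"
  by (induction j) (auto simp: e_mult)

lemma e_of_nat: "e (of_nat j) = of_nat j"
  by (induction j) (auto simp: e_add)

lemma inj_e: "inj e"
proof (rule injI)
  fix a b assume "e a = e b"
  then have "e (a - b) = 0" by (simp add: e_diff)
  moreover have "e (a - b) * e (inverse (a - b)) = 1" if "a \<noteq> b"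
    using that by (simp flip: e_mult)
  ultimately show "a = b" by fastforce
qed

lemma infinite_range_e: "infinite (range e)"
  using inj_e infinite_UNIV_char_0 finite_imageD by blast

lemma poly_zero_on_range:
  assumes "\<And>t. poly P (e t) = 0"
  shows "P = 0"
  using poly_roots_finite[of P] assms infinite_range_e
  by (meson finite_subset image_subsetI mem_Collect_eq)

lemma poly_eq_on_range:
  assumes "\<And>t. poly P (e t) = poly Q (e t)"
  shows "P = Q"
  using poly_zero_on_range[of "P - Q"] assms by simp

text \<open>
  The function \<open>\<phi>\<close> is polynomial in \<open>e s\<close> and \<open>e t\<close>, with coefficients \<open>a\<close>, \<open>b\<close>, \<open>c\<close>, \<open>d\<close> at \<open>1\<close>, \<open>s\<close>, \<open>t\<close> and
  \<open>s t\<close>. Computing with jets is computing modulo \<open>(s\<^sup>2, t\<^sup>2)\<close>. In \<open>P\<close> the outer variable stands for \<open>t\<close>.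
\<close>

definition jet :: "('k \<Rightarrow> 'k \<Rightarrow> 'l) \<Rightarrow> 'l \<Rightarrow> 'l \<Rightarrow> 'l \<Rightarrow> 'l \<Rightarrow> bool" where
  "jet \<phi> a b c d \<longleftrightarrow> (\<exists>P :: 'l poly poly.
     (\<forall>s t. \<phi> s t = poly (poly P [:e t:]) (e s)) \<and>
     coeff (coeff P 0) 0 = a \<and> coeff (coeff P 0) 1 = b \<and>
     coeff (coeff P 1) 0 = c \<and> coeff (coeff P 1) 1 = d)"

text \<open>
  The field \<open>'k\<close> has characteristic \<open>0\<close>, so its image in \<open>'l\<close> is infinite and a polynomial is determined
  by its values there.
\<close>

lemma jet_unique:
  assumes "jet \<phi> a b c d" "jet \<phi> a' b' c' d'"
  shows "a = a' \<and> b = b' \<and> c = c' \<and> d = d'"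
proof -
  obtain P Q where PQ:
    "\<And>s t. poly (poly P [:e t:]) (e s) = poly (poly Q [:e t:]) (e s)"
    "coeff (coeff P 0) 0 = a" "coeff (coeff P 0) 1 = b"
    "coeff (coeff P 1) 0 = c" "coeff (coeff P 1) 1 = d"
    "coeff (coeff Q 0) 0 = a'" "coeff (coeff Q 0) 1 = b'"
    "coeff (coeff Q 1) 0 = c'" "coeff (coeff Q 1) 1 = d'"
    using assms unfolding jet_def by metis
  have "poly (P - Q) [:e t:] = 0" for t
    using poly_eq_on_range[of "poly P [:e t:]" "poly Q [:e t:]"] PQ(1) by simp
  then have roots: "range (\<lambda>t. [:e t:]) \<subseteq> {z. poly (P - Q) z = 0}" by blast
  moreover have "infinite (range (\<lambda>t. [:e t:]))"
    using inj_e infinite_UNIV_char_0[where ?'a = 'k] finite_imageD[of "\<lambda>t. [:e t:]" UNIV]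
    by (auto simp: inj_def)
  ultimately have "P - Q = 0" using poly_roots_finite[of "P - Q"] finite_subset[OF roots] by argo
  then show ?thesis using PQ by simp
qed

lemma jet_const: "jet (\<lambda>s t. c) c 0 0 0"
  unfolding jet_def by (rule exI[of _ "[:[:c:]:]"]) simp

lemma jet_add:
  assumes "jet \<phi> a b c d" "jet \<psi> a' b' c' d'"
  shows "jet (\<lambda>s t. \<phi> s t + \<psi> s t) (a + a') (b + b') (c + c') (d + d')"
proof -
  obtain P Q where
    "\<And>s t. \<phi> s t = poly (poly P [:e t:]) (e s)" "\<And>s t. \<psi> s t = poly (poly Q [:e t:]) (e s)"
    "coeff (coeff P 0) 0 = a" "coeff (coeff P 0) 1 = b"
    "coeff (coeff P 1) 0 = c" "coeff (coeff P 1) 1 = d"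
    "coeff (coeff Q 0) 0 = a'" "coeff (coeff Q 0) 1 = b'"
    "coeff (coeff Q 1) 0 = c'" "coeff (coeff Q 1) 1 = d'"
    using assms unfolding jet_def by metis
  then show ?thesis unfolding jet_def by (intro exI[of _ "P + Q"]) simp
qed

lemma jet_mult:
  assumes "jet \<phi> a b c d" "jet \<psi> a' b' c' d'"
  shows "jet (\<lambda>s t. \<phi> s t * \<psi> s t) (a * a') (a * b' + b * a') (a * c' + c * a')
    (a * d' + d * a' + b * c' + c * b')"
proof -
  obtain P Q where
    "\<And>s t. \<phi> s t = poly (poly P [:e t:]) (e s)" "\<And>s t. \<psi> s t = poly (poly Q [:e t:]) (e s)"
    "coeff (coeff P 0) 0 = a" "coeff (coeff P 0) 1 = b"
    "coeff (coeff P 1) 0 = c" "coeff (coeff P 1) 1 = d"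
    "coeff (coeff Q 0) 0 = a'" "coeff (coeff Q 0) 1 = b'"
    "coeff (coeff Q 1) 0 = c'" "coeff (coeff Q 1) 1 = d'"
    using assms unfolding jet_def by metis
  then show ?thesis unfolding jet_def
    by (intro exI[of _ "P * Q"]) (simp add: coeff_mult coeff_add algebra_simps)
qed

lemma jet_monomial:
  "jet (\<lambda>s t. c * e s ^ i * e t ^ j)
     (if (i, j) = (0, 0) then c else 0) (if (i, j) = (1, 0) then c else 0)
     (if (i, j) = (0, 1) then c else 0) (if (i, j) = (1, 1) then c else 0)"
  unfolding jet_def
  by (rule exI[of _ "monom (monom c i) j"]) (auto simp: poly_monom)

lemma jet_sum:
  assumes "finite I" "\<And>i. i \<in> I \<Longrightarrow> jet (\<phi> i) (a i) (b i) (c i) (d i)"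
  shows "jet (\<lambda>s t. \<Sum>i\<in>I. \<phi> i s t) (sum a I) (sum b I) (sum c I) (sum d I)"
  using assms by (induction I) (auto intro: jet_add jet_const)

text \<open>
  The bound of the inner sum may depend on the outer index: when two flows are composed, the degree
  of the second one depends on the coefficient of the first one to which it is applied.
\<close>

lemma jet_double_sum:
  assumes "\<And>i. i > m \<Longrightarrow> a i = (\<lambda>j. 0)" "\<And>i j. j > n i \<Longrightarrow> a i j = 0"
  shows "jet (\<lambda>s t. \<Sum>i\<le>m. e s ^ i * (\<Sum>j\<le>n i. e t ^ j * a i j)) (a 0 0) (a 1 0) (a 0 1) (a 1 1)"
proof -
  have pick: "(\<Sum>i\<le>m. \<Sum>j\<le>n i. if (i, j) = (k, l) then a i j else 0) = a k l" for k l
  proof -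
    have "(\<Sum>j\<le>n i. if (i, j) = (k, l) then a i j else 0) = (if i = k then a k l else 0)" for i
      using assms(2)[of k l] by (cases "i = k"; cases "l \<le> n k") (simp_all add: not_le)
    then have "(\<Sum>i\<le>m. \<Sum>j\<le>n i. if (i, j) = (k, l) then a i j else 0) =
        (if k \<le> m then a k l else 0)" by simp
    then show ?thesis using assms(1)[of k] by (cases "k \<le> m") (simp_all add: not_le)
  qed
  have "jet (\<lambda>s t. \<Sum>i\<le>m. \<Sum>j\<le>n i. a i j * e s ^ i * e t ^ j)
      (\<Sum>i\<le>m. \<Sum>j\<le>n i. if (i, j) = (0, 0) then a i j else 0)
      (\<Sum>i\<le>m. \<Sum>j\<le>n i. if (i, j) = (1, 0) then a i j else 0)
      (\<Sum>i\<le>m. \<Sum>j\<le>n i. if (i, j) = (0, 1) then a i j else 0)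
      (\<Sum>i\<le>m. \<Sum>j\<le>n i. if (i, j) = (1, 1) then a i j else 0)"
    by (intro jet_sum jet_monomial finite_atMost)
  then have "jet (\<lambda>s t. \<Sum>i\<le>m. \<Sum>j\<le>n i. a i j * e s ^ i * e t ^ j) (a 0 0) (a 1 0) (a 0 1) (a 1 1)"
    unfolding pick .
  moreover have "a i j * x * y = x * (y * a i j)" for i j x y by (simp only: mult_ac)
  ultimately show ?thesis by (simp only: sum_distrib_left)
qed

lemma jet_single_sum:
  assumes "\<And>j. j > m \<Longrightarrow> a j = 0"
  shows "jet (\<lambda>s t. \<Sum>j\<le>m. e t ^ j * a j) (a 0) 0 (a 1) 0"
  using jet_double_sum[of 0 "\<lambda>i j. if i = 0 then a j else 0" "\<lambda>_. m"] assms by fastforce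

end

locale group_jets = embedded_field e + nilpotent_lie_algebra scale br
  for e :: "'k::field_char_0 \<Rightarrow> 'l::field_char_0"
    and scale :: "'k \<Rightarrow> 'u::ab_group_add \<Rightarrow> 'u" and br
begin

text \<open>
  The curve \<open>w\<close> in \<open>\<uu>\<close> is \<open>s x + t y + s t z\<close> up to terms divisible by \<open>s\<^sup>2\<close> or \<open>t\<^sup>2\<close>. This is tested
  with linear functionals, since the action is polynomial in these.
\<close>

definition curve_jet :: "('k \<Rightarrow> 'k \<Rightarrow> 'u) \<Rightarrow> 'u \<Rightarrow> 'u \<Rightarrow> 'u \<Rightarrow> bool" where
  "curve_jet w x y z \<longleftrightarrow> (\<forall>l. Vector_Spaces.linear scale (*) l \<longrightarrow>
     jet (\<lambda>s t. e (l (w s t))) 0 (e (l x)) (e (l y)) (e (l z)))"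

lemma curve_jet_multiple: "curve_jet (\<lambda>s t. scale t v) 0 v 0"
  unfolding curve_jet_def
proof (intro allI impI)
  fix l assume "Vector_Spaces.linear scale (*) l"
  then interpret l: Vector_Spaces.linear scale "(*)" l .
  show "jet (\<lambda>s t. e (l (scale t v))) 0 (e (l 0)) (e (l v)) (e (l 0))"
    using jet_monomial[of "e (l v)" 0 1] by (simp add: l.scale e_mult mult.commute l.zero)
qed

text \<open>
  Among the words of Dynkin's formula only those of degree \<open>(1, 0)\<close>, \<open>(0, 1)\<close> and \<open>(1, 1)\<close> matter.
\<close>

lemma curve_jet_bch:
  "curve_jet (\<lambda>s t. bch scale br (scale s x) (scale t y)) x y (scale (1/2) (br x y))"
  unfolding curve_jet_def
proof (intro allI impI)
  fix l assume "Vector_Spaces.linear scale (*) l"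
  then interpret l: Vector_Spaces.linear scale "(*)" l .
  obtain N where N: "N \<ge> 2" and expand:
    "\<And>s t. bch scale br (scale s x) (scale t y) =
     (\<Sum>ps\<in>dynkin_indices N.
        scale (s ^ fst (word_degree ps) * t ^ snd (word_degree ps) * dynkin_coeff ps)
          (nested_bracket br (dynkin_word x y ps)))"
    using bch_expansion[of x y] by (meson linear order_trans)
  define c where "c ps = e (dynkin_coeff ps * l (nested_bracket br (dynkin_word x y ps)))" for ps
  have coeffs: "jet (\<lambda>s t. \<Sum>ps\<in>dynkin_indices N.
      c ps * e s ^ fst (word_degree ps) * e t ^ snd (word_degree ps))
     (\<Sum>ps\<in>dynkin_indices N. if word_degree ps = (0, 0) then c ps else 0)
     (\<Sum>ps\<in>dynkin_indices N. if word_degree ps = (1, 0) then c ps else 0)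
     (\<Sum>ps\<in>dynkin_indices N. if word_degree ps = (0, 1) then c ps else 0)
     (\<Sum>ps\<in>dynkin_indices N. if word_degree ps = (1, 1) then c ps else 0)"
    using jet_sum[OF finite_dynkin_indices jet_monomial, of c
        "\<lambda>ps. fst (word_degree ps)" "\<lambda>ps. snd (word_degree ps)" N]
    unfolding prod.collapse .
  have pick: "(\<Sum>ps\<in>dynkin_indices N. if word_degree ps = d then c ps else 0) = sum c S"
    if "\<And>ps. ps \<in> dynkin_indices N \<Longrightarrow> word_degree ps = d \<longleftrightarrow> ps \<in> S"
      "S \<subseteq> dynkin_indices N" for d S
  proof -
    have "(\<Sum>ps\<in>dynkin_indices N. if word_degree ps = d then c ps else 0) =
        (\<Sum>ps\<in>dynkin_indices N. if ps \<in> S then c ps else 0)"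
      using that by (intro sum.cong) auto
    also have "\<dots> = sum c S"
      using that finite_dynkin_indices by (simp add: sum.If_cases Int_absorb1)
    finally show ?thesis .
  qed
  have "(\<Sum>ps\<in>dynkin_indices N. if word_degree ps = (0, 0) then c ps else 0) = 0"
    using pick[of "(0, 0)" "{}"] dynkin_indices_low_degree(1) by simp
  moreover have "(\<Sum>ps\<in>dynkin_indices N. if word_degree ps = (1, 0) then c ps else 0) = e (l x)"
  proof -
    have "(\<Sum>ps\<in>dynkin_indices N. if word_degree ps = (1, 0) then c ps else 0) =
        sum c {[(1, 0)]}"
      by (rule pick) (use N dynkin_indices_low_degree(2) in
          \<open>auto simp: dynkin_indices_def word_degree_def\<close>)
    then show ?thesis by (simp add: c_def dynkin_coeff_def dynkin_word_def)
  qed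
  moreover have "(\<Sum>ps\<in>dynkin_indices N. if word_degree ps = (0, 1) then c ps else 0) = e (l y)"
  proof -
    have "(\<Sum>ps\<in>dynkin_indices N. if word_degree ps = (0, 1) then c ps else 0) =
        sum c {[(0, 1)]}"
      by (rule pick) (use N dynkin_indices_low_degree(3) in
          \<open>auto simp: dynkin_indices_def word_degree_def\<close>)
    then show ?thesis by (simp add: c_def dynkin_coeff_def dynkin_word_def)
  qed
  moreover have "(\<Sum>ps\<in>dynkin_indices N. if word_degree ps = (1, 1) then c ps else 0) =
      e (l (scale (1/2) (br x y)))"
  proof -
    \<comment> \<open>The three words contribute \<open>1/2\<close>, \<open>-1/4\<close> and, through \<open>[y,x] = -[x,y]\<close>, \<open>1/4\<close>.\<close>
    have "(\<Sum>ps\<in>dynkin_indices N. if word_degree ps = (1, 1) then c ps else 0) =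
        sum c {[(1, 1)], [(1, 0), (0, 1)], [(0, 1), (1, 0)]}"
      by (rule pick) (use N dynkin_indices_low_degree(4) in
          \<open>auto simp: dynkin_indices_def word_degree_def\<close>)
    also have "\<dots> = e (1/2 * l (br x y) - 1/4 * l (br x y) - 1/4 * l (br y x))"
      unfolding e_diff by (simp add: c_def dynkin_coeff_def dynkin_word_def e_minus)
    also have "1/2 * l (br x y) - 1/4 * l (br x y) - 1/4 * l (br y x) =
        l (scale (1/2) (br x y))"
      by (simp add: br_swap[of y x] l.neg l.scale)
    finally show ?thesis .
  qed
  moreover have "e (l (bch scale br (scale s x) (scale t y))) =
      (\<Sum>ps\<in>dynkin_indices N. c ps * e s ^ fst (word_degree ps) * e t ^ snd (word_degree ps))"
    for s t
  proof -
    have e_sum: "e (sum g S) = (\<Sum>i\<in>S. e (g i))" for g :: "(nat \<times> nat) list \<Rightarrow> 'k" and S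
      by (induction S rule: infinite_finite_induct) (auto simp: e_add)
    show ?thesis
      unfolding expand l.sum l.scale e_sum c_def e_mult e_power
      by (intro sum.cong refl) (simp only: mult_ac)
  qed
  ultimately show "jet (\<lambda>s t. e (l (bch scale br (scale s x) (scale t y)))) 0 (e (l x)) (e (l y))
      (e (l (scale (1/2) (br x y))))"
    using coeffs by simp
qed

end

section \<open>The derivations of the coordinate ring\<close>

locale unipotent_action =
  fixes W :: "('k::field_char_0, 'l::field_char_0, 'n, 'u::ab_group_add, 'f::field_char_0) uvariety"
  assumes field_emb: "field_embedding (ext W)"
    and nilpotent_lie: "fd_nilpotent_lie_algebra (smult W) (bracket W)"
    and rational: "rational_action W"
    and fractions: "fraction_embedding W"

sublocale unipotent_action \<subseteq> group_jets "ext W" "smult W" "bracket W"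
proof -
  interpret lie_algebra "smult W" "bracket W"
    using nilpotent_lie by (simp add: fd_nilpotent_lie_algebra_def)
  show "group_jets (ext W) (smult W) (bracket W)"
    by unfold_locales (use field_emb nilpotent_lie in \<open>auto simp: fd_nilpotent_lie_algebra_def\<close>)
qed

context unipotent_action
begin

text \<open>
  \<open>A\<close> is the coordinate ring \<open>K[X]\<close> and \<open>\<delta> x\<close> is the derivation \<open>D\<^sub>x\<close> on it; the letter \<open>D\<close> is kept for
  the extension to \<open>K(X)\<close>. As elements of \<open>A\<close> vanish off \<open>X\<close>, so do its constants.
\<close>

abbreviation "X \<equiv> points W"
abbreviation "A \<equiv> coord_ring W"
abbreviation "T \<equiv> trans_fun W"
abbreviation "\<delta> \<equiv> deriv_fun W"
abbreviation "const c \<equiv> restr X (\<lambda>p. ext W c)"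

lemma act_points: "p \<in> X \<Longrightarrow> act W y p \<in> X"
  and act_0: "p \<in> X \<Longrightarrow> act W 0 p = p"
  and act_bch: "p \<in> X \<Longrightarrow> act W (bch (smult W) (bracket W) y z) p = act W y (act W z p)"
  using rational by (auto simp: rational_action_def)

lemma act_multiples:
  "p \<in> X \<Longrightarrow> act W (smult W (s + t) x) p = act W (smult W s x) (act W (smult W t x) p)"
  by (simp add: bch_multiples flip: act_bch)

lemma act_inverse: "p \<in> X \<Longrightarrow> act W (- y) (act W y p) = p"
  using act_multiples[of p "-1" 1 y] act_0 by simp

lemma poly_funs_intros:
  "(\<lambda>p. ext W c) \<in> poly_funs W"
  "(\<lambda>p. p i) \<in> poly_funs W"
  "f \<in> poly_funs W \<Longrightarrow> g \<in> poly_funs W \<Longrightarrow> f + g \<in> poly_funs W"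
  "f \<in> poly_funs W \<Longrightarrow> g \<in> poly_funs W \<Longrightarrow> f * g \<in> poly_funs W"
  unfolding poly_funs_def by (auto intro: gen_alg.intros)

lemma poly_funs_0: "0 \<in> poly_funs W"
  using poly_funs_intros(1)[of 0] by (simp add: zero_fun_def)

lemma poly_funs_sum: "(\<And>i. i \<in> I \<Longrightarrow> f i \<in> poly_funs W) \<Longrightarrow> sum f I \<in> poly_funs W"
  by (induction I rule: infinite_finite_induct) (auto intro: poly_funs_intros poly_funs_0)

lemma sum_fun_apply: "(\<Sum>i\<in>I. f i) p = (\<Sum>i\<in>I. f i p)"
  by (induction I rule: infinite_finite_induct) auto

lemma restr_add: "restr S (f + g) = restr S f + restr S g"
  and restr_mult: "restr S (f * g) = restr S f * (restr S g :: 'a \<Rightarrow> 'b::comm_ring_1)"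
  by (auto simp: restr_def)

lemma coord_ring_add: "f \<in> A \<Longrightarrow> g \<in> A \<Longrightarrow> f + g \<in> A"
  and coord_ring_mult: "f \<in> A \<Longrightarrow> g \<in> A \<Longrightarrow> f * g \<in> A"
  unfolding coord_ring_def
  by (auto simp flip: restr_add restr_mult intro!: imageI poly_funs_intros)

lemma coord_ring_const: "const c \<in> A"
  unfolding coord_ring_def by (intro imageI poly_funs_intros)

lemma coord_ring_0: "0 \<in> A"
  using coord_ring_const[of 0] by (simp add: restr_def zero_fun_def)

lemma coord_ring_off: "f \<in> A \<Longrightarrow> p \<notin> X \<Longrightarrow> f p = 0"
  by (auto simp: coord_ring_def restr_def)

lemma coord_ring_sum: "(\<And>i. i \<in> I \<Longrightarrow> f i \<in> A) \<Longrightarrow> sum f I \<in> A"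
  by (induction I rule: infinite_finite_induct) (auto intro: coord_ring_add coord_ring_0)

lemma coord_ring_minus: "f \<in> A \<Longrightarrow> - f \<in> A"
proof -
  assume f: "f \<in> A"
  have "- f = const (- 1) * f"
    using coord_ring_off[OF f] by (auto simp: fun_eq_iff restr_def e_minus)
  then show ?thesis using f coord_ring_const coord_ring_mult by metis
qed

lemma coord_ring_diff: "f \<in> A \<Longrightarrow> g \<in> A \<Longrightarrow> f - g \<in> A"
  using coord_ring_add[of f "- g"] coord_ring_minus by simp

text \<open>
  The polynomial functions on the product of \<open>\<uu>\<close> and affine space, among which the action map has its
  coordinates.
\<close>

definition action_funs :: "('u \<times> ('n \<Rightarrow> 'l) \<Rightarrow> 'l) set" where
  "action_funs = gen_alg (\<lambda>c q. ext W c)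
     ({\<lambda>q. ext W (l (fst q)) |l. Vector_Spaces.linear (smult W) (*) l} \<union> {\<lambda>q. snd q j |j. True})"

lemma pullback_action:
  assumes "f \<in> A"
  shows "\<exists>G\<in>action_funs. \<forall>y. \<forall>p\<in>X. f (act W y p) = G (y, p)"
proof -
  obtain q where q: "q \<in> poly_funs W" "f = restr X q"
    using assms by (auto simp: coord_ring_def)
  from q(1) have "\<exists>G\<in>action_funs. \<forall>y. \<forall>p\<in>X. q (act W y p) = G (y, p)"
    unfolding poly_funs_def
  proof (induction q rule: gen_alg.induct)
    case (scalar c)
    then show ?case
      by (intro bexI[of _ "\<lambda>q. ext W c"]) (auto simp: action_funs_def intro: gen_alg.scalar)
  next
    case (gen g)
    then show ?case
      using rational unfolding rational_action_def action_funs_def by auto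
  next
    case (add f g)
    then obtain F G where "F \<in> action_funs" "G \<in> action_funs"
      "\<forall>y. \<forall>p\<in>X. f (act W y p) = F (y, p)" "\<forall>y. \<forall>p\<in>X. g (act W y p) = G (y, p)" by blast
    then show ?case
      by (intro bexI[of _ "F + G"]) (auto simp: action_funs_def intro: gen_alg.add)
  next
    case (mult f g)
    then obtain F G where "F \<in> action_funs" "G \<in> action_funs"
      "\<forall>y. \<forall>p\<in>X. f (act W y p) = F (y, p)" "\<forall>y. \<forall>p\<in>X. g (act W y p) = G (y, p)" by blast
    then show ?case
      by (intro bexI[of _ "F * G"]) (auto simp: action_funs_def intro: gen_alg.mult)
  qed
  then show ?thesis using q(2) act_points by (auto simp: restr_def)
qed

lemma action_fun_along_line:
  assumes "G \<in> action_funs"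
  shows "\<exists>d c. (\<forall>j. c j \<in> poly_funs W) \<and> (\<forall>j>d. c j = 0) \<and>
    (\<forall>t p. G (smult W t x, p) = (\<Sum>j\<le>d. ext W t ^ j * c j p))"
  using assms unfolding action_funs_def
proof (induction G rule: gen_alg.induct)
  case (scalar a)
  show ?case
    by (rule exI[of _ 0], rule exI[of _ "\<lambda>j. if j = 0 then (\<lambda>p. ext W a) else 0"])
      (auto intro: poly_funs_intros poly_funs_0)
next
  case (gen g)
  then consider l where "Vector_Spaces.linear (smult W) (*) l" "g = (\<lambda>q. ext W (l (fst q)))"
    | j where "g = (\<lambda>q. snd q j)" by blast
  then show ?case
  proof cases
    case 1
    then interpret l: Vector_Spaces.linear "smult W" "(*)" l by blast
    show ?thesis
      by (rule exI[of _ 1], rule exI[of _ "\<lambda>j. if j = 1 then (\<lambda>p. ext W (l x)) else 0"])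
        (auto intro: poly_funs_intros poly_funs_0 simp: 1 l.scale e_mult)
  next
    case 2
    then show ?thesis
      by (intro exI[of _ 0] exI[of _ "\<lambda>i. if i = 0 then (\<lambda>p. p j) else 0"])
        (auto intro: poly_funs_intros poly_funs_0)
  qed
next
  case (add F G)
  then obtain d c d' c' where
    c: "\<forall>j. c j \<in> poly_funs W" "\<forall>j>d. c j = 0"
      "\<forall>t p. F (smult W t x, p) = (\<Sum>j\<le>d. ext W t ^ j * c j p)" and
    c': "\<forall>j. c' j \<in> poly_funs W" "\<forall>j>d'. c' j = 0"
      "\<forall>t p. G (smult W t x, p) = (\<Sum>j\<le>d'. ext W t ^ j * c' j p)" using add.IH by blast
  have "(\<Sum>j\<le>d. ext W t ^ j * c j p) = (\<Sum>j\<le>d + d'. ext W t ^ j * c j p)" for t p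
    by (rule sum.mono_neutral_left) (auto simp: c)
  moreover have "(\<Sum>j\<le>d'. ext W t ^ j * c' j p) = (\<Sum>j\<le>d + d'. ext W t ^ j * c' j p)" for t p
    by (rule sum.mono_neutral_left) (auto simp: c')
  ultimately have "(F + G) (smult W t x, p) = (\<Sum>j\<le>d + d'. ext W t ^ j * (c j + c' j) p)" for t p
    by (simp add: c c' distrib_left sum.distrib)
  moreover have "c j + c' j \<in> poly_funs W" "j > d + d' \<Longrightarrow> c j + c' j = 0" for j
    using c c' by (simp_all add: poly_funs_intros(3))
  ultimately show ?case
    by (intro exI[of _ "d + d'"] exI[of _ "\<lambda>j. c j + c' j"] conjI allI impI)
next
  case (mult F G)
  then obtain d c d' c' where
    c: "\<forall>j. c j \<in> poly_funs W" "\<forall>j>d. c j = 0"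
      "\<forall>t p. F (smult W t x, p) = (\<Sum>j\<le>d. ext W t ^ j * c j p)" and
    c': "\<forall>j. c' j \<in> poly_funs W" "\<forall>j>d'. c' j = 0"
      "\<forall>t p. G (smult W t x, p) = (\<Sum>j\<le>d'. ext W t ^ j * c' j p)" using mult.IH by blast
  have off: "c k * c' (j - k) = 0" if "j > d + d'" for j k
    using that c(2) c'(2) by (cases "k > d") auto
  have "(\<Sum>j\<le>d. ext W t ^ j * c j p) * (\<Sum>j\<le>d'. ext W t ^ j * c' j p) =
      (\<Sum>j\<le>d + d'. ext W t ^ j * (\<Sum>k\<le>j. c k * c' (j - k)) p)" for t p
    using polynomial_product[of d "\<lambda>j. c j p" d' "\<lambda>j. c' j p" "ext W t"] c(2) c'(2)
    by (simp add: mult.commute sum_fun_apply)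
  then have "(F * G) (smult W t x, p) =
      (\<Sum>j\<le>d + d'. ext W t ^ j * (\<Sum>k\<le>j. c k * c' (j - k)) p)" for t p
    by (simp add: c c')
  moreover have "(\<Sum>k\<le>j. c k * c' (j - k)) \<in> poly_funs W" for j
    using c c' by (blast intro: poly_funs_sum poly_funs_intros(4))
  moreover have "(\<Sum>k\<le>j. c k * c' (j - k)) = 0" if "j > d + d'" for j
    using off[OF that] by (simp only: sum.neutral_const)
  ultimately show ?case
    by (intro exI[of _ "d + d'"] exI[of _ "\<lambda>j. \<Sum>k\<le>j. c k * c' (j - k)"] conjI allI impI)
qed

text \<open>
  Taylor's formula at the unit of the group: \<open>g1\<close> is the differential and \<open>g2\<close> the second differential
  of \<open>G\<close>. The second differential is symmetric, and the correction \<open>z\<close> of the curve enters only through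
  the first one; together this separates the bracket from the rest of the coefficient of \<open>s t\<close>.
\<close>

lemma action_fun_jet:
  assumes "G \<in> action_funs"
  shows "\<exists>g0 g1 g2. (\<forall>u v. g1 (u + v) = g1 u + g1 v) \<and> (\<forall>c u. g1 (smult W c u) = ext W c * g1 u) \<and>
    (\<forall>u v. g2 u v = g2 v u) \<and>
    (\<forall>w x y z. curve_jet w x y z \<longrightarrow> jet (\<lambda>s t. G (w s t, p)) g0 (g1 x) (g1 y) (g2 x y + g1 z))"
  using assms unfolding action_funs_def
proof (induction G rule: gen_alg.induct)
  case (scalar a)
  show ?case
    by (intro exI[of _ "ext W a"] exI[of _ "\<lambda>u. 0"] exI[of _ "\<lambda>u v. 0"]) (auto intro: jet_const)
next
  case (gen g)
  then consider l where "Vector_Spaces.linear (smult W) (*) l" "g = (\<lambda>q. ext W (l (fst q)))"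
    | j where "g = (\<lambda>q. snd q j)" by blast
  then show ?case
  proof cases
    case 1
    then interpret l: Vector_Spaces.linear "smult W" "(*)" l by blast
    show ?thesis
      by (rule exI[of _ 0], rule exI[of _ "\<lambda>u. ext W (l u)"], rule exI[of _ "\<lambda>u v. 0"])
        (use 1 in \<open>auto simp: l.add l.scale e_add e_mult curve_jet_def\<close>)
  next
    case 2
    then show ?thesis
      by (intro exI[of _ "p j"] exI[of _ "\<lambda>u. 0"] exI[of _ "\<lambda>u v. 0"]) (auto intro: jet_const)
  qed
next
  case (add G H)
  obtain g0 g1 g2 where g: "\<forall>u v. g1 (u + v) = g1 u + g1 v" "\<forall>c u. g1 (smult W c u) = ext W c * g1 u"
    "\<forall>u v. g2 u v = g2 v u" "\<forall>w x y z. curve_jet w x y z \<longrightarrow>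
      jet (\<lambda>s t. G (w s t, p)) g0 (g1 x) (g1 y) (g2 x y + g1 z)" using add.IH(1) by blast
  obtain h0 h1 h2 where h: "\<forall>u v. h1 (u + v) = h1 u + h1 v" "\<forall>c u. h1 (smult W c u) = ext W c * h1 u"
    "\<forall>u v. h2 u v = h2 v u" "\<forall>w x y z. curve_jet w x y z \<longrightarrow>
      jet (\<lambda>s t. H (w s t, p)) h0 (h1 x) (h1 y) (h2 x y + h1 z)" using add.IH(2) by blast
  show ?case
  proof (intro exI conjI allI impI)
    fix w x y z assume *: "curve_jet w x y z"
    show "jet (\<lambda>s t. (G + H) (w s t, p)) (g0 + h0) (g1 x + h1 x) (g1 y + h1 y)
        ((g2 x y + h2 x y) + (g1 z + h1 z))"
      using jet_add[OF g(4)[rule_format, OF *] h(4)[rule_format, OF *]]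
      by (simp add: algebra_simps)
  qed (use g(1,2,3) h(1,2,3) in \<open>auto simp: algebra_simps\<close>)
next
  case (mult G H)
  obtain g0 g1 g2 where g: "\<forall>u v. g1 (u + v) = g1 u + g1 v" "\<forall>c u. g1 (smult W c u) = ext W c * g1 u"
    "\<forall>u v. g2 u v = g2 v u" "\<forall>w x y z. curve_jet w x y z \<longrightarrow>
      jet (\<lambda>s t. G (w s t, p)) g0 (g1 x) (g1 y) (g2 x y + g1 z)" using mult.IH(1) by blast
  obtain h0 h1 h2 where h: "\<forall>u v. h1 (u + v) = h1 u + h1 v" "\<forall>c u. h1 (smult W c u) = ext W c * h1 u"
    "\<forall>u v. h2 u v = h2 v u" "\<forall>w x y z. curve_jet w x y z \<longrightarrow>
      jet (\<lambda>s t. H (w s t, p)) h0 (h1 x) (h1 y) (h2 x y + h1 z)" using mult.IH(2) by blast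
  show ?case
  proof (intro exI conjI allI impI)
    fix w x y z assume *: "curve_jet w x y z"
    show "jet (\<lambda>s t. (G * H) (w s t, p)) (g0 * h0) (g0 * h1 x + g1 x * h0) (g0 * h1 y + g1 y * h0)
        ((g0 * h2 x y + g2 x y * h0 + g1 x * h1 y + g1 y * h1 x) + (g0 * h1 z + g1 z * h0))"
      using jet_mult[OF g(4)[rule_format, OF *] h(4)[rule_format, OF *]]
      by (simp add: algebra_simps)
  next
    show "g0 * h2 u v + g2 u v * h0 + g1 u * h1 v + g1 v * h1 u =
        g0 * h2 v u + g2 v u * h0 + g1 v * h1 u + g1 u * h1 v" for u v
      using g(3)[rule_format, of u v] h(3)[rule_format, of u v] by simp
  qed (use g(1,2) h(1,2) in \<open>auto simp: algebra_simps\<close>)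
qed

text \<open>The polynomial dependence of \<open>T (exp (t x)) f\<close> on \<open>t\<close>.\<close>

definition flow_expansion :: "'u \<Rightarrow> (('n \<Rightarrow> 'l) \<Rightarrow> 'l) \<Rightarrow> nat \<Rightarrow> (nat \<Rightarrow> ('n \<Rightarrow> 'l) \<Rightarrow> 'l) \<Rightarrow> bool" where
  "flow_expansion x f d c \<longleftrightarrow> (\<forall>j. c j \<in> A) \<and> (\<forall>j>d. c j = 0) \<and>
     (\<forall>t p. T (smult W t x) f p = (\<Sum>j\<le>d. ext W t ^ j * c j p))"

lemma flow_expansion_exists:
  assumes "f \<in> A"
  shows "\<exists>d c. flow_expansion x f d c"
proof -
  obtain G where G: "G \<in> action_funs" "\<And>y p. p \<in> X \<Longrightarrow> f (act W y p) = G (y, p)"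
    using pullback_action[OF assms] by blast
  obtain d c where c: "\<forall>j. c j \<in> poly_funs W" "\<forall>j>d. c j = 0"
      "\<forall>t p. G (smult W t (- x), p) = (\<Sum>j\<le>d. ext W t ^ j * c j p)"
    using action_fun_along_line[OF G(1)] by blast
  have "flow_expansion x f d (\<lambda>j. restr X (c j))"
    using c G(2) by (auto simp: flow_expansion_def trans_fun_def coord_ring_def restr_def)
  then show ?thesis by blast
qed

lemma flow_in_coord_ring:
  assumes "f \<in> A"
  shows "T y f \<in> A"
proof -
  obtain d c where c: "flow_expansion y f d c" using flow_expansion_exists[OF assms] by blast
  have "T (smult W 1 y) f p = (\<Sum>j\<le>d. ext W 1 ^ j * c j p)" for p
    using c unfolding flow_expansion_def by blast
  then have "T y f = (\<Sum>j\<le>d. c j)"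
    by (simp add: fun_eq_iff sum_fun_apply)
  then show ?thesis using c by (simp add: flow_expansion_def coord_ring_sum)
qed

lemma power_sum_coeff:
  fixes a b :: "nat \<Rightarrow> 'l"
  assumes "\<And>t. (\<Sum>j\<le>m. ext W t ^ j * a j) = (\<Sum>j\<le>n. ext W t ^ j * b j)"
  shows "(if i \<le> m then a i else 0) = (if i \<le> n then b i else 0)"
proof -
  have "(\<Sum>j\<le>m. monom (a j) j) = (\<Sum>j\<le>n. monom (b j) j)"
    by (rule poly_eq_on_range) (use assms in \<open>simp add: poly_sum poly_monom mult.commute\<close>)
  then have "coeff (\<Sum>j\<le>m. monom (a j) j) i = coeff (\<Sum>j\<le>n. monom (b j) j) i" by simp
  then show ?thesis by (simp add: coeff_sum)
qed

text \<open>
  The coefficients of a polynomial in \<open>t\<close> are determined by its values, so every expansion, whatever its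
  formal degree, gives the same derivative.
\<close>

lemma deriv_fun_eq:
  assumes "flow_expansion x f d c"
  shows "\<delta> x f = c 1"
  unfolding deriv_fun_def
proof (rule the_equality)
  show "\<exists>d c'. (\<forall>j\<le>Suc d. c' j \<in> A) \<and>
      (\<forall>t p. T (smult W t x) f p = (\<Sum>j\<le>Suc d. ext W t ^ j * c' j p)) \<and> c 1 = c' 1"
    using assms unfolding flow_expansion_def by (intro exI[of _ d] exI[of _ c]) simp
next
  fix g assume "\<exists>d c. (\<forall>j\<le>Suc d. c j \<in> A) \<and>
      (\<forall>t p. T (smult W t x) f p = (\<Sum>j\<le>Suc d. ext W t ^ j * c j p)) \<and> g = c 1"
  then obtain d' c' where c': "\<And>t p. T (smult W t x) f p = (\<Sum>j\<le>Suc d'. ext W t ^ j * c' j p)"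
    and g: "g = c' 1" by blast
  have "c' 1 p = c 1 p" for p
  proof -
    have "(if 1 \<le> Suc d' then c' 1 p else 0) = (if 1 \<le> d then c 1 p else 0)"
      by (rule power_sum_coeff) (use assms c' in \<open>simp add: flow_expansion_def\<close>)
    then show ?thesis using assms by (auto simp: flow_expansion_def split: if_splits)
  qed
  then show "g = c 1" using g by auto
qed

lemma flow_expansion_0:
  assumes "flow_expansion x f d c" "f \<in> A"
  shows "c 0 = f"
proof
  fix p
  have "T (smult W 0 x) f p = (\<Sum>j\<le>d. ext W 0 ^ j * c j p)"
    using assms by (simp only: flow_expansion_def)
  also have "\<dots> = (\<Sum>j\<in>{0}. ext W 0 ^ j * c j p)"
    by (rule sum.mono_neutral_right) auto
  finally show "c 0 p = f p"
    using coord_ring_off[OF assms(2)] by (auto simp: trans_fun_def restr_def act_0 split: if_splits)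
qed

lemma deriv_fun_closed: "f \<in> A \<Longrightarrow> \<delta> x f \<in> A"
  using flow_expansion_exists[of f x] by (auto simp: deriv_fun_eq) (auto simp: flow_expansion_def)

lemma trans_fun_add: "T y (f + g) = T y f + T y g"
  and trans_fun_mult: "T y (f * g) = T y f * T y g"
  by (auto simp: trans_fun_def restr_def)

lemma deriv_fun_add:
  assumes "f \<in> A" "g \<in> A"
  shows "\<delta> x (f + g) = \<delta> x f + \<delta> x g"
proof -
  obtain d c d' c' where c: "flow_expansion x f d c" and c': "flow_expansion x g d' c'"
    using flow_expansion_exists assms by blast
  have "(\<Sum>j\<le>d. ext W t ^ j * c j p) = (\<Sum>j\<le>d + d'. ext W t ^ j * c j p)" for t p
    using c by (intro sum.mono_neutral_left) (auto simp: flow_expansion_def)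
  moreover have "(\<Sum>j\<le>d'. ext W t ^ j * c' j p) = (\<Sum>j\<le>d + d'. ext W t ^ j * c' j p)" for t p
    using c' by (intro sum.mono_neutral_left) (auto simp: flow_expansion_def)
  ultimately have "T (smult W t x) (f + g) p = (\<Sum>j\<le>d + d'. ext W t ^ j * (c j + c' j) p)" for t p
    using c c' by (simp add: trans_fun_add distrib_left sum.distrib flow_expansion_def)
  moreover have "c j + c' j \<in> A" "j > d + d' \<Longrightarrow> c j + c' j = 0" for j
    using c c' by (simp_all add: coord_ring_add flow_expansion_def)
  ultimately have "flow_expansion x (f + g) (d + d') (\<lambda>j. c j + c' j)"
    unfolding flow_expansion_def by (intro conjI allI impI)
  from deriv_fun_eq[OF this] show ?thesis
    by (simp only: deriv_fun_eq[OF c] deriv_fun_eq[OF c'])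
qed

lemma deriv_fun_mult:
  assumes "f \<in> A" "g \<in> A"
  shows "\<delta> x (f * g) = f * \<delta> x g + \<delta> x f * g"
proof -
  obtain d c d' c' where c: "flow_expansion x f d c" and c': "flow_expansion x g d' c'"
    using flow_expansion_exists assms by blast
  have off: "c k * c' (j - k) = 0" if "j > d + d'" for j k
    using that c c' by (cases "k > d") (auto simp: flow_expansion_def)
  have "(\<Sum>j\<le>d. ext W t ^ j * c j p) * (\<Sum>j\<le>d'. ext W t ^ j * c' j p) =
      (\<Sum>j\<le>d + d'. ext W t ^ j * (\<Sum>k\<le>j. c k * c' (j - k)) p)" for t p
    using polynomial_product[of d "\<lambda>j. c j p" d' "\<lambda>j. c' j p" "ext W t"] c c'
    by (simp add: mult.commute sum_fun_apply flow_expansion_def)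
  then have "T (smult W t x) (f * g) p =
      (\<Sum>j\<le>d + d'. ext W t ^ j * (\<Sum>k\<le>j. c k * c' (j - k)) p)" for t p
    using c c' by (simp add: trans_fun_mult flow_expansion_def)
  moreover have "(\<Sum>k\<le>j. c k * c' (j - k)) \<in> A" for j
    using c c' by (auto intro: coord_ring_sum coord_ring_mult simp: flow_expansion_def)
  moreover have "(\<Sum>k\<le>j. c k * c' (j - k)) = 0" if "j > d + d'" for j
    using off[OF that] by (simp only: sum.neutral_const)
  ultimately have "flow_expansion x (f * g) (d + d') (\<lambda>j. \<Sum>k\<le>j. c k * c' (j - k))"
    unfolding flow_expansion_def by (intro conjI allI impI)
  from deriv_fun_eq[OF this] show ?thesis
    by (simp add: deriv_fun_eq[OF c] deriv_fun_eq[OF c']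
        flow_expansion_0[OF c assms(1)] flow_expansion_0[OF c' assms(2)])
qed

lemma deriv_fun_const: "\<delta> x (const a) = 0"
proof -
  have "flow_expansion x (const a) 0 (\<lambda>j. if j = 0 then const a else 0)"
    by (auto simp: flow_expansion_def trans_fun_def restr_def coord_ring_0 act_points
        intro: coord_ring_const[unfolded restr_def])
  from deriv_fun_eq[OF this] show ?thesis by simp
qed

lemma deriv_fun_0: "\<delta> x 0 = 0"
  using deriv_fun_const[of x 0] by (simp add: restr_def zero_fun_def)

end

context unipotent_action
begin

lemma deriv_fun_scalar:
  assumes "f \<in> A"
  shows "\<delta> x (const a * f) = const a * \<delta> x f"
  using deriv_fun_mult[OF coord_ring_const assms, of x a] by (simp add: deriv_fun_const)

lemma const_times: "f \<in> A \<Longrightarrow> const a * f = (\<lambda>p. ext W a * f p)"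
  using coord_ring_off by (auto simp: restr_def fun_eq_iff)

text \<open>
  The coefficient of \<open>s\<close> in \<open>T (exp (s x)) (T (exp (t x)) f) = T (exp ((s + t) x)) f\<close> is a
  differential equation for \<open>T (exp (t x)) f\<close> as a function of \<open>t\<close>.
\<close>

lemma flow_expansion_Suc:
  assumes f: "f \<in> A" and c: "flow_expansion x f d c" and j: "j \<le> d"
  shows "\<delta> x (c j) p = of_nat (Suc j) * c (Suc j) p"
proof (cases "p \<in> X")
  case False
  have "c (Suc j) \<in> A" "\<delta> x (c j) \<in> A"
    using c by (auto simp: flow_expansion_def deriv_fun_closed)
  then have "c (Suc j) p = 0" "\<delta> x (c j) p = 0" using False coord_ring_off by blast+
  then show ?thesis by simp
next
  case p: True
  have "\<forall>j. \<exists>d' c'. flow_expansion x (c j) d' c'"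
    using c flow_expansion_exists by (auto simp: flow_expansion_def)
  then obtain d' c' where c': "\<And>j. flow_expansion x (c j) (d' j) (c' j)" by metis
  define C where "C = (\<Sum>k\<le>d. monom (c k p) k)"
  define C' where "C' j = (\<Sum>i\<le>d' j. monom (c' j i p) i)" for j
  have coeff_C: "coeff C k = c k p" for k
    using c unfolding C_def coeff_sum by (cases "k \<le> d") (auto simp: not_le flow_expansion_def)
  have coeff_C': "coeff (C' j) i = c' j i p" for i j
    using c'[of j] unfolding C'_def coeff_sum
    by (cases "i \<le> d' j") (auto simp: not_le flow_expansion_def)
  have flow_C': "c j (act W (- smult W s x) p) = poly (C' j) (ext W s)" for s j
  proof -
    have "T (smult W s x) (c j) p = (\<Sum>i\<le>d' j. ext W s ^ i * c' j i p)"
      using c'[of j] unfolding flow_expansion_def by blast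
    then show ?thesis
      using p by (simp add: trans_fun_def restr_def C'_def poly_sum poly_monom mult.commute)
  qed
  have flow_C: "f (act W (- smult W t x) p') = (\<Sum>j\<le>d. ext W t ^ j * c j p')" if "p' \<in> X" for t p'
  proof -
    have "T (smult W t x) f p' = (\<Sum>j\<le>d. ext W t ^ j * c j p')"
      using c unfolding flow_expansion_def by blast
    then show ?thesis using that by (simp add: trans_fun_def restr_def)
  qed
  have "(\<Sum>j\<le>d. Polynomial.smult (ext W t ^ j) (C' j)) = pcompose C [:ext W t, 1:]" for t
  proof (rule poly_eq_on_range)
    fix s
    have "poly (\<Sum>j\<le>d. Polynomial.smult (ext W t ^ j) (C' j)) (ext W s) =
        (\<Sum>j\<le>d. ext W t ^ j * c j (act W (- smult W s x) p))"
      by (simp add: poly_sum flow_C')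
    also have "\<dots> = f (act W (- smult W t x) (act W (- smult W s x) p))"
      using flow_C[of "act W (- smult W s x) p"] act_points[OF p] by simp
    also have "\<dots> = f (act W (- smult W (s + t) x) p)"
    proof -
      have "- smult W (s + t) x = smult W (- t + - s) x"
        by (simp add: scale_left_distrib scale_left_diff_distrib scale_minus_left)
      then show ?thesis using act_multiples[OF p, of "- t" "- s" x] by (simp add: scale_minus_left)
    qed
    also have "\<dots> = poly (pcompose C [:ext W t, 1:]) (ext W s)"
      using flow_C[OF p, of "s + t"]
      by (simp add: C_def poly_pcompose poly_sum poly_monom e_add add.commute mult.commute)
    finally show "poly (\<Sum>j\<le>d. Polynomial.smult (ext W t ^ j) (C' j)) (ext W s) =
        poly (pcompose C [:ext W t, 1:]) (ext W s)" .
  qed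
  then have "coeff (\<Sum>j\<le>d. Polynomial.smult (ext W t ^ j) (C' j)) 1 =
      coeff (pcompose C [:ext W t, 1:]) 1" for t by simp
  moreover have "coeff (pcompose C [:ext W t, 1:]) 1 = poly (pderiv C) (ext W t)" for t
  proof -
    have "coeff (pcompose C [:ext W t, 1:]) 1 = poly (pderiv (pcompose C [:ext W t, 1:])) 0"
      by (simp add: poly_0_coeff_0 coeff_pderiv)
    also have "\<dots> = poly (pderiv C) (ext W t)"
      by (simp add: pderiv_pcompose poly_pcompose pderiv_pCons)
    finally show ?thesis .
  qed
  ultimately have "poly (\<Sum>j\<le>d. monom (c' j 1 p) j) (ext W t) = poly (pderiv C) (ext W t)" for t
    by (simp add: coeff_sum coeff_C' poly_sum poly_monom mult.commute)
  then have "(\<Sum>j\<le>d. monom (c' j 1 p) j) = pderiv C" by (rule poly_eq_on_range)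
  then have "coeff (\<Sum>j\<le>d. monom (c' j 1 p) j) j = coeff (pderiv C) j" by simp
  then have "c' j 1 p = of_nat (Suc j) * c (Suc j) p"
    using j by (simp add: coeff_sum coeff_pderiv coeff_C)
  then show ?thesis using deriv_fun_eq[OF c'] by simp
qed

lemma iterated_deriv_closed: "f \<in> A \<Longrightarrow> (\<delta> x ^^ j) f \<in> A"
  by (induction j) (auto simp: deriv_fun_closed)

text \<open>\<open>T (exp y) = exp (D y)\<close>, where the exponential series is finite.\<close>

lemma flow_exp_series:
  assumes f: "f \<in> A"
  shows "\<exists>d. (\<forall>j>d. (\<delta> x ^^ j) f = 0) \<and>
    (\<forall>t p. T (smult W t x) f p = (\<Sum>j\<le>d. ext W t ^ j * ((\<delta> x ^^ j) f p / fact j)))"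
proof -
  obtain d c where c: "flow_expansion x f d c" using flow_expansion_exists f by blast
  then have c_A: "c j \<in> A" for j by (simp add: flow_expansion_def)
  have e_fact: "ext W (fact j) = fact j" for j
    using e_of_nat[of "fact j"] by simp
  have iter: "(\<delta> x ^^ j) f = const (fact j) * c j" if "j \<le> Suc d" for j
    using that
  proof (induction j)
    case 0
    then show ?case using flow_expansion_0[OF c f] const_times[OF f, of 1] by simp
  next
    case (Suc j)
    then have "(\<delta> x ^^ j) f = const (fact j) * c j" using Suc_leD by blast
    then have "(\<delta> x ^^ Suc j) f = const (fact j) * \<delta> x (c j)"
      by (simp only: funpow.simps comp_apply deriv_fun_scalar[OF c_A])
    also have "\<dots> = (\<lambda>p. ext W (fact j) * (of_nat (Suc j) * c (Suc j) p))"
      using flow_expansion_Suc[OF f c, of j] Suc.prems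
      by (simp only: const_times c_A deriv_fun_closed Suc_le_mono)
    also have "\<dots> = const (fact (Suc j)) * c (Suc j)"
      unfolding const_times[OF c_A] unfolding e_fact by (simp add: algebra_simps)
    finally show ?case .
  qed
  have "(\<delta> x ^^ (Suc d + k)) f = 0" for k
  proof (induction k)
    case 0
    have "c (Suc d) = 0" using c by (simp add: flow_expansion_def)
    then show ?case using iter[of "Suc d"] by simp
  next
    case (Suc k)
    then show ?case by (simp only: add_Suc_right funpow.simps comp_apply deriv_fun_0)
  qed
  then have "\<forall>j>d. (\<delta> x ^^ j) f = 0" by (metis Suc_le_eq le_Suc_ex)
  moreover have "T (smult W t x) f p = (\<Sum>j\<le>d. ext W t ^ j * ((\<delta> x ^^ j) f p / fact j))" for t p
  proof -
    have "T (smult W t x) f p = (\<Sum>j\<le>d. ext W t ^ j * c j p)"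
      using c unfolding flow_expansion_def by blast
    also have "\<dots> = (\<Sum>j\<le>d. ext W t ^ j * ((\<delta> x ^^ j) f p / fact j))"
    proof (intro sum.cong refl)
      fix j assume "j \<in> {..d}"
      then have "(\<delta> x ^^ j) f = (\<lambda>p. ext W (fact j) * c j p)"
        using iter[of j] unfolding const_times[OF c_A] by simp
      then show "ext W t ^ j * c j p = ext W t ^ j * ((\<delta> x ^^ j) f p / fact j)"
        by (simp add: e_fact)
    qed
    finally show ?thesis .
  qed
  ultimately show ?thesis by blast
qed

text \<open>
  For fixed \<open>p\<close> let \<open>g1\<close> and \<open>g2\<close> be the first and second differential at \<open>0\<close> of \<open>y \<mapsto> f (exp y \<cdot> p)\<close>.
  Then \<open>D\<^sub>v f (p) = - g1 v\<close>, which is linear in \<open>v\<close>, and the coefficient of \<open>s t\<close> in the group law gives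
  \<open>D\<^sub>x (D\<^sub>y f) (p) = g2 (- x) (- y) - g1 [x,y] / 2\<close>. When \<open>x\<close> and \<open>y\<close> are interchanged the symmetric term cancels.
\<close>

lemma deriv_fun_linear_and_bracket:
  assumes f: "f \<in> A"
  shows "\<delta> (x + y) f = \<delta> x f + \<delta> y f"
    and "\<delta> (smult W a x) f = const a * \<delta> x f"
    and "\<delta> (bracket W x y) f = \<delta> x (\<delta> y f) - \<delta> y (\<delta> x f)"
proof -
  obtain G where G: "G \<in> action_funs" "\<And>y p. p \<in> X \<Longrightarrow> f (act W y p) = G (y, p)"
    using pullback_action[OF f] by blast
  have *: "\<delta> (x + y) f p = \<delta> x f p + \<delta> y f p \<and> \<delta> (smult W a x) f p = ext W a * \<delta> x f p \<and>
      \<delta> (bracket W x y) f p = \<delta> x (\<delta> y f) p - \<delta> y (\<delta> x f) p" if p: "p \<in> X" for p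
  proof -
    obtain g0 g1 g2 where g1_add: "\<And>u v. g1 (u + v) = g1 u + g1 v"
      and g1_scale: "\<And>c u. g1 (smult W c u) = ext W c * g1 u"
      and g2_sym: "\<And>u v. g2 u v = g2 v u"
      and jet_G: "\<And>w x y z. curve_jet w x y z \<Longrightarrow>
        jet (\<lambda>s t. G (w s t, p)) g0 (g1 x) (g1 y) (g2 x y + g1 z)"
      using action_fun_jet[OF G(1), of p] by blast
    have g1_minus: "g1 (- u) = - g1 u" for u
      using g1_scale[of "- 1" u] by (simp add: e_minus)
    have first: "\<delta> v f p = - g1 v" for v
    proof -
      obtain d c where c: "flow_expansion v f d c" using flow_expansion_exists f by blast
      have "G (smult W t (- v), p) = (\<Sum>j\<le>d. ext W t ^ j * c j p)" for t
      proof -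
        have "T (smult W t v) f p = (\<Sum>j\<le>d. ext W t ^ j * c j p)"
          using c unfolding flow_expansion_def by blast
        then show ?thesis using p G(2)[OF p] by (simp add: trans_fun_def restr_def)
      qed
      then have "jet (\<lambda>s t. G (smult W t (- v), p)) (c 0 p) 0 (c 1 p) 0"
        using jet_single_sum[of d "\<lambda>j. c j p"] c by (simp add: flow_expansion_def)
      then show ?thesis
        using jet_unique[OF jet_G[OF curve_jet_multiple[of "- v"]]] deriv_fun_eq[OF c] g1_minus
        by simp
    qed
    have second: "\<delta> x (\<delta> y f) p = g2 (- x) (- y) - g1 (smult W (1/2) (bracket W x y))" for x y
    proof -
      obtain d c where c: "flow_expansion y f d c" using flow_expansion_exists f by blast
      have "\<forall>i. \<exists>d' c'. flow_expansion x (c i) d' c'"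
        using c flow_expansion_exists by (auto simp: flow_expansion_def)
      then obtain d' c' where c': "\<And>i. flow_expansion x (c i) (d' i) (c' i)" by metis
      \<comment> \<open>\<open>T\<close> acts through the inverse: \<open>T (exp (t x)) (T (exp (s y)) f) (p) = f (exp (- s y) exp (- t x) \<cdot> p)\<close>.\<close>
      have expand: "G (bch (smult W) (bracket W) (smult W s (- y)) (smult W t (- x)), p) =
          (\<Sum>i\<le>d. ext W s ^ i * (\<Sum>j\<le>d' i. ext W t ^ j * c' i j p))" for s t
      proof -
        have p': "act W (smult W t (- x)) p \<in> X" using p act_points by blast
        have "G (bch (smult W) (bracket W) (smult W s (- y)) (smult W t (- x)), p) =
            f (act W (smult W s (- y)) (act W (smult W t (- x)) p))"
          using G(2)[OF p] act_bch[OF p] by metis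
        also have "\<dots> = T (smult W s y) f (act W (smult W t (- x)) p)"
          using p' by (simp add: trans_fun_def restr_def)
        also have "\<dots> = (\<Sum>i\<le>d. ext W s ^ i * c i (act W (smult W t (- x)) p))"
          using c unfolding flow_expansion_def by blast
        also have "\<dots> = (\<Sum>i\<le>d. ext W s ^ i * T (smult W t x) (c i) p)"
          using p by (simp add: trans_fun_def restr_def)
        also have "\<dots> = (\<Sum>i\<le>d. ext W s ^ i * (\<Sum>j\<le>d' i. ext W t ^ j * c' i j p))"
          using c' unfolding flow_expansion_def by (intro sum.cong refl) metis
        finally show ?thesis .
      qed
      have c_off: "c i = 0" if "i > d" for i
        using that c by (simp add: flow_expansion_def)
      have c'_off: "c' i j p = 0" if "j > d' i" for i j
        using that c'[of i] by (simp add: flow_expansion_def)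
      have "c' i j p = 0" if "i > d" for i j
      proof -
        have "(\<Sum>j\<le>d' i. ext W t ^ j * c' i j p) = (\<Sum>j\<le>0. ext W t ^ j * 0)" for t
        proof -
          have "T (smult W t x) (c i) p = (\<Sum>j\<le>d' i. ext W t ^ j * c' i j p)"
            using c' unfolding flow_expansion_def by blast
          then show ?thesis using c_off[OF that] by (simp add: trans_fun_def restr_def)
        qed
        from power_sum_coeff[OF this, of j] show ?thesis
          using c'_off by (auto split: if_splits simp: not_le)
      qed
      then have "jet (\<lambda>s t. \<Sum>i\<le>d. ext W s ^ i * (\<Sum>j\<le>d' i. ext W t ^ j * c' i j p))
          (c' 0 0 p) (c' 1 0 p) (c' 0 1 p) (c' 1 1 p)"
        using c'_off by (intro jet_double_sum) auto
      from jet_unique[OF jet_G[OF curve_jet_bch[of "- y" "- x"], unfolded expand] this]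
      have "c' 1 1 p = g2 (- y) (- x) + g1 (smult W (1/2) (bracket W (- y) (- x)))" by simp
      moreover have "\<delta> x (\<delta> y f) = c' 1 1"
        using deriv_fun_eq[OF c] deriv_fun_eq[OF c'] by simp
      ultimately show ?thesis
        using g1_minus g2_sym[of "- y" "- x"]
        by (simp add: br_minus_left br_minus_right br_swap[of x y])
    qed
    have "\<delta> x (\<delta> y f) p - \<delta> y (\<delta> x f) p = - g1 (bracket W x y)"
    proof -
      have "bracket W x y = smult W (1/2) (bracket W x y) + smult W (1/2) (bracket W x y)"
        by (simp flip: scale_left_distrib)
      then have "g1 (bracket W x y) =
          g1 (smult W (1/2) (bracket W x y)) + g1 (smult W (1/2) (bracket W x y))"
        using g1_add by metis
      moreover have "g1 (smult W (1/2) (bracket W y x)) = - g1 (smult W (1/2) (bracket W x y))"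
        by (simp add: br_swap[of y x] g1_minus)
      ultimately show ?thesis by (simp add: second g2_sym[of "- y" "- x"])
    qed
    then show ?thesis by (simp add: first g1_add g1_scale)
  qed
  have vanish: "\<delta> v h p = 0" if "p \<notin> X" "h \<in> A" for v h p
    using that coord_ring_off deriv_fun_closed by blast
  show "\<delta> (x + y) f = \<delta> x f + \<delta> y f"
  proof
    show "\<delta> (x + y) f p = (\<delta> x f + \<delta> y f) p" for p
      using *[of p] vanish[of p] f by (cases "p \<in> X") simp_all
  qed
  show "\<delta> (smult W a x) f = const a * \<delta> x f"
  proof
    show "\<delta> (smult W a x) f p = (const a * \<delta> x f) p" for p
      using *[of p] vanish[of p] f by (cases "p \<in> X") (simp_all add: restr_def)
  qed
  show "\<delta> (bracket W x y) f = \<delta> x (\<delta> y f) - \<delta> y (\<delta> x f)"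
  proof
    show "\<delta> (bracket W x y) f p = (\<delta> x (\<delta> y f) - \<delta> y (\<delta> x f)) p" for p
      using *[of p] vanish[of p] f
      by (cases "p \<in> X") (simp_all add: fun_diff_def deriv_fun_closed)
  qed
qed

end

section \<open>Locally nilpotent derivations with a slice\<close>

text \<open>
  Subfields and derivations are relative to a subset, since the field in which \<open>K(X)\<close> is realised may
  be larger and \<open>deriv_ff\<close> is meaningful on \<open>K(X)\<close> only.
\<close>

locale subfield =
  fixes F :: "'f::field_char_0 set"
  assumes one_closed: "1 \<in> F"
    and add_closed: "a \<in> F \<Longrightarrow> b \<in> F \<Longrightarrow> a + b \<in> F"
    and minus_closed: "a \<in> F \<Longrightarrow> - a \<in> F"
    and mult_closed: "a \<in> F \<Longrightarrow> b \<in> F \<Longrightarrow> a * b \<in> F"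
    and inverse_closed: "a \<in> F \<Longrightarrow> inverse a \<in> F"
begin

lemma zero_closed: "0 \<in> F"
  using add_closed[OF one_closed minus_closed[OF one_closed]] by simp

lemma diff_closed: "a \<in> F \<Longrightarrow> b \<in> F \<Longrightarrow> a - b \<in> F"
  using add_closed[of a "- b"] minus_closed by simp

lemma divide_closed: "a \<in> F \<Longrightarrow> b \<in> F \<Longrightarrow> a / b \<in> F"
  by (simp add: divide_inverse mult_closed inverse_closed)

lemma power_closed: "a \<in> F \<Longrightarrow> a ^ j \<in> F"
  by (induction j) (auto intro: one_closed mult_closed)

lemma of_nat_closed: "of_nat j \<in> F"
  by (induction j) (auto intro: zero_closed one_closed add_closed)

lemma fact_closed: "fact j \<in> F"
  using of_nat_closed[of "fact j"] by simp

lemma sum_closed: "(\<And>i. i \<in> I \<Longrightarrow> f i \<in> F) \<Longrightarrow> sum f I \<in> F"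
  by (induction I rule: infinite_finite_induct) (auto intro: zero_closed add_closed)

lemmas closed = zero_closed one_closed add_closed minus_closed mult_closed inverse_closed
  diff_closed divide_closed power_closed of_nat_closed fact_closed sum_closed

end

locale subfield_derivation = subfield F for F :: "'f::field_char_0 set" +
  fixes D :: "'f \<Rightarrow> 'f"
  assumes D_closed: "a \<in> F \<Longrightarrow> D a \<in> F"
    and D_add: "a \<in> F \<Longrightarrow> b \<in> F \<Longrightarrow> D (a + b) = D a + D b"
    and D_mult: "a \<in> F \<Longrightarrow> b \<in> F \<Longrightarrow> D (a * b) = a * D b + D a * b"
begin

lemma D_0 [simp]: "D 0 = 0"
  using D_add[of 0 0] zero_closed by simp

lemma D_1 [simp]: "D 1 = 0"
  using D_mult[of 1 1] one_closed by simp

lemma D_of_nat [simp]: "D (of_nat j) = 0"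
  by (induction j) (auto simp: D_add closed)

lemma D_minus: "a \<in> F \<Longrightarrow> D (- a) = - D a"
  using D_add[of a "- a"] minus_closed by (simp add: eq_neg_iff_add_eq_0 add.commute)

lemma D_sum: "(\<And>i. i \<in> I \<Longrightarrow> f i \<in> F) \<Longrightarrow> D (sum f I) = (\<Sum>i\<in>I. D (f i))"
  by (induction I rule: infinite_finite_induct) (auto simp: D_add sum_closed)

lemma D_inverse_kernel:
  assumes "c \<in> F" "D c = 0"
  shows "D (inverse c) = 0"
proof (cases "c = 0")
  case False
  then have "c * D (inverse c) = 0"
    using D_mult[of c "inverse c"] assms inverse_closed by simp
  then show ?thesis using False by simp
qed simp

lemma D_divide_kernel:
  assumes "a \<in> F" "c \<in> F" "D c = 0"
  shows "D (a / c) = D a / c"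
  using assms D_mult[of a "inverse c"] by (simp add: divide_inverse D_inverse_kernel closed)

lemma D_fact_divide: "a \<in> F \<Longrightarrow> D (a / fact j) = D a / fact j"
  using D_divide_kernel[of a "of_nat (fact j)"] D_of_nat[of "fact j"] fact_closed
  by (metis of_nat_closed of_nat_fact)

lemma D_power: "a \<in> F \<Longrightarrow> D (a ^ Suc j) = of_nat (Suc j) * a ^ j * D a"
proof (induction j)
  case (Suc j)
  have "D (a ^ Suc (Suc j)) = a * D (a ^ Suc j) + D a * a ^ Suc j"
    using D_mult[OF Suc.prems power_closed[OF Suc.prems, of "Suc j"]] by simp
  then show ?case using Suc by (simp add: algebra_simps)
qed simp

lemma iter_closed: "a \<in> F \<Longrightarrow> (D ^^ j) a \<in> F"
  by (induction j) (auto simp: D_closed)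

lemma iter_add: "a \<in> F \<Longrightarrow> b \<in> F \<Longrightarrow> (D ^^ j) (a + b) = (D ^^ j) a + (D ^^ j) b"
  by (induction j) (auto simp: D_add iter_closed)

lemma iter_vanish_mono:
  assumes "(D ^^ n) a = 0" "n \<le> j"
  shows "(D ^^ j) a = 0"
proof -
  have "(D ^^ (n + k)) a = 0" for k
    by (induction k) (auto simp: assms)
  then show ?thesis using assms(2) le_Suc_ex by blast
qed

text \<open>With divided powers Leibniz' formula is the multiplication rule for power series.\<close>

lemma iter_mult:
  assumes a: "a \<in> F" and b: "b \<in> F"
  shows "(D ^^ n) (a * b) / fact n =
    (\<Sum>k\<le>n. ((D ^^ k) a / fact k) * ((D ^^ (n - k)) b / fact (n - k)))"
proof (induction n)
  case (Suc n)
  define u where "u k = (D ^^ k) a / fact k" for k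
  define v where "v k = (D ^^ k) b / fact k" for k
  have uF: "u k \<in> F" and vF: "v k \<in> F" for k
    by (auto simp: u_def v_def a b iter_closed closed)
  have Du: "D (u k) = of_nat (Suc k) * u (Suc k)" and Dv: "D (v k) = of_nat (Suc k) * v (Suc k)" for k
    using iter_closed[OF a] iter_closed[OF b] by (simp_all add: u_def v_def D_fact_divide del: of_nat_Suc)
  have "of_nat (Suc n) * ((D ^^ Suc n) (a * b) / fact (Suc n)) = D ((D ^^ n) (a * b) / fact n)"
    using iter_closed[OF mult_closed[OF a b]] by (simp add: D_fact_divide del: of_nat_Suc)
  also have "\<dots> = D (\<Sum>k\<le>n. u k * v (n - k))"
    using Suc.IH by (simp add: u_def v_def)
  also have "\<dots> = (\<Sum>k\<le>n. u k * D (v (n - k)) + D (u k) * v (n - k))"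
    using uF vF by (simp add: D_sum D_mult mult_closed)
  also have "\<dots> = (\<Sum>k\<le>n. of_nat (Suc n - k) * u k * v (Suc n - k)) +
      (\<Sum>k\<le>n. of_nat (Suc k) * u (Suc k) * v (n - k))"
    unfolding sum.distrib[symmetric]
    by (intro sum.cong refl) (simp add: Du Dv Suc_diff_le mult_ac del: of_nat_Suc)
  also have "(\<Sum>k\<le>n. of_nat (Suc n - k) * u k * v (Suc n - k)) =
      (\<Sum>k\<le>Suc n. of_nat (Suc n - k) * u k * v (Suc n - k))"
    by simp
  also have "(\<Sum>k\<le>n. of_nat (Suc k) * u (Suc k) * v (n - k)) =
      (\<Sum>k\<le>Suc n. of_nat k * u k * v (Suc n - k))"
    by (subst sum.atMost_Suc_shift) simp
  also have "(\<Sum>k\<le>Suc n. of_nat (Suc n - k) * u k * v (Suc n - k)) +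
      (\<Sum>k\<le>Suc n. of_nat k * u k * v (Suc n - k)) =
      (\<Sum>k\<le>Suc n. of_nat (Suc n) * (u k * v (Suc n - k)))"
    unfolding sum.distrib[symmetric]
    by (intro sum.cong refl) (simp add: of_nat_diff algebra_simps)
  also have "\<dots> = of_nat (Suc n) * (\<Sum>k\<le>Suc n. u k * v (Suc n - k))"
    by (simp only: sum_distrib_left)
  finally have "(D ^^ Suc n) (a * b) / fact (Suc n) = (\<Sum>k\<le>Suc n. u k * v (Suc n - k))"
    using mult_cancel_left[of "of_nat (Suc n) :: 'f"] by (metis of_nat_neq_0)
  then show ?case by (simp only: u_def v_def)
qed simp

definition nilpotent_at :: "'f \<Rightarrow> bool" where
  "nilpotent_at a \<longleftrightarrow> (\<exists>n. (D ^^ n) a = 0)"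

lemma nilpotent_at_add:
  assumes "a \<in> F" "b \<in> F" "nilpotent_at a" "nilpotent_at b"
  shows "nilpotent_at (a + b)"
proof -
  obtain m n where "(D ^^ m) a = 0" "(D ^^ n) b = 0" using assms by (auto simp: nilpotent_at_def)
  then have "(D ^^ (m + n)) (a + b) = 0"
    using assms iter_vanish_mono[of m a "m + n"] iter_vanish_mono[of n b "m + n"]
    by (simp add: iter_add)
  then show ?thesis by (auto simp: nilpotent_at_def)
qed

lemma nilpotent_at_mult:
  assumes "a \<in> F" "b \<in> F" "nilpotent_at a" "nilpotent_at b"
  shows "nilpotent_at (a * b)"
proof -
  obtain m n where mn: "(D ^^ m) a = 0" "(D ^^ n) b = 0" using assms by (auto simp: nilpotent_at_def)
  have "((D ^^ k) a / fact k) * ((D ^^ (m + n - k)) b / fact (m + n - k)) = 0" for k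
    using iter_vanish_mono[OF mn(1), of k] iter_vanish_mono[OF mn(2), of "m + n - k"]
    by (cases "m \<le> k") auto
  then have "(D ^^ (m + n)) (a * b) / fact (m + n) = 0"
    unfolding iter_mult[OF assms(1,2)] by (simp only: sum.neutral_const)
  then show ?thesis unfolding nilpotent_at_def by (intro exI[of _ "m + n"]) simp
qed

lemma nilpotent_at_kernel: "D a = 0 \<Longrightarrow> nilpotent_at a"
  unfolding nilpotent_at_def by (rule exI[of _ 1]) simp

lemma S_map_eq:
  assumes "\<And>j. j > n \<Longrightarrow> (D ^^ j) a = 0"
  shows "S_map D Q a = (\<Sum>j\<le>n. (- Q) ^ j * ((D ^^ j) a / fact j))"
proof -
  have "S_map D Q a = (\<Sum>j\<le>n. (-1) ^ j * (D ^^ j) a * (Q ^ j / fact j))"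
    unfolding S_map_def
    by (rule sum.mono_neutral_left) (use assms not_le in auto)
  also have "\<dots> = (\<Sum>j\<le>n. (- Q) ^ j * ((D ^^ j) a / fact j))"
    by (intro sum.cong refl) (simp add: power_minus[of Q])
  finally show ?thesis .
qed

lemma S_map_bound:
  assumes "nilpotent_at a"
  obtains n where "\<And>j. j > n \<Longrightarrow> (D ^^ j) a = 0"
  using assms iter_vanish_mono unfolding nilpotent_at_def by (meson less_imp_le)

lemma S_map_kernel: "D a = 0 \<Longrightarrow> S_map D Q a = a"
proof -
  assume "D a = 0"
  then have "(D ^^ j) a = 0" if "j > 0" for j
    using that iter_vanish_mono[of 1 a j] by simp
  then show ?thesis using S_map_eq[of 0 a Q] by simp
qed

lemma S_map_closed:
  assumes "a \<in> F" "Q \<in> F"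
  shows "S_map D Q a \<in> F"
  unfolding S_map_def using assms by (auto intro!: closed iter_closed)

lemma S_map_add:
  assumes "a \<in> F" "b \<in> F" "nilpotent_at a" "nilpotent_at b"
  shows "S_map D Q (a + b) = S_map D Q a + S_map D Q b"
proof -
  obtain m n where m: "\<And>j. j > m \<Longrightarrow> (D ^^ j) a = 0" and n: "\<And>j. j > n \<Longrightarrow> (D ^^ j) b = 0"
    using S_map_bound assms(3,4) by metis
  have "S_map D Q (a + b) = (\<Sum>j\<le>m + n. (- Q) ^ j * ((D ^^ j) (a + b) / fact j))"
    by (rule S_map_eq) (use m n assms in \<open>simp add: iter_add\<close>)
  also have "\<dots> = (\<Sum>j\<le>m + n. (- Q) ^ j * ((D ^^ j) a / fact j)) +
      (\<Sum>j\<le>m + n. (- Q) ^ j * ((D ^^ j) b / fact j))"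
    using assms by (simp add: iter_add sum.distrib add_divide_distrib distrib_left)
  also have "\<dots> = S_map D Q a + S_map D Q b"
    using S_map_eq[of "m + n" a Q] S_map_eq[of "m + n" b Q] m n by simp
  finally show ?thesis .
qed

text \<open>
  By Leibniz' formula \<open>a \<mapsto> \<Sum>\<^sub>j t\<^sup>j D\<^sup>j a / j!\<close> is multiplicative as a polynomial in \<open>t\<close>, and \<open>S_map\<close> is its value
  at \<open>t = - Q\<close>.
\<close>

lemma S_map_mult:
  assumes "a \<in> F" "b \<in> F" "nilpotent_at a" "nilpotent_at b"
  shows "S_map D Q (a * b) = S_map D Q a * S_map D Q b"
proof -
  obtain m n where m: "\<And>j. j > m \<Longrightarrow> (D ^^ j) a = 0" and n: "\<And>j. j > n \<Longrightarrow> (D ^^ j) b = 0"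
    using S_map_bound assms(3,4) by metis
  have "(D ^^ j) (a * b) = 0" if "j > m + n" for j
  proof -
    have "((D ^^ k) a / fact k) * ((D ^^ (j - k)) b / fact (j - k)) = 0" for k
      using m[of k] n[of "j - k"] that by (cases "k > m") auto
    then have "(D ^^ j) (a * b) / fact j = 0"
      unfolding iter_mult[OF assms(1,2)] by (simp only: sum.neutral_const)
    then show ?thesis by simp
  qed
  then have "S_map D Q (a * b) = (\<Sum>j\<le>m + n. (- Q) ^ j * ((D ^^ j) (a * b) / fact j))"
    by (rule S_map_eq)
  also have "\<dots> = (\<Sum>j\<le>m + n. (\<Sum>k\<le>j. ((D ^^ k) a / fact k) *
      ((D ^^ (j - k)) b / fact (j - k))) * (- Q) ^ j)"
    by (simp only: iter_mult[OF assms(1,2)] mult.commute)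
  also have "\<dots> = (\<Sum>j\<le>m. ((D ^^ j) a / fact j) * (- Q) ^ j) *
      (\<Sum>j\<le>n. ((D ^^ j) b / fact j) * (- Q) ^ j)"
    by (rule polynomial_product[symmetric]) (use m n in auto)
  also have "\<dots> = S_map D Q a * S_map D Q b"
    using S_map_eq[of m a Q] S_map_eq[of n b Q] m n by (simp add: mult.commute)
  finally show ?thesis .
qed

text \<open>
  \<open>S_map\<close> substitutes \<open>t = - Q\<close> into \<open>exp (t D) a\<close>. As \<open>D Q = 1\<close>, the two contributions to the
  derivative, from the coefficients and from \<open>Q\<close>, cancel.
\<close>

lemma D_S_map:
  assumes a: "a \<in> F" and nil: "nilpotent_at a" and Q: "Q \<in> F" "D Q = 1"
  shows "D (S_map D Q a) = 0"
proof -
  obtain n where n: "\<And>j. j > n \<Longrightarrow> (D ^^ j) a = 0" using S_map_bound nil by metis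
  \<comment> \<open>With \<open>v j\<close>, the derivatives of the summands telescope.\<close>
  define v where "v j = (- Q) ^ j * ((D ^^ Suc j) a / fact j)" for j
  have D_term: "D ((- Q) ^ j * ((D ^^ j) a / fact j)) = v j - (if j = 0 then 0 else v (j - 1))" for j
  proof -
    have "D ((- Q) ^ j * ((D ^^ j) a / fact j)) =
        v j + D ((- Q) ^ j) * ((D ^^ j) a / fact j)"
      using a Q
      by (simp add: D_mult closed iter_closed D_fact_divide v_def add_divide_distrib)
    moreover have "D ((- Q) ^ j) * ((D ^^ j) a / fact j) = - (if j = 0 then 0 else v (j - 1))"
    proof (cases j)
      case (Suc k)
      then show ?thesis
        using Q D_power[of "- Q" k]
        by (simp add: D_minus minus_closed v_def del: power_Suc of_nat_Suc)
    qed simp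
    ultimately show ?thesis by simp
  qed
  have "D (S_map D Q a) = (\<Sum>j\<le>n. v j - (if j = 0 then 0 else v (j - 1)))"
    using S_map_eq[of n a Q] n a Q D_term by (simp add: D_sum closed iter_closed)
  also have "\<dots> = v n"
    by (induction n) auto
  also have "\<dots> = 0" using n[of "Suc n"] by (simp add: v_def)
  finally show ?thesis .
qed

text \<open>
  \<open>S_map D Q a\<close> is a polynomial expression in \<open>Q\<close> and the iterated derivatives of \<open>a\<close>.
\<close>

lemma S_map_annihilated:
  assumes E: "subfield_derivation F E" and a: "a \<in> F" and Q: "Q \<in> F" "E Q = 0"
    and iter: "\<And>j. E ((D ^^ j) a) = 0"
  shows "E (S_map D Q a) = 0"
proof -
  interpret E: subfield_derivation F E by fact
  have "E (Q ^ j) = 0" for j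
    using Q E.D_power[of Q "j - 1"] by (cases j) auto
  moreover have "E ((-1) ^ j) = 0" for j
    by (cases "even j") (auto simp: E.D_minus closed)
  ultimately show ?thesis
    unfolding S_map_def using a Q iter
    by (simp add: E.D_sum E.D_mult closed iter_closed E.D_fact_divide)
qed

end

section \<open>The derivations of the function field\<close>

context unipotent_action
begin

abbreviation "F \<equiv> function_field W"
abbreviation "D \<equiv> deriv_ff W"

lemma emb_add: "f \<in> A \<Longrightarrow> g \<in> A \<Longrightarrow> emb W (f + g) = emb W f + emb W g"
  and emb_mult: "f \<in> A \<Longrightarrow> g \<in> A \<Longrightarrow> emb W (f * g) = emb W f * emb W g"
  and emb_inj: "f \<in> A \<Longrightarrow> g \<in> A \<Longrightarrow> emb W f = emb W g \<longleftrightarrow> f = g"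
  and emb_const_1: "emb W (const 1) = 1"
  using fractions by (auto simp: fraction_embedding_def inj_on_def)

lemma emb_0: "emb W 0 = 0"
  using emb_add[OF coord_ring_0 coord_ring_0] by simp

lemma emb_eq_0: "f \<in> A \<Longrightarrow> emb W f = 0 \<longleftrightarrow> f = 0"
  using emb_inj[OF _ coord_ring_0] emb_0 by simp

lemma emb_minus:
  assumes "f \<in> A"
  shows "emb W (- f) = - emb W f"
  using emb_add[OF assms coord_ring_minus[OF assms]] emb_0
  by (simp add: eq_neg_iff_add_eq_0 add.commute)

lemma emb_diff: "f \<in> A \<Longrightarrow> g \<in> A \<Longrightarrow> emb W (f - g) = emb W f - emb W g"
  using emb_add[of f "- g"] emb_minus coord_ring_minus by simp

lemma emb_sum: "(\<And>i. i \<in> I \<Longrightarrow> f i \<in> A) \<Longrightarrow> emb W (sum f I) = (\<Sum>i\<in>I. emb W (f i))"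
  by (induction I rule: infinite_finite_induct) (auto simp: emb_0 emb_add coord_ring_sum)

lemma coord_ring_no_zero_divisors:
  assumes "f \<in> A" "g \<in> A" "f \<noteq> 0" "g \<noteq> 0"
  shows "f * g \<noteq> 0"
  using assms emb_mult[of f g] emb_eq_0 coord_ring_mult by (metis mult_eq_0_iff)

lemma const_1_nonzero: "const 1 \<noteq> 0"
  using emb_const_1 emb_0 by (metis zero_neq_one)

lemma function_fieldE:
  assumes "r \<in> F"
  obtains f g where "f \<in> A" "g \<in> A" "g \<noteq> 0" "emb W g \<noteq> 0" "emb W f = r * emb W g"
  using assms emb_eq_0 unfolding function_field_def by fastforce

lemma function_fieldI: "f \<in> A \<Longrightarrow> g \<in> A \<Longrightarrow> g \<noteq> 0 \<Longrightarrow> emb W f / emb W g \<in> F"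
  unfolding function_field_def by blast

lemma emb_in_function_field: "f \<in> A \<Longrightarrow> emb W f \<in> F"
  using function_fieldI[OF _ coord_ring_const const_1_nonzero, of f] emb_const_1 by simp

lemma subfield_function_field: "subfield F"
proof
  show "1 \<in> F" using emb_in_function_field[OF coord_ring_const, of 1] emb_const_1 by simp
next
  fix a b assume a: "a \<in> F" and b: "b \<in> F"
  obtain f g where f: "f \<in> A" "g \<in> A" "g \<noteq> 0" "emb W g \<noteq> 0" "emb W f = a * emb W g"
    using function_fieldE[OF a] .
  obtain f' g' where f': "f' \<in> A" "g' \<in> A" "g' \<noteq> 0" "emb W g' \<noteq> 0" "emb W f' = b * emb W g'"
    using function_fieldE[OF b] .
  have gg: "g * g' \<in> A" "g * g' \<noteq> 0"
    using f f' coord_ring_mult coord_ring_no_zero_divisors by auto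
  have "a + b = emb W (f * g' + f' * g) / emb W (g * g')"
    using f f' by (simp add: emb_add emb_mult coord_ring_mult field_simps)
  then show "a + b \<in> F"
    using f f' gg function_fieldI[of "f * g' + f' * g"] coord_ring_add coord_ring_mult by metis
  have "a * b = emb W (f * f') / emb W (g * g')"
    using f f' by (simp add: emb_mult)
  then show "a * b \<in> F"
    using f f' gg function_fieldI[of "f * f'"] coord_ring_mult by metis
next
  fix a assume a: "a \<in> F"
  obtain f g where f: "f \<in> A" "g \<in> A" "g \<noteq> 0" "emb W g \<noteq> 0" "emb W f = a * emb W g"
    using function_fieldE[OF a] .
  then have a_eq: "a = emb W f / emb W g" by simp
  show "- a \<in> F"
    using f a_eq function_fieldI[of "- f" g] coord_ring_minus by (simp add: emb_minus)
  show "inverse a \<in> F"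
  proof (cases "f = 0")
    case True
    then show ?thesis using a a_eq emb_0 by simp
  next
    case False
    then show ?thesis using f(1,2) a_eq function_fieldI[of g f] by simp
  qed
qed

text \<open>
  The quotient rule in the form \<open>(D f - r D g) / g\<close>. Independence of the chosen fraction comes from
  differentiating \<open>f g' = f' g\<close>.
\<close>

lemma deriv_ff_eq:
  assumes "f \<in> A" "g \<in> A" "g \<noteq> 0" and r: "r * emb W g = emb W f"
  shows "D x r = (emb W (\<delta> x f) - r * emb W (\<delta> x g)) / emb W g"
proof -
  have quotient_rule: "(emb W (\<delta> x f) * emb W g - emb W f * emb W (\<delta> x g)) / (emb W g)\<^sup>2 =
      (emb W (\<delta> x f) - r * emb W (\<delta> x g)) / emb W g"
    if "g \<in> A" "g \<noteq> 0" "r * emb W g = emb W f" for f g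
    using that emb_eq_0[of g] unfolding that(3)[symmetric]
    by (simp add: field_simps power2_eq_square)
  show ?thesis
    unfolding deriv_ff_def
  proof (rule the_equality)
    have "r = emb W f / emb W g" using assms emb_eq_0 by (simp add: field_simps)
    then show "\<exists>f'\<in>A. \<exists>g'\<in>A. g' \<noteq> 0 \<and> r = emb W f' / emb W g' \<and>
        (emb W (\<delta> x f) - r * emb W (\<delta> x g)) / emb W g =
        (emb W (\<delta> x f') * emb W g' - emb W f' * emb W (\<delta> x g')) / (emb W g')\<^sup>2"
      using assms quotient_rule[of g f] by (intro bexI[of _ f] bexI[of _ g]) simp_all
  next
    fix r' assume "\<exists>f\<in>A. \<exists>g\<in>A. g \<noteq> 0 \<and> r = emb W f / emb W g \<and>
        r' = (emb W (\<delta> x f) * emb W g - emb W f * emb W (\<delta> x g)) / (emb W g)\<^sup>2"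
    then obtain f' g' where f': "f' \<in> A" "g' \<in> A" "g' \<noteq> 0" and r_eq: "r = emb W f' / emb W g'" and
      r': "r' = (emb W (\<delta> x f') * emb W g' - emb W f' * emb W (\<delta> x g')) / (emb W g')\<^sup>2"
      by blast
    have rf': "r * emb W g' = emb W f'" using f' emb_eq_0 r_eq by simp
    have "emb W (f * g') = emb W (f' * g)"
      using assms f' rf' by (simp add: emb_mult flip: r rf')
    then have "f * g' = f' * g"
      using assms f' emb_inj coord_ring_mult by blast
    then have "emb W (\<delta> x (f * g')) = emb W (\<delta> x (f' * g))" by simp
    then have "emb W f * emb W (\<delta> x g') + emb W (\<delta> x f) * emb W g' =
        emb W f' * emb W (\<delta> x g) + emb W (\<delta> x f') * emb W g"
      using assms f'
      by (simp add: deriv_fun_mult emb_add emb_mult deriv_fun_closed coord_ring_mult)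
    then have "(emb W (\<delta> x f) - r * emb W (\<delta> x g)) * emb W g' =
        (emb W (\<delta> x f') - r * emb W (\<delta> x g')) * emb W g"
      by (simp add: algebra_simps flip: r rf')
    then show "r' = (emb W (\<delta> x f) - r * emb W (\<delta> x g)) / emb W g"
      using assms f' emb_eq_0 rf' unfolding r' by (subst quotient_rule) (simp_all add: field_simps)
  qed
qed

lemma deriv_ff_emb: "f \<in> A \<Longrightarrow> D x (emb W f) = emb W (\<delta> x f)"
  using deriv_ff_eq[OF _ coord_ring_const const_1_nonzero, of f "emb W f" x]
  unfolding deriv_fun_const emb_const_1 emb_0 by simp

lemma deriv_ff_scalar: "D x (scalar_ff W c) = 0"
  unfolding scalar_ff_def by (simp add: deriv_ff_emb coord_ring_const deriv_fun_const emb_0)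

lemma subfield_derivation_deriv_ff: "subfield_derivation F (D x)"
proof -
  interpret subfield F by (rule subfield_function_field)
  show ?thesis
  proof
    fix a assume a: "a \<in> F"
    obtain f g where f: "f \<in> A" "g \<in> A" "g \<noteq> 0" "emb W g \<noteq> 0" "emb W f = a * emb W g"
      using function_fieldE[OF a] .
    have "D x a = (emb W (\<delta> x f) - a * emb W (\<delta> x g)) / emb W g"
      using f by (intro deriv_ff_eq) auto
    then show "D x a \<in> F"
      using f a by (auto intro!: closed emb_in_function_field deriv_fun_closed)
  next
    fix a b assume a: "a \<in> F" and b: "b \<in> F"
    obtain f g where f: "f \<in> A" "g \<in> A" "g \<noteq> 0" "emb W g \<noteq> 0" "emb W f = a * emb W g"
      using function_fieldE[OF a] .
    obtain f' g' where f': "f' \<in> A" "g' \<in> A" "g' \<noteq> 0" "emb W g' \<noteq> 0" "emb W f' = b * emb W g'"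
      using function_fieldE[OF b] .
    have gg: "g * g' \<in> A" "g * g' \<noteq> 0"
      using f f' coord_ring_mult coord_ring_no_zero_divisors by auto
    have Da: "D x a = (emb W (\<delta> x f) - a * emb W (\<delta> x g)) / emb W g"
      using f by (intro deriv_ff_eq) auto
    have Db: "D x b = (emb W (\<delta> x f') - b * emb W (\<delta> x g')) / emb W g'"
      using f' by (intro deriv_ff_eq) auto
    note hom = emb_add emb_mult deriv_fun_add deriv_fun_mult coord_ring_mult coord_ring_add
      deriv_fun_closed
    have "D x (a + b) =
        (emb W (\<delta> x (f * g' + f' * g)) - (a + b) * emb W (\<delta> x (g * g'))) / emb W (g * g')"
      using f f' gg by (intro deriv_ff_eq) (simp_all add: hom field_simps)
    also have "\<dots> = D x a + D x b"
      unfolding Da Db using f f' by (simp add: hom field_simps)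
    finally show "D x (a + b) = D x a + D x b" .
    have "D x (a * b) =
        (emb W (\<delta> x (f * f')) - (a * b) * emb W (\<delta> x (g * g'))) / emb W (g * g')"
      using f f' gg by (intro deriv_ff_eq) (simp_all add: hom)
    also have "\<dots> = a * D x b + D x a * b"
      unfolding Da Db using f f' by (simp add: hom field_simps)
    finally show "D x (a * b) = a * D x b + D x a * b" .
  qed
qed

sublocale FD: subfield_derivation "function_field W" "deriv_ff W x" for x
  by (rule subfield_derivation_deriv_ff)

lemma scalar_ff_const: "scalar_ff W c = emb W (const c)"
  by (simp add: scalar_ff_def)

lemma scalar_ff_in_function_field: "scalar_ff W c \<in> F"
  by (simp add: scalar_ff_const emb_in_function_field coord_ring_const)

lemma scalar_ff_1: "scalar_ff W 1 = 1"
  unfolding scalar_ff_def by (rule emb_const_1)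

lemma scalar_ff_add: "scalar_ff W (a + b) = scalar_ff W a + scalar_ff W b"
proof -
  have "const (a + b) = const a + const b" by (auto simp: restr_def e_add)
  then show ?thesis by (simp add: scalar_ff_const emb_add coord_ring_const del: plus_fun_apply)
qed

lemma scalar_ff_mult: "scalar_ff W (a * b) = scalar_ff W a * scalar_ff W b"
proof -
  have "const (a * b) = const a * const b" by (auto simp: restr_def e_mult)
  then show ?thesis by (simp add: scalar_ff_const emb_mult coord_ring_const del: times_fun_apply)
qed

lemma scalar_ff_minus_1: "scalar_ff W (- 1) = - 1"
proof -
  have "scalar_ff W (- 1 + 1) = scalar_ff W (- 1) + 1"
    by (simp only: scalar_ff_add scalar_ff_1)
  moreover have "scalar_ff W 0 = 0" using scalar_ff_add[of 0 0] by simp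
  ultimately show ?thesis by (simp add: eq_neg_iff_add_eq_0)
qed

lemma scalar_ff_inverse_fact: "scalar_ff W (inverse (fact j)) = inverse (fact j)"
proof -
  have "scalar_ff W (of_nat n) = of_nat n" for n
  proof (induction n)
    case 0
    then show ?case using scalar_ff_add[of 0 0] by simp
  qed (simp add: scalar_ff_add scalar_ff_1)
  from this[of "fact j"] have "scalar_ff W (fact j) = fact j" by simp
  moreover have "scalar_ff W (inverse (fact j)) * scalar_ff W (fact j) = 1"
    using scalar_ff_1 by (simp flip: scalar_ff_mult)
  ultimately show ?thesis by (simp add: field_simps)
qed

text \<open>
  Identities between derivations of \<open>K[X]\<close> carry over to \<open>K(X)\<close>, as a derivation is determined by
  its values at numerators and denominators.
\<close>

lemma deriv_ff_linear:
  assumes r: "r \<in> F"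
  shows "D (x + y) r = D x r + D y r" "D (smult W a x) r = scalar_ff W a * D x r"
proof -
  obtain f g where f: "f \<in> A" "g \<in> A" "g \<noteq> 0" "emb W g \<noteq> 0" "emb W f = r * emb W g"
    using function_fieldE[OF r] .
  have Dr: "D x r = (emb W (\<delta> x f) - r * emb W (\<delta> x g)) / emb W g" for x
    using f by (intro deriv_ff_eq) auto
  show "D (x + y) r = D x r + D y r"
    unfolding Dr using f
    by (simp add: deriv_fun_linear_and_bracket(1) emb_add deriv_fun_closed field_simps)
  show "D (smult W a x) r = scalar_ff W a * D x r"
    unfolding Dr scalar_ff_const using f
    by (simp add: deriv_fun_linear_and_bracket(2) emb_mult deriv_fun_closed coord_ring_const
        field_simps)
qed

lemma deriv_ff_bracket:
  assumes r: "r \<in> F"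
  shows "D (bracket W x y) r = D x (D y r) - D y (D x r)"
proof -
  obtain f g where f: "f \<in> A" "g \<in> A" "g \<noteq> 0" "emb W g \<noteq> 0" "emb W f = r * emb W g"
    using function_fieldE[OF r] .
  define E where "E a = D x (D y a) - D y (D x a) - D (bracket W x y) a" for a
  have E_emb: "E (emb W h) = 0" if "h \<in> A" for h
    using that
    by (simp add: E_def deriv_ff_emb deriv_fun_closed deriv_fun_linear_and_bracket(3) emb_diff
        coord_ring_diff del: fun_diff_def)
  have "E (r * emb W g) = E r * emb W g + r * E (emb W g)"
    using r emb_in_function_field[OF f(2)]
    by (simp add: E_def FD.D_mult FD.D_add FD.D_closed FD.closed algebra_simps)
  then have "E r * emb W g = 0"
    using E_emb[OF f(1)] E_emb[OF f(2)] unfolding f(5) by simp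
  then have "E r = 0" using f(4) by simp
  then show ?thesis by (simp add: E_def)
qed

lemma deriv_ff_nilpotent_emb:
  assumes "f \<in> A"
  shows "FD.nilpotent_at x (emb W f)"
proof -
  have iter: "(D x ^^ j) (emb W f) = emb W ((\<delta> x ^^ j) f)" for j
    by (induction j) (use assms in \<open>auto simp: deriv_ff_emb iterated_deriv_closed\<close>)
  obtain d where "\<forall>j>d. (\<delta> x ^^ j) f = 0" using flow_exp_series[OF assms] by blast
  then have "(\<delta> x ^^ Suc d) f = 0" by blast
  then have "(D x ^^ Suc d) (emb W f) = 0" unfolding iter by (simp only: emb_0)
  then show ?thesis unfolding FD.nilpotent_at_def by blast
qed

section \<open>Invariants of the group and of the Lie algebra\<close>

text \<open>
  The translation by the inverse group element recovers \<open>g\<close>. Hence translated fractions have nonzero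
  denominators.
\<close>

lemma trans_fun_nonzero:
  assumes "g \<in> A" "g \<noteq> 0"
  shows "T y g \<noteq> 0"
proof
  assume "T y g = 0"
  then have "T (- y) (T y g) = 0" by (auto simp: trans_fun_def restr_def)
  moreover have "T (- y) (T y g) = g"
    by (rule ext) (simp add: trans_fun_def restr_def coord_ring_off[OF assms(1)] act_points act_inverse)
  ultimately show False using assms(2) by simp
qed

lemma trans_eq:
  assumes "f \<in> A" "g \<in> A" "g \<noteq> 0"
  shows "trans W y (emb W f / emb W g) = emb W (T y f) / emb W (T y g)"
  unfolding trans_def
proof (rule the_equality)
  show "\<exists>f'\<in>A. \<exists>g'\<in>A. g' \<noteq> 0 \<and> emb W f / emb W g = emb W f' / emb W g' \<and>
      emb W (T y f) / emb W (T y g) = emb W (T y f') / emb W (T y g')"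
    using assms by blast
next
  fix r' assume "\<exists>f'\<in>A. \<exists>g'\<in>A. g' \<noteq> 0 \<and> emb W f / emb W g = emb W f' / emb W g' \<and>
      r' = emb W (T y f') / emb W (T y g')"
  then obtain f' g' where f': "f' \<in> A" "g' \<in> A" "g' \<noteq> 0"
    and eq: "emb W f / emb W g = emb W f' / emb W g'"
    and r': "r' = emb W (T y f') / emb W (T y g')" by blast
  have "emb W (f * g') = emb W (f' * g)"
    using assms f' eq emb_eq_0 by (simp add: emb_mult field_simps)
  then have "f * g' = f' * g" using assms f' emb_inj coord_ring_mult by blast
  then have "T y f * T y g' = T y f' * T y g" by (metis trans_fun_mult)
  then have "emb W (T y f) * emb W (T y g') = emb W (T y f') * emb W (T y g)"
    using assms f' flow_in_coord_ring emb_mult by metis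
  moreover have "emb W (T y g) \<noteq> 0" "emb W (T y g') \<noteq> 0"
    using assms f' trans_fun_nonzero flow_in_coord_ring emb_eq_0 by auto
  ultimately show "r' = emb W (T y f) / emb W (T y g)" unfolding r' by (simp add: field_simps)
qed

text \<open>
  Any sufficiently large upper bound of summation is allowed, so that the series of a numerator and of
  a denominator can be cut off at the same place.
\<close>

lemma emb_flow:
  assumes "f \<in> A"
  shows "\<exists>d. \<forall>n\<ge>d. emb W (T y f) = (\<Sum>j\<le>n. inverse (fact j) * (D y ^^ j) (emb W f))"
proof -
  obtain d where d: "\<forall>j>d. (\<delta> y ^^ j) f = 0"
    "\<forall>t p. T (smult W t y) f p = (\<Sum>j\<le>d. ext W t ^ j * ((\<delta> y ^^ j) f p / fact j))"
    using flow_exp_series[OF assms] by blast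
  have iter: "(D y ^^ j) (emb W f) = emb W ((\<delta> y ^^ j) f)" for j
    by (induction j) (use assms in \<open>auto simp: deriv_ff_emb iterated_deriv_closed\<close>)
  have e_inverse_fact: "ext W (inverse (fact j)) = inverse (fact j)" for j
  proof -
    have "ext W (inverse (fact j)) * ext W (of_nat (fact j)) = 1"
      by (simp flip: e_mult)
    then show ?thesis unfolding e_of_nat by (simp add: field_simps)
  qed
  have "emb W (T y f) = (\<Sum>j\<le>n. inverse (fact j) * (D y ^^ j) (emb W f))" if "n \<ge> d" for n
  proof -
    have "T y f p = (\<Sum>j\<le>n. const (inverse (fact j)) * (\<delta> y ^^ j) f) p" for p
    proof -
      have "T y f p = T (smult W 1 y) f p" by simp
      also have "\<dots> = (\<Sum>j\<le>d. ext W 1 ^ j * ((\<delta> y ^^ j) f p / fact j))"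
        using d(2) by blast
      also have "\<dots> = (\<Sum>j\<le>n. ext W 1 ^ j * ((\<delta> y ^^ j) f p / fact j))"
        by (rule sum.mono_neutral_left) (use d(1) that in auto)
      also have "\<dots> = (\<Sum>j\<le>n. (const (inverse (fact j)) * (\<delta> y ^^ j) f) p)"
        unfolding const_times[OF iterated_deriv_closed[OF assms]]
        by (simp add: e_inverse_fact divide_inverse mult.commute)
      finally show ?thesis by (simp only: sum_fun_apply)
    qed
    then have "T y f = (\<Sum>j\<le>n. const (inverse (fact j)) * (\<delta> y ^^ j) f)" by blast
    then have "emb W (T y f) = (\<Sum>j\<le>n. emb W (const (inverse (fact j)) * (\<delta> y ^^ j) f))"
      by (simp only: emb_sum coord_ring_mult coord_ring_const iterated_deriv_closed assms)
    also have "\<dots> = (\<Sum>j\<le>n. inverse (fact j) * (D y ^^ j) (emb W f))"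
      unfolding iter scalar_ff_inverse_fact[symmetric] scalar_ff_const
      by (intro sum.cong refl emb_mult coord_ring_const iterated_deriv_closed assms)
    finally show ?thesis .
  qed
  then show ?thesis by blast
qed

text \<open>
  For \<open>r = f / g\<close> invariance means \<open>T\<^sub>y f \<cdot> g = f \<cdot> T\<^sub>y g\<close>. The coefficient of \<open>t\<close> of this identity at \<open>y = t x\<close>
  says \<open>D\<^sub>x r = 0\<close>. Conversely, \<open>D\<^sub>x r = 0\<close> gives \<open>D\<^sub>x\<^sup>j f = r D\<^sub>x\<^sup>j g\<close> for all \<open>j\<close>, and the exponential series of \<open>f\<close>
  is \<open>r\<close> times that of \<open>g\<close>.
\<close>

lemma invariant_iff_annihilated:
  assumes r: "r \<in> F"
  shows "(\<forall>y. trans W y r = r) \<longleftrightarrow> (\<forall>x. D x r = 0)"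
proof -
  obtain f g where f: "f \<in> A" "g \<in> A" "g \<noteq> 0" "emb W g \<noteq> 0" "emb W f = r * emb W g"
    using function_fieldE[OF r] .
  have "r = emb W f / emb W g" using f by simp
  then have trans_r: "trans W y r = emb W (T y f) / emb W (T y g)" for y
    using f trans_eq by blast
  have Tg: "emb W (T y g) \<noteq> 0" for y
    using f trans_fun_nonzero flow_in_coord_ring emb_eq_0 by auto
  show ?thesis
  proof
    assume inv: "\<forall>y. trans W y r = r"
    show "\<forall>x. D x r = 0"
    proof
      fix x
      obtain d c where c: "flow_expansion x f d c" using flow_expansion_exists f by blast
      obtain d' c' where c': "flow_expansion x g d' c'" using flow_expansion_exists f by blast
      have "emb W (T y f * g) = emb W (f * T y g)" for y
      proof -
        have "emb W (T y f) = r * emb W (T y g)"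
          using inv[rule_format, of y] Tg[of y] unfolding trans_r by (simp add: field_simps)
        then show ?thesis using f by (simp add: emb_mult flow_in_coord_ring)
      qed
      then have eq: "T y f * g = f * T y g" for y
        using emb_inj[OF coord_ring_mult[OF flow_in_coord_ring[OF f(1)] f(2)]
            coord_ring_mult[OF f(1) flow_in_coord_ring[OF f(2)]]] by simp
      have "c 1 p * g p = f p * c' 1 p" for p
      proof -
        have "(\<Sum>j\<le>d. ext W t ^ j * (c j p * g p)) = (\<Sum>j\<le>d'. ext W t ^ j * (f p * c' j p))" for t
        proof -
          have "T (smult W t x) f p * g p = f p * T (smult W t x) g p"
            using fun_cong[OF eq[of "smult W t x"], of p] by simp
          then show ?thesis
            using c c' unfolding flow_expansion_def
            by (simp add: sum_distrib_left sum_distrib_right mult_ac)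
        qed
        from power_sum_coeff[OF this, of 1] show ?thesis
          using c c' by (auto simp: flow_expansion_def split: if_splits)
      qed
      then have "\<delta> x f * g = f * \<delta> x g"
        unfolding deriv_fun_eq[OF c] deriv_fun_eq[OF c'] by (auto simp: fun_eq_iff)
      then have "emb W (\<delta> x f) * emb W g = emb W f * emb W (\<delta> x g)"
        using f emb_mult deriv_fun_closed by metis
      moreover have "D x r = (emb W (\<delta> x f) - r * emb W (\<delta> x g)) / emb W g"
        using f by (intro deriv_ff_eq) auto
      ultimately show "D x r = 0" using f by (simp add: field_simps)
    qed
  next
    assume ann: "\<forall>x. D x r = 0"
    show "\<forall>y. trans W y r = r"
    proof
      fix y
      have iter: "(D y ^^ j) (emb W f) = r * (D y ^^ j) (emb W g)" for j
      proof (induction j)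
        case 0
        show ?case using f by simp
      next
        case (Suc j)
        have "(D y ^^ j) (emb W g) \<in> F"
          by (rule FD.iter_closed[OF emb_in_function_field[OF f(2)]])
        from FD.D_mult[OF r this, of y] show ?case using Suc ann by simp
      qed
      obtain d where d:
        "\<And>n. n \<ge> d \<Longrightarrow> emb W (T y f) = (\<Sum>j\<le>n. inverse (fact j) * (D y ^^ j) (emb W f))"
        using emb_flow[OF f(1)] by blast
      obtain d' where d':
        "\<And>n. n \<ge> d' \<Longrightarrow> emb W (T y g) = (\<Sum>j\<le>n. inverse (fact j) * (D y ^^ j) (emb W g))"
        using emb_flow[OF f(2)] by blast
      have "emb W (T y f) = (\<Sum>j\<le>max d d'. inverse (fact j) * (D y ^^ j) (emb W f))"
        by (rule d) simp
      moreover have "emb W (T y g) = (\<Sum>j\<le>max d d'. inverse (fact j) * (D y ^^ j) (emb W g))"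
        by (rule d') simp
      ultimately have "emb W (T y f) = r * emb W (T y g)"
        unfolding iter by (simp add: sum_distrib_left mult_ac)
      then show "trans W y r = r" unfolding trans_r using Tg by simp
    qed
  qed
qed

lemma group_invariants_eq: "B \<subseteq> F \<Longrightarrow> group_invariants W B = lie_invariants W B UNIV"
  using invariant_iff_annihilated unfolding group_invariants_def lie_invariants_def by blast

end

section \<open>The projector\<close>

locale projector_construction = unipotent_action W
  for W :: "('k::field_char_0, 'l::field_char_0, 'n, 'u::ab_group_add, 'f::field_char_0) uvariety" +
  fixes \<uu> :: "nat \<Rightarrow> 'u set" and i :: "nat \<Rightarrow> nat" and x :: "nat \<Rightarrow> 'u"
    and a0 a1 :: "nat \<Rightarrow> 'f" and n m :: nat
  assumes chain: "ideal_chain W n \<uu>"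
    and projector_data: "projector_data W n \<uu> m i x a0 a1"
begin

text \<open>
  \<open>B k\<close> is the localization of \<open>B 0 = K[X]\<close> at the first \<open>k\<close> denominators, and \<open>B m = K[X\<^sub>0]\<close>; the letter
  \<open>A\<close> denotes the coordinate ring before its embedding into the field.
\<close>

abbreviation "B k \<equiv> loc_alg W a0 k"
abbreviation "annihilated V r \<equiv> \<forall>y\<in>V. D y r = 0"

lemma u_0: "\<uu> 0 = {0}" and u_n: "\<uu> n = UNIV"
  and u_subspace: "j \<le> n \<Longrightarrow> subspace (\<uu> j)"
  and u_ideal: "j \<le> n \<Longrightarrow> y \<in> \<uu> j \<Longrightarrow> bracket W z y \<in> \<uu> j"
  and u_Suc: "j < n \<Longrightarrow> \<uu> j \<subset> \<uu> (Suc j)"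
  and u_dim: "j < n \<Longrightarrow> dim (\<uu> (Suc j)) = dim (\<uu> j) + 1"
  using chain by (auto simp: ideal_chain_def lie_ideal_def)

lemma u_mono:
  assumes "j \<le> k" "k \<le> n"
  shows "\<uu> j \<subseteq> \<uu> k"
  using assms
proof (induction k rule: dec_induct)
  case (step k)
  then show ?case using u_Suc[of k] by auto
qed simp

text \<open>
  Consecutive ideals differ by one dimension.
\<close>

lemma u_Suc_decompose:
  assumes "j < n" "v \<in> \<uu> (Suc j) - \<uu> j" "y \<in> \<uu> (Suc j)"
  shows "\<exists>c. \<exists>w\<in>\<uu> j. y = w + smult W c v"
proof -
  obtain S where S: "finite S" "span S = UNIV"
    using nilpotent_lie by (auto simp: fd_nilpotent_lie_algebra_def)
  obtain E where E: "independent E" "UNIV \<subseteq> span E" using basis_exists[of UNIV] by blast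
  have "finite E" using independent_span_bound[OF S(1) E(1)] S(2) by simp
  then interpret fd: finite_dimensional_vector_space "smult W" E
    using E by unfold_locales auto
  have sub: "subspace (\<uu> j)" "subspace (\<uu> (Suc j))" using assms u_subspace by auto
  then have span_u: "span (\<uu> j) = \<uu> j" by (simp add: span_eq_iff)
  have "span (insert v (\<uu> j)) = \<uu> (Suc j)"
  proof (rule fd.subspace_dim_equal)
    show "span (insert v (\<uu> j)) \<subseteq> \<uu> (Suc j)"
      using assms u_Suc[of j] sub by (intro span_minimal) auto
    have "v \<notin> span (\<uu> j)" using assms unfolding span_u by blast
    then show "dim (\<uu> (Suc j)) \<le> dim (span (insert v (\<uu> j)))"
      using fd.dim_insert[of v "\<uu> j"] u_dim[OF assms(1)] by simp
  qed (use sub in auto)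
  then have "y \<in> span (insert v (\<uu> j))" using assms by simp
  then obtain c where "y - smult W c v \<in> span (\<uu> j)" by (auto simp: span_insert)
  then have "y - smult W c v \<in> \<uu> j" unfolding span_u .
  then show ?thesis by (metis diff_add_cancel)
qed

text \<open>
  For \<open>y\<close> in the ideal, \<open>D\<^sub>y D\<^sub>z r = D\<^sub>z D\<^sub>y r + D\<^sub>[\<^sub>y\<^sub>,\<^sub>z\<^sub>] r\<close> and \<open>[y,z]\<close> lies in the ideal again.
\<close>

lemma annihilated_deriv:
  assumes "j \<le> n" "r \<in> F" "annihilated (\<uu> j) r"
  shows "annihilated (\<uu> j) (D z r)"
proof
  fix y assume y: "y \<in> \<uu> j"
  have "bracket W y z = - bracket W z y" by (rule br_swap)
  then have "bracket W y z \<in> \<uu> j"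
    using u_ideal[OF assms(1) y] u_subspace[OF assms(1)] by (simp add: subspace_neg)
  then have "D y (D z r) - D z (D y r) = 0"
    using assms deriv_ff_bracket[of r y z] by simp
  then show "D y (D z r) = 0" using assms y by simp
qed

lemma annihilated_iter:
  assumes "j \<le> n" "r \<in> F" "annihilated (\<uu> j) r"
  shows "annihilated (\<uu> j) ((D z ^^ k) r)"
proof (induction k)
  case (Suc k)
  then show ?case using annihilated_deriv[OF assms(1) FD.iter_closed[OF assms(2)]] by simp
qed (use assms in simp)

lemma annihilated_Suc:
  assumes "j < n" "v \<in> \<uu> (Suc j) - \<uu> j" "r \<in> F" "annihilated (\<uu> j) r" "D v r = 0"
  shows "annihilated (\<uu> (Suc j)) r"
proof
  fix y assume "y \<in> \<uu> (Suc j)"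
  then obtain c w where "w \<in> \<uu> j" "y = w + smult W c v"
    using u_Suc_decompose assms by blast
  then show "D y r = 0" using assms by (simp add: deriv_ff_linear)
qed

lemma loc_alg_scalar: "scalar_ff W c \<in> B k"
proof (cases k)
  case 0
  then show ?thesis by (simp add: scalar_ff_const coord_ring_const)
qed (simp add: gen_alg.scalar)

lemma loc_alg_add: "f \<in> B k \<Longrightarrow> g \<in> B k \<Longrightarrow> f + g \<in> B k"
proof (cases k)
  case 0
  assume "f \<in> B k" "g \<in> B k"
  with 0 obtain f' g' where "f' \<in> A" "f = emb W f'" "g' \<in> A" "g = emb W g'" by auto
  then show ?thesis using 0 emb_add[of f' g'] coord_ring_add[of f' g'] by (metis imageI loc_alg.simps(1))
qed (auto intro: gen_alg.add)

lemma loc_alg_mult: "f \<in> B k \<Longrightarrow> g \<in> B k \<Longrightarrow> f * g \<in> B k"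
proof (cases k)
  case 0
  assume "f \<in> B k" "g \<in> B k"
  with 0 obtain f' g' where "f' \<in> A" "f = emb W f'" "g' \<in> A" "g = emb W g'" by auto
  then show ?thesis using 0 emb_mult[of f' g'] coord_ring_mult[of f' g'] by (metis imageI loc_alg.simps(1))
qed (auto intro: gen_alg.mult)

lemma loc_alg_1: "1 \<in> B k"
  using loc_alg_scalar[of 1] scalar_ff_1 by simp

lemma loc_alg_0: "0 \<in> B k"
  using loc_alg_scalar[of 0] scalar_ff_add[of 0 0] by simp

lemma loc_alg_minus: "f \<in> B k \<Longrightarrow> - f \<in> B k"
  using loc_alg_mult[OF loc_alg_scalar[of "- 1"]] scalar_ff_minus_1 by fastforce

lemma loc_alg_diff: "f \<in> B k \<Longrightarrow> g \<in> B k \<Longrightarrow> f - g \<in> B k"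
  using loc_alg_add[of f k "- g"] loc_alg_minus by simp

lemma loc_alg_power: "f \<in> B k \<Longrightarrow> f ^ j \<in> B k"
  by (induction j) (auto intro: loc_alg_1 loc_alg_mult)

lemma loc_alg_sum: "(\<And>i. i \<in> I \<Longrightarrow> f i \<in> B k) \<Longrightarrow> sum f I \<in> B k"
  by (induction I rule: infinite_finite_induct) (auto intro: loc_alg_0 loc_alg_add)

lemma loc_alg_mono: "j \<le> k \<Longrightarrow> B j \<subseteq> B k"
proof (induction k rule: dec_induct)
  case (step k)
  then show ?case by (auto intro: gen_alg.gen)
qed simp

lemma i_0: "i 0 = 0"
  and stable_m: "lie_invariants W (B m) UNIV = lie_invariants W (B m) (\<uu> (i m))"
  using projector_data by (auto simp: projector_data_def)

lemma step_data:
  assumes "k \<in> {1..m}"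
  shows "lie_invariants W (B (k - 1)) UNIV \<noteq> lie_invariants W (B (k - 1)) (\<uu> (i (k - 1)))"
    and "i k = (LEAST j. i (k - 1) < j \<and> j \<le> n \<and>
      lie_invariants W (B (k - 1)) (\<uu> j) \<noteq> lie_invariants W (B (k - 1)) (\<uu> (i (k - 1))))"
    and "x k \<in> \<uu> (i k) - \<uu> (i k - 1)"
    and "a1 k \<in> lie_invariants W (B (k - 1)) (\<uu> (i (k - 1)))"
    and "a0 k \<in> lie_invariants W (B (k - 1)) UNIV" "a0 k \<noteq> 0" "D (x k) (a1 k) = a0 k"
  using projector_data assms unfolding projector_data_def Let_def by blast+

lemma a0_loc_alg: "k \<in> {1..m} \<Longrightarrow> a0 k \<in> B (k - 1)"
  and a0_invariant: "k \<in> {1..m} \<Longrightarrow> D y (a0 k) = 0"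
  and a1_loc_alg: "k \<in> {1..m} \<Longrightarrow> a1 k \<in> B (k - 1)"
  and a1_annihilated: "k \<in> {1..m} \<Longrightarrow> annihilated (\<uu> (i (k - 1))) (a1 k)"
  using step_data(4,5) by (auto simp: lie_invariants_def)

text \<open>
  Every \<open>a0 k\<close> is invariant, so localizing at it neither destroys stability under the derivations
  nor their local nilpotency.
\<close>

lemma loc_alg_properties:
  assumes "k \<le> m" "r \<in> B k"
  shows "r \<in> F \<and> D y r \<in> B k \<and> FD.nilpotent_at y r"
  using assms
proof (induction k arbitrary: r)
  case 0
  then obtain f where "f \<in> A" "r = emb W f" by auto
  then show ?case
    by (simp add: emb_in_function_field deriv_ff_emb deriv_fun_closed deriv_ff_nilpotent_emb)
next
  case (Suc k)
  have k: "Suc k \<in> {1..m}" using Suc.prems by simp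
  have a0: "a0 (Suc k) \<in> F" using Suc.IH[of "a0 (Suc k)"] Suc.prems a0_loc_alg[OF k] by simp
  have "r \<in> gen_alg (scalar_ff W) (B k \<union> {inverse (a0 (Suc k))})" using Suc.prems by simp
  then show ?case
  proof (induction r rule: gen_alg.induct)
    case (scalar c)
    show ?case
      by (simp add: loc_alg_0 scalar_ff_in_function_field deriv_ff_scalar FD.nilpotent_at_kernel
          del: loc_alg.simps)
  next
    case (gen g)
    then consider "g \<in> B k" | "g = inverse (a0 (Suc k))" by blast
    then show ?case
    proof cases
      case 1
      then show ?thesis using Suc.IH[of g] Suc.prems loc_alg_mono[of k "Suc k"] by auto
    next
      case 2
      have "D y g = 0" unfolding 2 by (rule FD.D_inverse_kernel[OF a0 a0_invariant[OF k]])
      then show ?thesis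
        using 2 a0
        by (simp add: FD.inverse_closed loc_alg_0 FD.nilpotent_at_kernel del: loc_alg.simps)
    qed
  next
    case (add f g)
    then show ?case
      using FD.D_add FD.add_closed FD.nilpotent_at_add loc_alg_add[of "D y f" "Suc k"] by simp
  next
    case (mult f g)
    then have "f \<in> B (Suc k)" "g \<in> B (Suc k)" by simp_all
    then have "f * D y g + D y f * g \<in> B (Suc k)"
      using mult.IH loc_alg_add loc_alg_mult by blast
    then show ?case
      using mult.IH FD.D_mult FD.mult_closed FD.nilpotent_at_mult by simp
  qed
qed

lemma loc_alg_function_field: "k \<le> m \<Longrightarrow> r \<in> B k \<Longrightarrow> r \<in> F"
  and loc_alg_deriv: "k \<le> m \<Longrightarrow> r \<in> B k \<Longrightarrow> D y r \<in> B k"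
  and loc_alg_nilpotent: "k \<le> m \<Longrightarrow> r \<in> B k \<Longrightarrow> FD.nilpotent_at y r"
  using loc_alg_properties by blast+

lemma loc_alg_iter: "k \<le> m \<Longrightarrow> r \<in> B k \<Longrightarrow> (D y ^^ j) r \<in> B k"
  by (induction j) (auto simp: loc_alg_deriv)

lemma a0_in: "k \<in> {1..m} \<Longrightarrow> a0 k \<in> B m" and a1_in: "k \<in> {1..m} \<Longrightarrow> a1 k \<in> B m"
proof -
  assume k: "k \<in> {1..m}"
  then have "B (k - 1) \<subseteq> B m" by (intro loc_alg_mono) auto
  then show "a0 k \<in> B m" "a1 k \<in> B m" using k a0_loc_alg a1_loc_alg by blast+
qed

lemma inverse_a0_in: "k \<in> {1..m} \<Longrightarrow> inverse (a0 k) \<in> B m"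
proof -
  assume k: "k \<in> {1..m}"
  then obtain j where j: "k = Suc j" by (cases k) auto
  have "inverse (a0 k) \<in> B k" unfolding j by (auto intro: gen_alg.gen)
  then show ?thesis using k loc_alg_mono[of k m] by auto
qed

text \<open>
  The elements of \<open>B (k + 1)\<close> have powers of the invariant \<open>a0 (k + 1)\<close> as denominators. It is enough to
  know that the denominator \<open>w\<close> is some nonzero invariant of \<open>B k\<close>, which passes to sums and products.
\<close>

lemma clear_denominators_step:
  assumes k: "Suc k \<le> m" and r: "r \<in> B (Suc k)"
  shows "\<exists>w\<in>B k. w \<noteq> 0 \<and> (\<forall>y. D y w = 0) \<and> r * w \<in> B k"
proof -
  have wF: "w \<in> F" if "w \<in> B k" for w using that k loc_alg_function_field[of k] by simp
  have combine: "w * w' \<in> B k \<and> w * w' \<noteq> 0 \<and> (\<forall>y. D y (w * w') = 0)"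
    if "w \<in> B k" "w' \<in> B k" "w \<noteq> 0" "w' \<noteq> 0" "\<forall>y. D y w = 0" "\<forall>y. D y w' = 0" for w w'
    using that wF by (simp add: loc_alg_mult FD.D_mult)
  have "r \<in> gen_alg (scalar_ff W) (B k \<union> {inverse (a0 (Suc k))})" using r by simp
  then show ?thesis
  proof (induction r rule: gen_alg.induct)
    case (scalar c)
    show ?case by (intro bexI[of _ 1]) (simp_all add: loc_alg_scalar loc_alg_1)
  next
    case (gen g)
    have Suck: "Suc k \<in> {1..m}" using k by simp
    from gen consider "g \<in> B k" | "g = inverse (a0 (Suc k))" by blast
    then show ?case
    proof cases
      case 1
      then show ?thesis by (intro bexI[of _ 1]) (simp_all add: loc_alg_1)
    next
      case 2
      then show ?thesis
        using a0_loc_alg[OF Suck] a0_invariant[OF Suck] step_data(6)[OF Suck]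
        by (intro bexI[of _ "a0 (Suc k)"]) (simp_all add: loc_alg_1)
    qed
  next
    case (add f g)
    then obtain w w' where w: "w \<in> B k" "w \<noteq> 0" "\<forall>y. D y w = 0" "f * w \<in> B k"
      "w' \<in> B k" "w' \<noteq> 0" "\<forall>y. D y w' = 0" "g * w' \<in> B k" by blast
    have eq: "(f + g) * (w * w') = (f * w) * w' + (g * w') * w" by (simp add: algebra_simps)
    have "(f + g) * (w * w') \<in> B k" unfolding eq using w loc_alg_add loc_alg_mult by blast
    then show ?case using combine[of w w'] w by (intro bexI[of _ "w * w'"]) simp_all
  next
    case (mult f g)
    then obtain w w' where w: "w \<in> B k" "w \<noteq> 0" "\<forall>y. D y w = 0" "f * w \<in> B k"
      "w' \<in> B k" "w' \<noteq> 0" "\<forall>y. D y w' = 0" "g * w' \<in> B k" by blast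
    have eq: "(f * g) * (w * w') = (f * w) * (g * w')" by (simp add: algebra_simps)
    have "(f * g) * (w * w') \<in> B k" unfolding eq using w loc_alg_mult by blast
    then show ?case using combine[of w w'] w by (intro bexI[of _ "w * w'"]) simp_all
  qed
qed

lemma clear_denominators:
  assumes "k \<le> l" "l \<le> m" "r \<in> B l"
  shows "\<exists>w\<in>F. w \<noteq> 0 \<and> (\<forall>y. D y w = 0) \<and> r * w \<in> B k"
  using assms
proof (induction l arbitrary: r rule: dec_induct)
  case base
  then show ?case by (intro bexI[of _ 1]) (simp_all add: FD.one_closed)
next
  case (step l)
  obtain w where w: "w \<in> B l" "w \<noteq> 0" "\<forall>y. D y w = 0" "r * w \<in> B l"
    using clear_denominators_step[of l r] step.prems by auto
  obtain w' where w': "w' \<in> F" "w' \<noteq> 0" "\<forall>y. D y w' = 0" "r * w * w' \<in> B k"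
    using step.IH[OF _ w(4)] step.prems by auto
  have "w \<in> F" using w(1) loc_alg_function_field[of l] step.prems by simp
  then show ?case
    using w w' by (intro bexI[of _ "w * w'"]) (simp_all add: FD.D_mult FD.mult_closed mult.assoc)
qed

text \<open>
  The least index exists because \<open>\<uu> n\<close> is the whole Lie algebra, and at the index before it the
  invariants are still those at \<open>i (k - 1)\<close>.
\<close>

lemma index_step:
  assumes "k \<in> {1..m}" "i (k - 1) \<le> n"
  shows "i (k - 1) < i k" "i k \<le> n"
    and "lie_invariants W (B (k - 1)) (\<uu> (i k - 1)) = lie_invariants W (B (k - 1)) (\<uu> (i (k - 1)))"
proof -
  define P where "P j \<longleftrightarrow> i (k - 1) < j \<and> j \<le> n \<and>
      lie_invariants W (B (k - 1)) (\<uu> j) \<noteq> lie_invariants W (B (k - 1)) (\<uu> (i (k - 1)))" for j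
  have i_k: "i k = (LEAST j. P j)" unfolding P_def by (rule step_data(2)[OF assms(1)])
  have "i (k - 1) \<noteq> n" using step_data(1)[OF assms(1)] u_n by metis
  then have "P n" using assms step_data(1)[OF assms(1)] u_n by (simp add: P_def)
  then have P: "P (i k)" unfolding i_k by (rule LeastI)
  then show "i (k - 1) < i k" "i k \<le> n" by (simp_all add: P_def)
  have "\<not> P (i k - 1)"
    using P not_less_Least[of "i k - 1" P] unfolding i_k[symmetric] by (simp add: P_def)
  then show "lie_invariants W (B (k - 1)) (\<uu> (i k - 1)) =
      lie_invariants W (B (k - 1)) (\<uu> (i (k - 1)))"
    using P by (cases "i k - 1 = i (k - 1)") (auto simp: P_def)
qed

lemma index_le: "k \<le> m \<Longrightarrow> i k \<le> n"
proof (induction k)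
  case (Suc k)
  then show ?case using index_step(2)[of "Suc k"] by simp
qed (simp add: i_0)

lemma index_mono: "j \<le> k \<Longrightarrow> k \<le> m \<Longrightarrow> i j \<le> i k"
proof (induction k rule: dec_induct)
  case (step k)
  then show ?case using index_step(1)[of "Suc k"] index_le[of k] by simp
qed simp

text \<open>
  The minimality of \<open>i k\<close> concerns invariants in \<open>B (k - 1)\<close>; clearing invariant denominators
  extends it to \<open>B m\<close>, where all the maps \<open>S\<^sub>k\<close> can be composed.
\<close>

lemma annihilated_up_to_next_index:
  assumes k: "k \<in> {1..m}" and r: "r \<in> B m" "annihilated (\<uu> (i (k - 1))) r"
  shows "annihilated (\<uu> (i k - 1)) r"
proof
  fix y assume y: "y \<in> \<uu> (i k - 1)"
  have rF: "r \<in> F" using r loc_alg_function_field by blast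
  obtain w where w: "w \<in> F" "w \<noteq> 0" "\<forall>y. D y w = 0" "r * w \<in> B (k - 1)"
    using clear_denominators[OF _ order_refl r(1), of "k - 1"] k by fastforce
  have D_rw: "D z (r * w) = D z r * w" for z
    using FD.D_mult[OF rF w(1)] w(3) by simp
  have "r * w \<in> lie_invariants W (B (k - 1)) (\<uu> (i (k - 1)))"
    using w r D_rw by (simp add: lie_invariants_def)
  then have "r * w \<in> lie_invariants W (B (k - 1)) (\<uu> (i k - 1))"
    using index_step(3)[OF k] index_le[of "k - 1"] k by auto
  then have "D y (r * w) = 0" using y unfolding lie_invariants_def by blast
  then have "D y r * w = 0" unfolding D_rw .
  then show "D y r = 0" using w by simp
qed

abbreviation "Q k \<equiv> a1 k / a0 k"
abbreviation "S k \<equiv> S_map (D (x k)) (Q k)"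
abbreviation "P \<equiv> projector W x a0 a1"

lemma Q_in: "k \<in> {1..m} \<Longrightarrow> Q k \<in> B m"
  using a1_in inverse_a0_in loc_alg_mult by (simp add: divide_inverse)

lemma deriv_Q:
  assumes k: "k \<in> {1..m}"
  shows "D (x k) (Q k) = 1" and "annihilated (\<uu> (i k - 1)) (Q k)"
proof -
  have F: "a0 k \<in> F" "a1 k \<in> F" using k a0_in a1_in loc_alg_function_field by blast+
  have D_Q: "D y (Q k) = D y (a1 k) / a0 k" for y
    using FD.D_divide_kernel[OF F(2,1) a0_invariant[OF k]] .
  show "D (x k) (Q k) = 1" using D_Q step_data(6,7)[OF k] by simp
  show "annihilated (\<uu> (i k - 1)) (Q k)"
    using D_Q annihilated_up_to_next_index[OF k a1_in[OF k] a1_annihilated[OF k]] by simp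
qed

text \<open>
  The step from \<open>\<uu> (i (k - 1))\<close> to \<open>\<uu> (i k)\<close>: the ideal \<open>\<uu> (i k - 1)\<close> kills \<open>Q k\<close> and all iterated derivatives
  of \<open>r\<close>, the element \<open>x k\<close> kills the value of \<open>S k\<close>, and together they span \<open>\<uu> (i k)\<close>.
\<close>

lemma S_annihilated:
  assumes k: "k \<in> {1..m}" and r: "r \<in> B m" "annihilated (\<uu> (i (k - 1))) r"
  shows "S k r \<in> B m" "annihilated (\<uu> (i k)) (S k r)"
proof -
  have F: "r \<in> F" "Q k \<in> F" using k r Q_in loc_alg_function_field by blast+
  have nil: "FD.nilpotent_at (x k) r" using r loc_alg_nilpotent by blast
  obtain d where d: "\<And>j. j > d \<Longrightarrow> (D (x k) ^^ j) r = 0" using FD.S_map_bound[OF nil] by blast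
  have "S k r = (\<Sum>j\<le>d. (- Q k) ^ j * ((D (x k) ^^ j) r * scalar_ff W (inverse (fact j))))"
    using FD.S_map_eq[of d "x k" r "Q k"] d by (simp add: scalar_ff_inverse_fact divide_inverse)
  then show "S k r \<in> B m"
    using k r by (auto intro!: loc_alg_sum loc_alg_mult loc_alg_power loc_alg_minus
        loc_alg_scalar loc_alg_iter Q_in)
  obtain j where j: "i k = Suc j" "j < n"
    using index_step(1,2)[OF k] index_le[of "k - 1"] k by (cases "i k") auto
  have "annihilated (\<uu> (Suc j)) (S k r)"
  proof (rule annihilated_Suc[OF j(2)])
    show "x k \<in> \<uu> (Suc j) - \<uu> j" using step_data(3)[OF k] j by simp
    show "S k r \<in> F" by (rule FD.S_map_closed[OF F])
    show "D (x k) (S k r) = 0" by (rule FD.D_S_map[OF F(1) nil F(2) deriv_Q(1)[OF k]])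
    show "annihilated (\<uu> j) (S k r)"
    proof
      fix y assume y: "y \<in> \<uu> j"
      have "annihilated (\<uu> j) r" using annihilated_up_to_next_index[OF k r] j by simp
      then have "D y ((D (x k) ^^ l) r) = 0" for l
        using annihilated_iter[of j r] F j y by simp
      moreover have "D y (Q k) = 0" using deriv_Q(2)[OF k] j y by simp
      ultimately show "D y (S k r) = 0"
        by (intro FD.S_map_annihilated[OF subfield_derivation_deriv_ff F])
    qed
  qed
  then show "annihilated (\<uu> (i k)) (S k r)" using j by simp
qed

lemma projector_in:
  assumes "k \<le> m" "r \<in> B m"
  shows "P k r \<in> B m \<and> annihilated (\<uu> (i k)) (P k r)"
  using assms(1)
proof (induction k)
  case 0
  have "r \<in> F" using assms loc_alg_function_field by blast
  then have "D 0 r = 0" using deriv_ff_linear(1)[of r 0 0] by simp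
  then show ?case using assms by (simp add: i_0 u_0)
next
  case (Suc k)
  then show ?case using S_annihilated[of "Suc k" "P k r"] by simp
qed

lemma projector_hom:
  assumes "k \<le> m" "f \<in> B m" "g \<in> B m"
  shows "P k (f + g) = P k f + P k g" "P k (f * g) = P k f * P k g"
proof -
  have "P k (f + g) = P k f + P k g \<and> P k (f * g) = P k f * P k g"
    using assms(1)
  proof (induction k)
    case (Suc k)
    have F: "P k f \<in> F" "P k g \<in> F" and nil: "FD.nilpotent_at y (P k f)" "FD.nilpotent_at y (P k g)" for y
      using projector_in[of k] assms Suc.prems loc_alg_function_field[of m] loc_alg_nilpotent[of m] by auto
    show ?case
      using Suc FD.S_map_add[OF F nil] FD.S_map_mult[OF F nil] by simp
  qed simp
  then show "P k (f + g) = P k f + P k g" "P k (f * g) = P k f * P k g" by blast+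
qed

lemma projector_fixes:
  assumes "\<And>y. D y r = 0"
  shows "P k r = r"
  by (induction k) (simp_all add: FD.S_map_kernel assms)

lemma projector_sum:
  assumes "\<And>j. j \<in> J \<Longrightarrow> f j \<in> B m"
  shows "P m (sum f J) = (\<Sum>j\<in>J. P m (f j))"
  using assms
proof (induction J rule: infinite_finite_induct)
  case (insert j J)
  then show ?case by (simp add: projector_hom(1) loc_alg_sum)
qed (simp_all add: projector_fixes)

text \<open>
  \<open>S\<^sub>1, \<dots>, S\<^sub>k\<^sub>-\<^sub>1\<close> fix \<open>a1 k\<close>, and \<open>S\<^sub>k\<close> sends it to \<open>a1 k - Q k * a0 k = 0\<close>.
\<close>

lemma projector_kills_a1:
  assumes k: "k \<in> {1..m}"
  shows "P m (a1 k) = 0"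
proof -
  have fixed: "P j (a1 k) = a1 k" if "j < k" for j
    using that
  proof (induction j)
    case (Suc j)
    have "x (Suc j) \<in> \<uu> (i (Suc j))" using step_data(3)[of "Suc j"] Suc.prems k by simp
    moreover have "\<uu> (i (Suc j)) \<subseteq> \<uu> (i (k - 1))"
      using Suc.prems k index_mono[of "Suc j" "k - 1"] index_le[of "k - 1"] by (intro u_mono) auto
    ultimately have "D (x (Suc j)) (a1 k) = 0" using a1_annihilated[OF k] by blast
    then show ?case using Suc by (simp add: FD.S_map_kernel)
  qed simp
  have "S k (a1 k) = 0"
  proof -
    have "(D (x k) ^^ j) (a1 k) = 0" if "j > 1" for j
    proof (rule FD.iter_vanish_mono[of 2])
      show "(D (x k) ^^ 2) (a1 k) = 0"
        by (simp add: numeral_2_eq_2 step_data(7)[OF k] a0_invariant[OF k])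
    qed (use that in simp)
    then have "S k (a1 k) = (\<Sum>j\<le>1. (- Q k) ^ j * ((D (x k) ^^ j) (a1 k) / fact j))"
      by (rule FD.S_map_eq)
    then show ?thesis using step_data(6,7)[OF k] by simp
  qed
  moreover obtain j where j: "k = Suc j" using k by (cases k) auto
  ultimately have "P k (a1 k) = 0" using fixed[of j] by simp
  then have "P (k + l) (a1 k) = 0" for l
    by (induction l) (simp_all add: FD.S_map_kernel)
  from this[of "m - k"] show ?thesis using k by simp
qed

text \<open>
  The construction stops when annihilation by \<open>\<uu> (i m)\<close> already means invariance.
\<close>

lemma projector_image: "P m ` B m = lie_invariants W (B m) UNIV"
proof
  show "P m ` B m \<subseteq> lie_invariants W (B m) UNIV"
    using projector_in[of m] unfolding stable_m by (auto simp: lie_invariants_def)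
  show "lie_invariants W (B m) UNIV \<subseteq> P m ` B m"
    using projector_fixes[symmetric] by (fastforce simp: lie_invariants_def)
qed

end

section \<open>Restriction to the slice\<close>

context unipotent_action
begin

text \<open>
  As for derivatives, cross-multiplication shows that the value does not depend on the fraction.
\<close>

lemma ff_value_eq:
  assumes "f \<in> A" "g \<in> A" "g p \<noteq> 0" "r * emb W g = emb W f"
  shows "ff_value W r p = f p / g p"
  unfolding ff_value_def
proof (rule the_equality)
  have nonzero: "emb W g \<noteq> 0" if "g \<in> A" "g p \<noteq> 0" for g
    using that emb_eq_0[of g] by auto
  have "r = emb W f / emb W g" using assms nonzero[of g] by (simp add: field_simps)
  then show "\<exists>f'\<in>A. \<exists>g'\<in>A. g' p \<noteq> 0 \<and> r = emb W f' / emb W g' \<and> f p / g p = f' p / g' p"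
    using assms by blast
  fix v assume "\<exists>f\<in>A. \<exists>g\<in>A. g p \<noteq> 0 \<and> r = emb W f / emb W g \<and> v = f p / g p"
  then obtain f' g' where f': "f' \<in> A" "g' \<in> A" "g' p \<noteq> 0" "r = emb W f' / emb W g'"
    and v: "v = f' p / g' p" by blast
  have "emb W g' \<noteq> 0" by (rule nonzero) fact+
  then have rf': "r * emb W g' = emb W f'" using f'(4) by simp
  have "emb W (f * g') = emb W (f' * g)"
    using assms(1,2) f'(1,2) by (simp add: emb_mult flip: assms(4) rf')
  then have "f * g' = f' * g" using assms f' emb_inj coord_ring_mult by metis
  then have "f p * g' p = f' p * g p" by (metis times_fun_apply)
  then show "v = f p / g p" using assms(3) f'(3) v by (simp add: frac_eq_eq)
qed

lemma regular_atE:
  assumes "regular_at W r p"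
  obtains f g where "f \<in> A" "g \<in> A" "g p \<noteq> 0" "r * emb W g = emb W f"
proof -
  obtain f g where "f \<in> A" "g \<in> A" "g p \<noteq> 0" "r = emb W f / emb W g"
    using assms by (auto simp: regular_at_def)
  moreover from this have "emb W g \<noteq> 0" using emb_eq_0[of g] by auto
  ultimately show thesis using that[of f g] by simp
qed

lemma regular_atI:
  assumes "f \<in> A" "g \<in> A" "g p \<noteq> 0" "r * emb W g = emb W f"
  shows "regular_at W r p"
proof -
  have "emb W g \<noteq> 0" using assms emb_eq_0[of g] by auto
  then have "r = emb W f / emb W g" using assms by (simp add: field_simps)
  then show ?thesis using assms unfolding regular_at_def by blast
qed

lemma ff_value_add:
  assumes "regular_at W r p" "regular_at W r' p"
  shows "regular_at W (r + r') p" "ff_value W (r + r') p = ff_value W r p + ff_value W r' p"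
proof -
  obtain f g where f: "f \<in> A" "g \<in> A" "g p \<noteq> 0" "r * emb W g = emb W f"
    using regular_atE[OF assms(1)] .
  obtain f' g' where f': "f' \<in> A" "g' \<in> A" "g' p \<noteq> 0" "r' * emb W g' = emb W f'"
    using regular_atE[OF assms(2)] .
  have sum: "f * g' + f' * g \<in> A" "g * g' \<in> A" "(g * g') p \<noteq> 0"
    "(r + r') * emb W (g * g') = emb W (f * g' + f' * g)"
    using f f' by (simp_all add: coord_ring_add coord_ring_mult emb_add emb_mult algebra_simps
        flip: f(4) f'(4))
  show "regular_at W (r + r') p" by (rule regular_atI[OF sum])
  show "ff_value W (r + r') p = ff_value W r p + ff_value W r' p"
    unfolding ff_value_eq[OF sum] ff_value_eq[OF f] ff_value_eq[OF f']
    using f f' by (simp add: field_simps)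
qed

lemma ff_value_mult:
  assumes "regular_at W r p" "regular_at W r' p"
  shows "regular_at W (r * r') p" "ff_value W (r * r') p = ff_value W r p * ff_value W r' p"
proof -
  obtain f g where f: "f \<in> A" "g \<in> A" "g p \<noteq> 0" "r * emb W g = emb W f"
    using regular_atE[OF assms(1)] .
  obtain f' g' where f': "f' \<in> A" "g' \<in> A" "g' p \<noteq> 0" "r' * emb W g' = emb W f'"
    using regular_atE[OF assms(2)] .
  have prod: "f * f' \<in> A" "g * g' \<in> A" "(g * g') p \<noteq> 0"
    "(r * r') * emb W (g * g') = emb W (f * f')"
    using f f' by (simp_all add: coord_ring_mult emb_mult flip: f(4) f'(4))
  show "regular_at W (r * r') p" by (rule regular_atI[OF prod])
  show "ff_value W (r * r') p = ff_value W r p * ff_value W r' p"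
    unfolding ff_value_eq[OF prod] ff_value_eq[OF f] ff_value_eq[OF f'] by simp
qed

lemma ff_value_inverse:
  assumes "regular_at W r p" "ff_value W r p \<noteq> 0"
  shows "regular_at W (inverse r) p" "ff_value W (inverse r) p = inverse (ff_value W r p)"
proof -
  obtain f g where f: "f \<in> A" "g \<in> A" "g p \<noteq> 0" "r * emb W g = emb W f"
    using regular_atE[OF assms(1)] .
  have val: "ff_value W r p = f p / g p" by (rule ff_value_eq[OF f])
  then have fp: "f p \<noteq> 0" using assms(2) by auto
  then have "emb W f \<noteq> 0" using f emb_eq_0[of f] by auto
  then have "r \<noteq> 0" using f by auto
  then have "inverse r * emb W f = emb W g" by (simp flip: f(4))
  note inv = f(2) f(1) fp this
  show "regular_at W (inverse r) p" by (rule regular_atI[OF inv])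
  show "ff_value W (inverse r) p = inverse (ff_value W r p)"
    unfolding ff_value_eq[OF inv] val by simp
qed

lemma ff_value_emb:
  assumes "p \<in> X" "f \<in> A"
  shows "regular_at W (emb W f) p" "ff_value W (emb W f) p = f p"
proof -
  have one: "const 1 \<in> A" "const 1 p \<noteq> 0" "emb W f * emb W (const 1) = emb W f"
    using assms(1) coord_ring_const[of 1] emb_const_1 by (simp_all add: restr_def)
  show "regular_at W (emb W f) p" by (rule regular_atI[OF assms(2) one])
  show "ff_value W (emb W f) p = f p"
    using ff_value_eq[OF assms(2) one] assms(1) by (simp add: restr_def)
qed

lemma ff_value_scalar:
  assumes "p \<in> X"
  shows "regular_at W (scalar_ff W c) p" "ff_value W (scalar_ff W c) p = ext W c"
  using ff_value_emb[OF assms coord_ring_const, of c] assms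
  by (simp_all add: scalar_ff_const restr_def)

end

context projector_construction
begin

text \<open>
  The conditions that define \<open>X\<^sub>0\<close> say that each \<open>inverse (a0 k)\<close> is regular at \<open>p\<close>.
\<close>

lemma regular_on_X0:
  assumes p: "p \<in> X0 W a0 m" and r: "r \<in> B m"
  shows "regular_at W r p"
proof -
  have pX: "p \<in> X" using p by (simp add: X0_def)
  have "regular_at W r p" if "k \<le> m" "r \<in> B k" for k r
    using that
  proof (induction k arbitrary: r)
    case 0
    then show ?case using ff_value_emb(1)[OF pX] by auto
  next
    case (Suc k)
    have "r \<in> gen_alg (scalar_ff W) (B k \<union> {inverse (a0 (Suc k))})" using Suc.prems by simp
    then show ?case
    proof (induction r rule: gen_alg.induct)
      case (gen g)
      have "regular_at W (a0 (Suc k)) p" "ff_value W (a0 (Suc k)) p \<noteq> 0"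
        using p Suc.prems by (auto simp: X0_def)
      then show ?case using gen Suc ff_value_inverse(1) by auto
    qed (auto intro: ff_value_scalar pX ff_value_add ff_value_mult)
  qed
  then show ?thesis using r by blast
qed

abbreviation "\<SS> \<equiv> slice W a0 a1 m"
abbreviation "res \<equiv> Res W a0 a1 m"

lemma slice_X0: "p \<in> \<SS> \<Longrightarrow> p \<in> X0 W a0 m"
  and slice_X: "p \<in> \<SS> \<Longrightarrow> p \<in> X"
  by (auto simp: slice_def X0_def)

lemma res_add: "f \<in> B m \<Longrightarrow> g \<in> B m \<Longrightarrow> res (f + g) = res f + res g"
  and res_mult: "f \<in> B m \<Longrightarrow> g \<in> B m \<Longrightarrow> res (f * g) = res f * res g"
  by (auto simp: Res_def restr_def fun_eq_iff ff_value_add ff_value_mult regular_on_X0 slice_X0)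

lemma res_scalar: "res (scalar_ff W c) = scalar_slice W a0 a1 m c"
  by (auto simp: Res_def scalar_slice_def restr_def fun_eq_iff ff_value_scalar slice_X)

lemma res_inverse_a0: "k \<in> {1..m} \<Longrightarrow> res (inverse (a0 k)) = (\<lambda>p. inverse (res (a0 k) p))"
  using ff_value_inverse(2) slice_X0
  by (fastforce simp: Res_def restr_def fun_eq_iff X0_def)

lemma res_eq_imp_diff_in_slice_ideal:
  assumes "f \<in> B m" "g \<in> B m" "res f = res g"
  shows "f - g \<in> slice_ideal W a0 a1 m"
proof -
  have zero: "res (f - g) = (\<lambda>p. 0)"
    using res_add[of g "f - g"] assms loc_alg_diff[of f m g] by (simp add: zero_fun_def)
  have "ff_value W (f - g) p = 0" if "p \<in> \<SS>" for p
    using fun_cong[OF zero, of p] that by (simp add: Res_def restr_def)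
  then show ?thesis
    using assms loc_alg_diff by (simp add: slice_ideal_def coord_ring_X0_def)
qed

section \<open>Generators of the invariants\<close>

text \<open>
  \<open>P\<close> vanishes on the ideal of the slice, hence factors through the restriction to the slice; so
  two functions that agree on the slice have the same projection.
\<close>

lemma projector_determined_by_res:
  assumes ideal: "slice_ideal W a0 a1 m =
      {\<Sum>k=1..m. c k * a1 k |c. \<forall>k\<in>{1..m}. c k \<in> coord_ring_X0 W a0 m}"
    and "f \<in> B m" "g \<in> B m" "res f = res g"
  shows "P m f = P m g"
proof -
  obtain c where c: "f - g = (\<Sum>k=1..m. c k * a1 k)" "\<forall>k\<in>{1..m}. c k \<in> B m"
    using res_eq_imp_diff_in_slice_ideal[OF assms(2-4)] unfolding ideal coord_ring_X0_def by blast
  have "P m (f - g) = (\<Sum>k=1..m. P m (c k * a1 k))"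
    unfolding c(1) by (rule projector_sum) (use c(2) a1_in loc_alg_mult in blast)
  also have "\<dots> = (\<Sum>k=1..m. P m (c k) * P m (a1 k))"
    using c(2) a1_in by (intro sum.cong refl projector_hom(2)) auto
  also have "\<dots> = 0" using projector_kills_a1 by simp
  finally have "P m (f - g) = 0" .
  moreover have "P m (g + (f - g)) = P m g + P m (f - g)"
    by (rule projector_hom(1)) (use assms loc_alg_diff in auto)
  ultimately show ?thesis by simp
qed

lemma invariants_eq_gen_alg:
  assumes ideal: "slice_ideal W a0 a1 m =
      {\<Sum>k=1..m. c k * a1 k |c. \<forall>k\<in>{1..m}. c k \<in> coord_ring_X0 W a0 m}"
    and G: "G \<subseteq> B m"
    and generate: "gen_alg (scalar_slice W a0 a1 m) (res ` G) = coord_ring_slice W a0 a1 m"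
  shows "gen_alg (scalar_ff W) (P m ` G) = lie_invariants W (B m) UNIV"
proof -
  have sub: "gen_alg (scalar_ff W) G \<subseteq> B m"
  proof
    fix r assume "r \<in> gen_alg (scalar_ff W) G"
    then show "r \<in> B m"
      by (induction r rule: gen_alg.induct) (use G in \<open>auto intro: loc_alg_scalar loc_alg_add loc_alg_mult\<close>)
  qed
  have "res ` gen_alg (scalar_ff W) G = gen_alg (scalar_slice W a0 a1 m) (res ` G)"
    by (rule gen_alg_image) (use sub res_scalar res_add res_mult in blast)+
  then have res_onto: "res ` gen_alg (scalar_ff W) G = res ` B m"
    using generate by (simp add: coord_ring_slice_def coord_ring_X0_def)
  have "gen_alg (scalar_ff W) (P m ` G) = P m ` gen_alg (scalar_ff W) G"
  proof (rule gen_alg_image[symmetric])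
    show "P m (scalar_ff W c) = scalar_ff W c" for c
      by (rule projector_fixes) (rule deriv_ff_scalar)
  qed (use sub projector_hom[OF order_refl] in blast)+
  also have "\<dots> = P m ` B m"
  proof
    show "P m ` B m \<subseteq> P m ` gen_alg (scalar_ff W) G"
    proof
      fix r assume "r \<in> P m ` B m"
      then obtain f where f: "f \<in> B m" "r = P m f" by blast
      then obtain g where g: "g \<in> gen_alg (scalar_ff W) G" "res f = res g"
        using res_onto by (metis imageE imageI)
      then have "r = P m g" using f sub projector_determined_by_res[OF ideal] by blast
      then show "r \<in> P m ` gen_alg (scalar_ff W) G" using g by blast
    qed
  qed (use sub in blast)
  finally show ?thesis by (simp only: projector_image)
qed

text \<open>
  The denominators of an invariant fraction form a \<open>\<uu>\<close>-stable ideal. Going up the chain, let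
  \<open>v\<close> lie in \<open>\<uu> (j + 1)\<close> but not in \<open>\<uu> j\<close>: if \<open>\<uu> j\<close> annihilates \<open>a\<close>, then \<open>\<uu> (j + 1)\<close> annihilates
  the last nonzero one of the iterated derivatives of \<open>a\<close> along \<open>v\<close>.
\<close>

lemma invariant_denominator:
  assumes r: "r \<in> F" "\<And>y. D y r = 0"
  shows "\<exists>a\<in>B 0. a \<noteq> 0 \<and> r * a \<in> B 0 \<and> (\<forall>y. D y a = 0)"
proof -
  have F: "a \<in> F" if "a \<in> B 0" for a using that loc_alg_function_field[of 0] by simp
  have "\<exists>a\<in>B 0. a \<noteq> 0 \<and> r * a \<in> B 0 \<and> annihilated (\<uu> j) a" if "j \<le> n" for j
    using that
  proof (induction j)
    case 0
    obtain f g where f: "f \<in> A" "g \<in> A" "g \<noteq> 0" "emb W g \<noteq> 0" "emb W f = r * emb W g"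
      using function_fieldE[OF r(1)] .
    have "D 0 (emb W g) = 0"
      using deriv_ff_linear(1)[OF emb_in_function_field[OF f(2)], of 0 0] by simp
    then show ?case
      using f by (intro bexI[of _ "emb W g"]) (auto simp: u_0 simp flip: f(5))
  next
    case (Suc j)
    then obtain a where a: "a \<in> B 0" "a \<noteq> 0" "r * a \<in> B 0" "annihilated (\<uu> j) a" by auto
    obtain v where v: "v \<in> \<uu> (Suc j) - \<uu> j" using u_Suc[of j] Suc.prems by auto
    have "\<exists>l. (D v ^^ l) a = 0"
      using loc_alg_nilpotent[of 0 a v] a(1) by (simp add: FD.nilpotent_at_def)
    define N where "N = (LEAST l. (D v ^^ l) a = 0)"
    have N: "(D v ^^ N) a = 0" unfolding N_def by (rule LeastI_ex) fact
    then obtain M where M: "N = Suc M" using a(2) by (cases N) auto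
    define a' where "a' = (D v ^^ M) a"
    have "a' \<noteq> 0" unfolding a'_def using not_less_Least[of M "\<lambda>l. (D v ^^ l) a = 0"] M N_def by auto
    have a'B: "a' \<in> B 0" unfolding a'_def by (rule loc_alg_iter) (use a in auto)
    have "r * (D v ^^ l) a = (D v ^^ l) (r * a)" for l
    proof (induction l)
      case (Suc l)
      have "D v (r * (D v ^^ l) a) = r * D v ((D v ^^ l) a)"
      proof -
        have "(D v ^^ l) a \<in> F" by (rule FD.iter_closed[OF F[OF a(1)]])
        from FD.D_mult[OF r(1) this, of v] show ?thesis using r(2) by simp
      qed
      then show ?case using Suc by simp
    qed simp
    then have "r * a' \<in> B 0" unfolding a'_def using loc_alg_iter[of 0 "r * a"] a by simp
    moreover have "annihilated (\<uu> (Suc j)) a'"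
    proof (rule annihilated_Suc[OF _ v F[OF a'B]])
      show "annihilated (\<uu> j) a'"
        unfolding a'_def by (rule annihilated_iter) (use Suc.prems F a in auto)
      show "D v a' = 0" using N unfolding a'_def M by simp
    qed (use Suc.prems in simp)
    ultimately show ?case using \<open>a' \<noteq> 0\<close> a'B by blast
  qed
  from this[of n] show ?thesis by (simp add: u_n)
qed

text \<open>
  An invariant fraction \<open>r\<close> is \<open>(r a) / a\<close> with \<open>a\<close> and \<open>r a\<close> invariant in \<open>K[X]\<close>.
\<close>

lemma field_invariants_eq_gen_field:
  assumes generate: "gen_alg (scalar_ff W) G = lie_invariants W (B m) UNIV"
  shows "gen_field (scalar_ff W) G = lie_invariants W F UNIV"
proof
  have G: "g \<in> F \<and> (\<forall>y. D y g = 0)" if "g \<in> G" for g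
  proof -
    have "g \<in> lie_invariants W (B m) UNIV"
      using gen_alg.gen[OF that] generate by blast
    then show ?thesis using loc_alg_function_field[of m g] by (simp add: lie_invariants_def)
  qed
  show "gen_field (scalar_ff W) G \<subseteq> lie_invariants W F UNIV"
  proof
    fix r assume "r \<in> gen_field (scalar_ff W) G"
    then have "r \<in> F \<and> (\<forall>y. D y r = 0)"
      by (induction r rule: gen_field.induct)
        (auto simp: scalar_ff_in_function_field deriv_ff_scalar G FD.closed FD.D_add FD.D_mult
          FD.D_inverse_kernel)
    then show "r \<in> lie_invariants W F UNIV" by (simp add: lie_invariants_def)
  qed
  have sub: "gen_alg (scalar_ff W) G \<subseteq> gen_field (scalar_ff W) G"
  proof
    fix r assume "r \<in> gen_alg (scalar_ff W) G"
    then show "r \<in> gen_field (scalar_ff W) G"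
      by (induction r rule: gen_alg.induct) (auto intro: gen_field.intros)
  qed
  show "lie_invariants W F UNIV \<subseteq> gen_field (scalar_ff W) G"
  proof
    fix r assume "r \<in> lie_invariants W F UNIV"
    then have r: "r \<in> F" "\<And>y. D y r = 0" by (auto simp: lie_invariants_def)
    then obtain a where a: "a \<in> B 0" "a \<noteq> 0" "r * a \<in> B 0" "\<forall>y. D y a = 0"
      using invariant_denominator by blast
    have "a \<in> F" using a loc_alg_function_field[of 0] by simp
    then have "D y (r * a) = 0" for y using FD.D_mult[OF r(1)] r(2) a(4) by simp
    then have "a \<in> lie_invariants W (B m) UNIV" "r * a \<in> lie_invariants W (B m) UNIV"
      using a loc_alg_mono[of 0 m] unfolding lie_invariants_def by blast+
    then have "r * a \<in> gen_field (scalar_ff W) G" "inverse a \<in> gen_field (scalar_ff W) G"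
      using generate sub by (blast intro: gen_field.inv)+
    then have "r * a * inverse a \<in> gen_field (scalar_ff W) G" by (rule gen_field.mult)
    moreover have "r * a * inverse a = r" using a(2) by simp
    ultimately show "r \<in> gen_field (scalar_ff W) G" by simp
  qed
qed

end

theorem theorem2p3:
  fixes W :: "('k::field_char_0, 'l::field_char_0, 'n::finite, 'u::ab_group_add, 'f::field_char_0) uvariety"
    and \<uu> :: "nat \<Rightarrow> 'u set" and i :: "nat \<Rightarrow> nat" and x :: "nat \<Rightarrow> 'u"
    and a0 a1 b :: "nat \<Rightarrow> 'f" and n m s :: nat
  assumes "field_embedding (ext W)"
    and "fd_nilpotent_lie_algebra (smult W) (bracket W)"
    and "irreducible_affine_variety W"
    and "rational_action W"
    and "fraction_embedding W"
    and "ideal_chain W n \<uu>"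
    and "projector_data W n \<uu> m i x a0 a1"
    and "slice_ideal W a0 a1 m =
           {\<Sum>k=1..m. c k * a1 k |c. \<forall>k\<in>{1..m}. c k \<in> coord_ring_X0 W a0 m}"
    and "\<forall>j\<in>{1..s}. b j \<in> emb W ` coord_ring W"
    and "gen_alg (scalar_slice W a0 a1 m)
           ({Res W a0 a1 m (b j) |j. j \<in> {1..s}} \<union>
            {Res W a0 a1 m (a0 k) |k. k \<in> {1..m}} \<union>
            {\<lambda>p. inverse (Res W a0 a1 m (a0 k) p) |k. k \<in> {1..m}})
         = coord_ring_slice W a0 a1 m"
  shows "gen_alg (scalar_ff W)
           ({projector W x a0 a1 m (b j) |j. j \<in> {1..s}} \<union>
            {a0 k |k. k \<in> {1..m}} \<union> {inverse (a0 k) |k. k \<in> {1..m}})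
         = group_invariants W (coord_ring_X0 W a0 m) \<and>
         gen_field (scalar_ff W)
           ({projector W x a0 a1 m (b j) |j. j \<in> {1..s}} \<union>
            {a0 k |k. k \<in> {1..m}} \<union> {inverse (a0 k) |k. k \<in> {1..m}})
         = group_invariants W (function_field W)"
proof -
  interpret projector_construction W \<uu> i x a0 a1 n m
    by unfold_locales (fact assms)+
  define G where "G = b ` {1..s} \<union> a0 ` {1..m} \<union> (\<lambda>k. inverse (a0 k)) ` {1..m}"
  have "b j \<in> B m" if "j \<in> {1..s}" for j
    using that assms(9) loc_alg_mono[of 0 m] by auto
  then have G: "G \<subseteq> B m" unfolding G_def using a0_in inverse_a0_in by auto
  have inv: "P m (a0 k) = a0 k" "P m (inverse (a0 k)) = inverse (a0 k)" if "k \<in> {1..m}" for k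
  proof -
    have "a0 k \<in> F" using that a0_in loc_alg_function_field by blast
    then show "P m (a0 k) = a0 k" "P m (inverse (a0 k)) = inverse (a0 k)"
      using that by (auto intro!: projector_fixes FD.D_inverse_kernel a0_invariant)
  qed
  have "res ` G = {res (b j) |j. j \<in> {1..s}} \<union> {res (a0 k) |k. k \<in> {1..m}} \<union>
      {\<lambda>p. inverse (res (a0 k) p) |k. k \<in> {1..m}}"
  proof -
    have "(\<lambda>k. res (inverse (a0 k))) ` {1..m} = (\<lambda>k p. inverse (res (a0 k) p)) ` {1..m}"
      by (intro image_cong refl res_inverse_a0)
    then show ?thesis unfolding G_def image_Un image_image Setcompr_eq_image by simp
  qed
  then have "gen_alg (scalar_slice W a0 a1 m) (res ` G) = coord_ring_slice W a0 a1 m"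
    using assms(10) by simp
  from invariants_eq_gen_alg[OF assms(8) G this]
  have algebra: "gen_alg (scalar_ff W) (P m ` G) = lie_invariants W (B m) UNIV" .
  have PG: "P m ` G = {P m (b j) |j. j \<in> {1..s}} \<union> {a0 k |k. k \<in> {1..m}} \<union>
      {inverse (a0 k) |k. k \<in> {1..m}}"
  proof -
    have "(\<lambda>k. P m (a0 k)) ` {1..m} = a0 ` {1..m}"
      "(\<lambda>k. P m (inverse (a0 k))) ` {1..m} = (\<lambda>k. inverse (a0 k)) ` {1..m}"
      by (intro image_cong refl inv; assumption)+
    then show ?thesis unfolding G_def image_Un image_image Setcompr_eq_image by simp
  qed
  have "group_invariants W (coord_ring_X0 W a0 m) = lie_invariants W (B m) UNIV"
    unfolding coord_ring_X0_def
    by (rule group_invariants_eq) (use loc_alg_function_field in blast)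
  moreover have "group_invariants W F = lie_invariants W F UNIV"
    by (rule group_invariants_eq) simp
  ultimately show ?thesis
    using algebra field_invariants_eq_gen_field[OF algebra] unfolding PG by simp
qed

end
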